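(* Let $\Omega\subset\mathbb{R}^d$ ($d\ge1$) be a bounded open polyhedral set. Let $(\mathcal M^{(m)})_{m\in\mathbb N}$ be a sequence of meshes of $\Omega$ (each equipped with points $(\mathbf x_K)_K$ and a dual mesh $(D_\sigma)_\sigma$) such that $h_{\mathcal M^{(m)}}\to0$ as $m\to+\infty$, and suppose that there exists $\theta^\nabla\in\mathbb R_+$ such that $\theta^\nabla_{\mathcal M^{(m)}}\le\theta^\nabla$ for all $m\in\mathbb N$. Let $\varphi\in C_c^\infty(\Omega)$ and, for $m\in\mathbb N$, let $\nabla_{\mathcal E^{(m)}}\varphi\in L^\infty(\Omega)^d$ be the discrete gradient of $\varphi$ associated with $\mathcal M^{(m)}$. Then the sequence $(\nabla_{\mathcal E^{(m)}}\varphi)_{m\in\mathbb N}$ is bounded in $L^\infty(\Omega)^d$ uniformly with respect to $m$ and converges to $\nabla\varphi$ in $L^\infty(\Omega)^d$ weak $\star$.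
   Context: Mesh. A mesh $\mathcal M$ of $\Omega$ is a finite partition of $\Omega$ (up to null sets) into measurable polyhedral sets $K$ (cells); the boundary of each $K$ is a finite union of parts of hyperplanes, the faces of $K$: $\partial K=\cup_{\sigma\in\mathcal E_K}\sigma$, where $\mathcal E_K$ is the set of faces of $K$. $\mathcal E=\cup_K\mathcal E_K$ is the set of all faces and $|\sigma|$ is the $(d-1)$-dimensional measure of $\sigma$. A face is interior ($\sigma\in\mathcal E_{\rm int}$) if it is shared by two distinct cells $K,L$, i.e. $\sigma\in\mathcal E_K\cap\mathcal E_L$, written $\sigma=K|L$; the remaining (exterior) faces $\mathcal E_{\rm ext}=\mathcal E\setminus\mathcal E_{\rm int}$ lie on $\partial\Omega$. $h_K$ is the diameter of $K$ and $h_{\mathcal M}=\max_K h_K$. $\mathbf n_{K,\sigma}$ is the unit normal vector to $\sigma\in\mathcal E_K$ outward $K$. $|A|$ is the Lebesgue measure of $A\subset\mathbb{R}^d$. Each mesh comes with a choice of points $\mathbf x_K\in K$, $K\in\mathcal M$, and with a dual mesh: a partition $\Omega=\cup_{\sigma\in\mathcal E}D_\sigma$ (up to null sets) into measurable sets indexed by the faces, where for $\sigma=K|L$ one has $D_\sigma\subset K\cup L$ and $|D_\sigma|>0$. Regularity parameter: $$\theta^\nabla_{\mathcal M}=\max_{\sigma\in\mathcal E_{\rm int},\,\sigma=K|L}\frac{|\sigma|\,|\mathbf x_L-\mathbf x_K|}{|D_\sigma|}.$$ Discrete gradient: for $\varphi\in C_c^\infty(\Omega)$ put $\varphi_K=\varphi(\mathbf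 x_K)$; $\nabla_{\mathcal E}\varphi$ is the piecewise constant function equal on each $D_\sigma$ to $$(\nabla_{\mathcal E}\varphi)_\sigma=\frac{|\sigma|}{|D_\sigma|}(\varphi_L-\varphi_K)\,\mathbf n_{K,\sigma}\ \text{ if }\sigma\in\mathcal E_{\rm int},\ \sigma=K|L,\qquad (\nabla_{\mathcal E}\varphi)_\sigma=0\ \text{ if }\sigma\in\mathcal E_{\rm ext}.$$ *)

theory Defs
  imports "HOL-Analysis.Analysis" "HOL-Probability.Essential_Supremum"
begin

text \<open>The prism of height 1 over a subset A of a hyperplane. By Fubini, its d-dimensional Lebesgue
  measure is the (d-1)-dimensional Lebesgue measure of A; for d = 1 this is the counting measure.
  If A lies in several hyperplanes, the prism is negligible whichever normal is selected, and
  replacing n by -n only translates it.\<close>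

definition unit_prism :: "'a::euclidean_space set \<Rightarrow> 'a set" where
  "unit_prism A =
     (let n = (SOME n. norm n = 1 \<and> (\<exists>c. A \<subseteq> {x. n \<bullet> x = c}))
      in {x + t *\<^sub>R n | x t. x \<in> A \<and> 0 \<le> t \<and> t \<le> 1})"

definition area :: "'a::euclidean_space set \<Rightarrow> real" where
  "area A = measure lebesgue (unit_prism A)"

definition surface_null :: "'a::euclidean_space set \<Rightarrow> bool" where
  "surface_null A \<longleftrightarrow> negligible (unit_prism A)"

text \<open>Not necessarily convex (unlike the library's \<^const>\<open>polyhedron\<close>): the boundary is made of
  parts of finitely many hyperplanes.\<close>

definition polyhedral :: "'a::euclidean_space set \<Rightarrow> bool" where
  "polyhedral S \<longleftrightarrow>
     (\<exists>H. finite H \<and> (\<forall>P\<in>H. \<exists>n c. n \<noteq> 0 \<and> P = {x. n \<bullet> x = c}) \<and> frontier S \<subseteq> \<Union>H)"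

text \<open>At almost every point of the face, K lies on the side of -n and its complement on the side
  of n. Interior and closure make this insensitive to whether K is taken open or closed.\<close>

definition outward_normal :: "'a::euclidean_space set \<Rightarrow> 'a set \<Rightarrow> 'a \<Rightarrow> bool" where
  "outward_normal K \<sigma> n \<longleftrightarrow>
     norm n = 1 \<and> (\<exists>c. \<sigma> \<subseteq> {x. n \<bullet> x = c}) \<and>
     surface_null {x \<in> \<sigma>. \<not> (\<forall>\<^sub>F t in at_right (0::real).
                               x - t *\<^sub>R n \<in> interior K \<and> x + t *\<^sub>R n \<notin> closure K)}"

text \<open>Unique as soon as \<open>area \<sigma> > 0\<close>.\<close>

definition normal_vec :: "'a::euclidean_space set \<Rightarrow> 'a set \<Rightarrow> 'a" where
  "normal_vec K \<sigma> = (SOME n. outward_normal K \<sigma> n)"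

definition null_partition :: "'a::euclidean_space set \<Rightarrow> 'i set \<Rightarrow> ('i \<Rightarrow> 'a set) \<Rightarrow> bool" where
  "null_partition \<Omega> I A \<longleftrightarrow>
     finite I \<and> (\<forall>i\<in>I. A i \<in> sets lebesgue) \<and>
     (\<forall>i\<in>I. \<forall>j\<in>I. i \<noteq> j \<longrightarrow> negligible (A i \<inter> A j)) \<and>
     negligible (\<Omega> - (\<Union>i\<in>I. A i)) \<and> negligible ((\<Union>i\<in>I. A i) - \<Omega>)"

record 'a mesh =
  cells :: "'a set set"
  cell_faces :: "'a set \<Rightarrow> 'a set set"
  cell_point :: "'a set \<Rightarrow> 'a"
  dual_cell :: "'a set \<Rightarrow> 'a set"

definition all_faces :: "'a mesh \<Rightarrow> 'a set set" where
  "all_faces M = (\<Union>K\<in>cells M. cell_faces M K)"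

text \<open>\<open>separates M \<sigma> K L\<close> is the relation written \<open>\<sigma> = K|L\<close>.\<close>

definition separates :: "'a mesh \<Rightarrow> 'a set \<Rightarrow> 'a set \<Rightarrow> 'a set \<Rightarrow> bool" where
  "separates M \<sigma> K L \<longleftrightarrow>
     K \<in> cells M \<and> L \<in> cells M \<and> K \<noteq> L \<and> \<sigma> \<in> cell_faces M K \<and> \<sigma> \<in> cell_faces M L"

definition int_faces :: "'a mesh \<Rightarrow> 'a set set" where
  "int_faces M = {\<sigma>. \<exists>K L. separates M \<sigma> K L}"

definition ext_faces :: "'a mesh \<Rightarrow> 'a set set" where
  "ext_faces M = all_faces M - int_faces M"

definition is_mesh :: "'a::euclidean_space set \<Rightarrow> 'a mesh \<Rightarrow> bool" where
  "is_mesh \<Omega> M \<longleftrightarrow>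
     null_partition \<Omega> (cells M) (\<lambda>K. K) \<and>
     (\<forall>K\<in>cells M.
        K \<subseteq> closure \<Omega> \<and> polyhedral K \<and>
        finite (cell_faces M K) \<and> frontier K = \<Union>(cell_faces M K) \<and>
        (\<forall>\<sigma>\<in>cell_faces M K. \<sigma> \<in> sets borel \<and> (\<exists>n. outward_normal K \<sigma> n)) \<and>
        (\<forall>\<sigma>\<in>cell_faces M K. \<forall>\<tau>\<in>cell_faces M K. \<sigma> \<noteq> \<tau> \<longrightarrow> surface_null (\<sigma> \<inter> \<tau>)) \<and>
        cell_point M K \<in> K) \<and>
     (\<forall>\<sigma>\<in>ext_faces M. \<sigma> \<subseteq> frontier \<Omega>) \<and>
     null_partition \<Omega> (all_faces M) (dual_cell M) \<and>
     (\<forall>\<sigma> K L. separates M \<sigma> K L \<longrightarrow>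
        dual_cell M \<sigma> \<subseteq> K \<union> L \<and> measure lebesgue (dual_cell M \<sigma>) > 0)"

definition mesh_size :: "'a::euclidean_space mesh \<Rightarrow> real" where
  "mesh_size M = Max (diameter ` cells M)"

text \<open>All the quotients are nonnegative; the inserted 0 only matters if there is no interior face.\<close>

definition theta_grad :: "'a::euclidean_space mesh \<Rightarrow> real" where
  "theta_grad M =
     Max (insert 0 {area \<sigma> * norm (cell_point M L - cell_point M K) / measure lebesgue (dual_cell M \<sigma>)
                    | \<sigma> K L. separates M \<sigma> K L})"

fun C_k :: "nat \<Rightarrow> ('a::euclidean_space \<Rightarrow> real) \<Rightarrow> bool" where
  "C_k 0 f \<longleftrightarrow> continuous_on UNIV f"
| "C_k (Suc k) f \<longleftrightarrow>
     (\<forall>x. f differentiable (at x)) \<and>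
     (\<forall>b\<in>Basis. C_k k (\<lambda>x. frechet_derivative f (at x) b))"

text \<open>The functions are defined on the whole space, i.e. extended by 0 outside \<open>\<Omega>\<close>.\<close>

definition test_functions :: "'a::euclidean_space set \<Rightarrow> ('a \<Rightarrow> real) set" where
  "test_functions \<Omega> =
     {f. (\<forall>k. C_k k f) \<and> compact (closure {x. f x \<noteq> 0}) \<and> closure {x. f x \<noteq> 0} \<subseteq> \<Omega>}"

definition grad :: "('a::euclidean_space \<Rightarrow> real) \<Rightarrow> 'a \<Rightarrow> 'a" where
  "grad f x = (\<Sum>b\<in>Basis. frechet_derivative f (at x) b *\<^sub>R b)"

text \<open>The value does not depend on which of the two orderings of the cells \<open>K, L\<close> is selected,
  because the two outward normals are opposite.\<close>

definition face_grad :: "'a::euclidean_space mesh \<Rightarrow> ('a \<Rightarrow> real) \<Rightarrow> 'a set \<Rightarrow> 'a" where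
  "face_grad M \<phi> \<sigma> =
     (if \<sigma> \<in> int_faces M
      then let (K, L) = (SOME (K, L). separates M \<sigma> K L)
           in (area \<sigma> / measure lebesgue (dual_cell M \<sigma>) *
               (\<phi> (cell_point M L) - \<phi> (cell_point M K))) *\<^sub>R normal_vec K \<sigma>
      else 0)"

text \<open>The dual cells overlap only on null sets, so almost everywhere a single term is present.\<close>

definition discrete_grad :: "'a::euclidean_space mesh \<Rightarrow> ('a \<Rightarrow> real) \<Rightarrow> 'a \<Rightarrow> 'a" where
  "discrete_grad M \<phi> x = (\<Sum>\<sigma>\<in>all_faces M. indicator (dual_cell M \<sigma>) x *\<^sub>R face_grad M \<phi> \<sigma>)"

definition Linf_norm :: "'a::euclidean_space set \<Rightarrow> ('a \<Rightarrow> 'a) \<Rightarrow> ereal" where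
  "Linf_norm \<Omega> f = esssup (lebesgue_on \<Omega>) (\<lambda>x. ereal (norm (f x)))"

definition Linf :: "'a::euclidean_space set \<Rightarrow> ('a \<Rightarrow> 'a) set" where
  "Linf \<Omega> = {f. f \<in> borel_measurable (lebesgue_on \<Omega>) \<and> Linf_norm \<Omega> f < \<infinity>}"

definition Linf_bounded :: "'a::euclidean_space set \<Rightarrow> (nat \<Rightarrow> 'a \<Rightarrow> 'a) \<Rightarrow> bool" where
  "Linf_bounded \<Omega> G \<longleftrightarrow>
     (\<forall>m. G m \<in> Linf \<Omega>) \<and> (\<exists>C::real. \<forall>m. Linf_norm \<Omega> (G m) \<le> ereal C)"

definition Linf_weak_star :: "'a::euclidean_space set \<Rightarrow> (nat \<Rightarrow> 'a \<Rightarrow> 'a) \<Rightarrow> ('a \<Rightarrow> 'a) \<Rightarrow> bool" where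
  "Linf_weak_star \<Omega> G g \<longleftrightarrow>
     (\<forall>m. G m \<in> Linf \<Omega>) \<and> g \<in> Linf \<Omega> \<and>
     (\<forall>\<psi>::'a \<Rightarrow> 'a. integrable (lebesgue_on \<Omega>) \<psi> \<longrightarrow>
        (\<lambda>m. \<integral>x. G m x \<bullet> \<psi> x \<partial>lebesgue_on \<Omega>) \<longlonglongrightarrow> (\<integral>x. g x \<bullet> \<psi> x \<partial>lebesgue_on \<Omega>))"

end

theory Submission
  imports Defs
begin

text \<open>
  The discrete gradients are bounded because a face value is an area times a difference of values of
  \<open>\<phi>\<close>, divided by the volume of the dual cell; \<open>\<phi>\<close> is Lipschitz, so the regularity parameter
  bounds it (\<open>norm_face_grad_le\<close>).  A bounded sequence has to be tested only against a set whose span is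
  dense in the integrable functions, here Lipschitz functions g times constant vectors c
  (\<open>weak_star_from_lipschitz\<close>).

  The classical argument pairs the discrete gradient with a smooth vector field, sums by parts over the
  cells and applies the divergence theorem on each cell.  Here the divergence theorem on a general
  polyhedral cell is replaced by an elementary count.  For a vector w, the indicator of a cell K
  changes along the segment from x to x + w exactly when a face of K is crossed, by the opposite of the sign of n.w
  (\<open>AE_increment_indicator_cell\<close>).  The x whose segment crosses a face form a prism over this face, of
  volume |n.w| times its area (\<open>measure_sweep\<close>).  Let u be the function equal to \<open>\<phi>(x\<^sub>K)\<close> on K.
  Summing over the cells and integrating against g, the integral of (u(x + w) - u(x)) g(x) becomes a sum
  over the interior faces of the jump of \<open>\<phi>\<close> times the area times n.w times a mean value of g near the
  face.  Up to the oscillation of g this is the integral of the discrete gradient against w g; faces on the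
  boundary do not contribute, since \<open>\<phi>\<close> vanishes near them once the mesh is fine.

  Since u differs from \<open>\<phi>\<close> by at most a constant times h, taking w = s c and dividing by s shows that the
  integral of the discrete gradient against c g differs from the integral of the difference quotient
  \<open>(\<phi>(x + s c) - \<phi>(x)) / s\<close> against g by an error of order h/s + h + s
  (\<open>discrete_grad_consistency\<close>).  Letting first h and then s tend to 0 gives the convergence.
\<close>

section \<open>Volumes of oblique prisms over subsets of hyperplanes\<close>

text \<open>The prism over A with an arbitrary edge vector v.  With v a unit normal it is the set whose volume
  defines the area of A; with v a displacement it collects the points x for which the segment from x to
  x - v meets A.\<close>

definition sweep :: "'a::euclidean_space set \<Rightarrow> 'a \<Rightarrow> 'a set" where
  "sweep A v = {x + t *\<^sub>R v | x t. x \<in> A \<and> 0 \<le> t \<and> t \<le> 1}"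

lemma mem_sweep_minus: "x \<in> sweep A (- w) \<longleftrightarrow> (\<exists>t\<in>{0..1}. x + t *\<^sub>R w \<in> A)"
proof
  assume "x \<in> sweep A (- w)"
  then obtain a t where "a \<in> A" "0 \<le> t" "t \<le> 1" "x = a + t *\<^sub>R (- w)"
    unfolding sweep_def by blast
  then show "\<exists>t\<in>{0..1}. x + t *\<^sub>R w \<in> A"
    by (intro bexI[of _ t]) simp_all
next
  assume "\<exists>t\<in>{0..1}. x + t *\<^sub>R w \<in> A"
  then obtain t where t: "0 \<le> t" "t \<le> 1" "x + t *\<^sub>R w \<in> A" by auto
  have "x = (x + t *\<^sub>R w) + t *\<^sub>R (- w)" by simp
  then show "x \<in> sweep A (- w)"
    unfolding sweep_def using t by blast
qed

lemma sweep_parallel_subset: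
  assumes "A \<subseteq> {x. n \<bullet> x = c}" "n \<bullet> v = 0"
  shows "sweep A v \<subseteq> {x. n \<bullet> x = c}"
proof
  fix y assume "y \<in> sweep A v"
  then obtain a t where a: "a \<in> A" "y = a + t *\<^sub>R v"
    unfolding sweep_def by blast
  have "n \<bullet> a = c" using assms(1) a(1) by auto
  then show "y \<in> {x. n \<bullet> x = c}"
    using assms(2) by (simp add: a(2) inner_add_right)
qed

lemma negligible_sweep_parallel:
  assumes "A \<subseteq> {x. n \<bullet> x = c}" "n \<noteq> 0" "n \<bullet> v = 0"
  shows "negligible (sweep A v)"
proof (rule negligible_subset)
  show "negligible {x. n \<bullet> x = c}"
    by (rule negligible_hyperplane) (use assms(2) in simp)
qed (rule sweep_parallel_subset[OF assms(1,3)])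

lemma bounded_sweep:
  assumes "bounded A"
  shows "bounded (sweep A v)"
proof -
  obtain B where B: "\<And>x. x \<in> A \<Longrightarrow> norm x \<le> B"
    using assms by (auto simp: bounded_iff)
  have "norm (x + t *\<^sub>R v) \<le> B + norm v" if "x \<in> A" "0 \<le> t" "t \<le> 1" for x t
  proof -
    have "norm (x + t *\<^sub>R v) \<le> norm x + norm (t *\<^sub>R v)" by (rule norm_triangle_ineq)
    also have "\<dots> \<le> B + norm v"
      using B[OF that(1)] that by (intro add_mono) (auto simp: mult_left_le_one_le)
    finally show ?thesis .
  qed
  then show ?thesis
    unfolding bounded_iff sweep_def by blast
qed

text \<open>The height of a point over the hyperplane, measured along v, recovers both the parameter and the
  base point, which turns membership into a Borel condition.\<close>

lemma mem_sweep_iff: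
  assumes "A \<subseteq> {x. n \<bullet> x = c}" "n \<bullet> v \<noteq> 0"
  shows "x \<in> sweep A v \<longleftrightarrow>
    0 \<le> (n \<bullet> x - c) / (n \<bullet> v) \<and> (n \<bullet> x - c) / (n \<bullet> v) \<le> 1 \<and>
    x - ((n \<bullet> x - c) / (n \<bullet> v)) *\<^sub>R v \<in> A" (is "_ \<longleftrightarrow> ?R")
proof
  assume "x \<in> sweep A v"
  then obtain a t where a: "a \<in> A" "0 \<le> t" "t \<le> 1" "x = a + t *\<^sub>R v"
    unfolding sweep_def by blast
  have "n \<bullet> a = c" using a assms by auto
  then have "(n \<bullet> x - c) / (n \<bullet> v) = t"
    using assms by (simp add: a inner_add_right)
  then show ?R using a by simp
next
  assume R: ?R
  show "x \<in> sweep A v"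
    unfolding sweep_def mem_Collect_eq
    using R by (intro exI[of _ "x - ((n \<bullet> x - c) / (n \<bullet> v)) *\<^sub>R v"]
        exI[of _ "(n \<bullet> x - c) / (n \<bullet> v)"]) simp
qed

lemma borel_sweep:
  assumes "A \<in> sets borel" "A \<subseteq> {x. n \<bullet> x = c}" "n \<bullet> v \<noteq> 0"
  shows "sweep A v \<in> sets borel"
proof -
  have eq: "sweep A v = {x \<in> space borel. 0 \<le> (n \<bullet> x - c) / (n \<bullet> v) \<and> (n \<bullet> x - c) / (n \<bullet> v) \<le> 1 \<and>
      x - ((n \<bullet> x - c) / (n \<bullet> v)) *\<^sub>R v \<in> A}"
    using mem_sweep_iff[OF assms(2,3)] by auto
  note [measurable] = assms(1)
  show ?thesis unfolding eq by measurable
qed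

lemma sweep_lebesgue:
  assumes "A \<in> sets borel" "A \<subseteq> {x. n \<bullet> x = c}" "n \<noteq> 0"
  shows "sweep A v \<in> sets lebesgue"
proof (cases "n \<bullet> v = 0")
  case True
  then show ?thesis
    using negligible_sweep_parallel[OF assms(2,3)] negligible_imp_sets by blast
next
  case False
  then have "sweep A v \<in> sets lborel"
    using borel_sweep[OF assms(1,2)] by simp
  then show ?thesis by auto
qed

lemma sweep_lmeasurable:
  assumes "A \<in> sets borel" "A \<subseteq> {x. n \<bullet> x = c}" "n \<noteq> 0" "bounded A"
  shows "sweep A v \<in> lmeasurable"
  by (rule bounded_set_imp_lmeasurable[OF bounded_sweep[OF assms(4)] sweep_lebesgue[OF assms(1-3)]])

text \<open>The prism along v is the image of the prism along n under an affine map fixing the hyperplane, and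
  affine maps preserve null sets, measurable or not.  This matters because A will be the set of points of a
  face at which the outward normal condition fails.\<close>

lemma negligible_sweep_transfer:
  assumes A: "A \<subseteq> {x. n \<bullet> x = c}" and n: "norm n = 1" and neg: "negligible (sweep A n)"
  shows "negligible (sweep A v)"
proof -
  let ?T = "\<lambda>x. x + (n \<bullet> x - c) *\<^sub>R (v - n)"
  have nn: "n \<bullet> n = 1" using n by (simp add: dot_square_norm)
  have "sweep A v \<subseteq> ?T ` sweep A n"
  proof
    fix x assume "x \<in> sweep A v"
    then obtain a t where a: "a \<in> A" "0 \<le> t" "t \<le> 1" "x = a + t *\<^sub>R v"
      unfolding sweep_def by blast
    have "n \<bullet> a = c" using a A by auto
    then have "?T (a + t *\<^sub>R n) = x"
      by (simp add: a nn inner_add_right algebra_simps)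
    moreover have "a + t *\<^sub>R n \<in> sweep A n" unfolding sweep_def using a by blast
    ultimately show "x \<in> ?T ` sweep A n" by (intro image_eqI[where x="a + t *\<^sub>R n"]) simp_all
  qed
  moreover have "negligible (?T ` sweep A n)"
  proof (rule negligible_differentiable_image_negligible)
    show "?T differentiable_on sweep A n"
    proof -
      have "linear (\<lambda>x. x + (n \<bullet> x) *\<^sub>R (v - n))"
        by (intro linearI) (simp_all only: inner_add_right inner_scaleR_right scaleR_add_left
            scaleR_add_right scaleR_scaleR add_ac real_scaleR_def mult.assoc)
      then have "(\<lambda>x. (x + (n \<bullet> x) *\<^sub>R (v - n)) + (- c) *\<^sub>R (v - n)) differentiable_on sweep A n"
        by (intro differentiable_on_add differentiable_on_const linear_imp_differentiable_on)
      moreover have "?T = (\<lambda>x. (x + (n \<bullet> x) *\<^sub>R (v - n)) + (- c) *\<^sub>R (v - n))"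
        by (simp add: fun_eq_iff scaleR_diff_left)
      ultimately show ?thesis by simp
    qed
  qed (use neg in auto)
  ultimately show ?thesis by (rule negligible_subset[rotated])
qed

lemma unit_prism_eq_sweep:
  assumes "A \<subseteq> {x. n \<bullet> x = c}" "norm n = 1"
  obtains n' c' where "norm n' = 1" "A \<subseteq> {x. n' \<bullet> x = c'}" "unit_prism A = sweep A n'"
proof -
  let ?P = "\<lambda>n. norm n = 1 \<and> (\<exists>c. A \<subseteq> {x. n \<bullet> x = c})"
  have "?P (SOME n. ?P n)" by (rule someI[of ?P n]) (use assms in blast)
  then obtain c' where "norm (SOME n. ?P n) = 1" "A \<subseteq> {x. (SOME n. ?P n) \<bullet> x = c'}" by blast
  moreover have "unit_prism A = sweep A (SOME n. ?P n)"
    unfolding unit_prism_def sweep_def Let_def by simp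
  ultimately show thesis using that by blast
qed

lemma surface_null_sweep:
  assumes "surface_null A" "A \<subseteq> {x. n \<bullet> x = c}" "norm n = 1"
  shows "negligible (sweep A v)"
proof -
  obtain n' c' where n': "norm n' = 1" "A \<subseteq> {x. n' \<bullet> x = c'}" "unit_prism A = sweep A n'"
    using unit_prism_eq_sweep[OF assms(2,3)] .
  show ?thesis
    by (rule negligible_sweep_transfer[OF n'(2,1)])
       (use assms(1) n'(3) in \<open>simp add: surface_null_def\<close>)
qed

lemma nn_integral_lborel_translate:
  fixes f :: "'a::euclidean_space \<Rightarrow> ennreal"
  assumes "f \<in> borel_measurable borel"
  shows "(\<integral>\<^sup>+x. f (x + a) \<partial>lborel) = (\<integral>\<^sup>+x. f x \<partial>lborel)"
proof -
  have "(\<integral>\<^sup>+x. f x \<partial>lborel) = (\<integral>\<^sup>+x. f x \<partial>distr lborel borel ((+) a))"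
    unfolding lborel_distr_plus ..
  also have "\<dots> = (\<integral>\<^sup>+x. f (a + x) \<partial>lborel)"
    by (intro nn_integral_distr) (use assms in auto)
  finally show ?thesis by (simp add: add.commute)
qed

text \<open>The shear x - g(x) w does not increase integrals.  Averaging over all translates by s w with s in a
  long interval [0, R] turns the shear, line by line, into a shift of that interval by at most G; the cost
  2 G is negligible compared with R.  The same inequality for -g gives equality.\<close>

lemma nn_integral_shear_le:
  fixes f :: "'a::euclidean_space \<Rightarrow> ennreal" and g :: "'a \<Rightarrow> real"
  assumes f [measurable]: "f \<in> borel_measurable borel" and g [measurable]: "g \<in> borel_measurable borel"
    and inv: "\<And>x s. g (x + s *\<^sub>R w) = g x"
    and supp: "\<And>x. f x \<noteq> 0 \<Longrightarrow> \<bar>g x\<bar> \<le> G"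
    and fin: "(\<integral>\<^sup>+x. f x \<partial>lborel) < \<infinity>"
  shows "(\<integral>\<^sup>+x. f (x - g x *\<^sub>R w) \<partial>lborel) \<le> (\<integral>\<^sup>+x. f x \<partial>lborel)" (is "?L \<le> ?I")
proof -
  have key: "ennreal R * ?L \<le> ennreal (R + 2 * \<bar>G\<bar>) * ?I" if R: "R > 0" for R :: real
  proof -
    have "ennreal R * ?L = (\<integral>\<^sup>+s. indicator {0..R} s * ?L \<partial>(lborel::real measure))"
      by (subst nn_integral_multc) (use R in \<open>auto simp: mult.commute\<close>)
    also have "\<dots> = (\<integral>\<^sup>+s. indicator {0..R} s * (\<integral>\<^sup>+x. f (x + s *\<^sub>R w - g x *\<^sub>R w) \<partial>lborel) \<partial>lborel)"
    proof -
      have "(\<integral>\<^sup>+x. f (x + s *\<^sub>R w - g x *\<^sub>R w) \<partial>lborel) = ?L" for s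
        using nn_integral_lborel_translate[of "\<lambda>x. f (x - g x *\<^sub>R w)" "s *\<^sub>R w"]
        by (simp add: inv)
      then show ?thesis by simp
    qed
    also have "\<dots> = (\<integral>\<^sup>+s. \<integral>\<^sup>+x. indicator {0..R} s * f (x + s *\<^sub>R w - g x *\<^sub>R w) \<partial>lborel \<partial>lborel)"
      by (subst nn_integral_cmult) auto
    also have "\<dots> = (\<integral>\<^sup>+x. \<integral>\<^sup>+s. indicator {0..R} s * f (x + s *\<^sub>R w - g x *\<^sub>R w) \<partial>lborel \<partial>lborel)"
      by (rule lborel_pair.Fubini') measurable
    also have "\<dots> \<le> (\<integral>\<^sup>+x. \<integral>\<^sup>+s. indicator {-\<bar>G\<bar>..R+\<bar>G\<bar>} s * f (x + s *\<^sub>R w) \<partial>lborel \<partial>lborel)"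
    proof (rule nn_integral_mono)
      fix x :: 'a
      have "(\<integral>\<^sup>+s. indicator {0..R} s * f (x + s *\<^sub>R w - g x *\<^sub>R w) \<partial>lborel)
          = (\<integral>\<^sup>+s. indicator {0..R} (s + g x) * f (x + s *\<^sub>R w) \<partial>lborel)"
        by (subst nn_integral_lborel_translate[where a="g x", symmetric])
           (auto simp: algebra_simps)
      also have "\<dots> \<le> (\<integral>\<^sup>+s. indicator {-\<bar>G\<bar>..R+\<bar>G\<bar>} s * f (x + s *\<^sub>R w) \<partial>lborel)"
      proof (rule nn_integral_mono)
        fix s :: real
        show "indicator {0..R} (s + g x) * f (x + s *\<^sub>R w) \<le> indicator {-\<bar>G\<bar>..R+\<bar>G\<bar>} s * f (x + s *\<^sub>R w)"
        proof (cases "f (x + s *\<^sub>R w) = 0")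
          case False
          then have "\<bar>g x\<bar> \<le> G" using supp[of "x + s *\<^sub>R w"] by (simp add: inv)
          then show ?thesis by (auto simp: indicator_def)
        qed simp
      qed
      finally show "(\<integral>\<^sup>+s. indicator {0..R} s * f (x + s *\<^sub>R w - g x *\<^sub>R w) \<partial>lborel) \<le> \<dots>" .
    qed
    also have "\<dots> = (\<integral>\<^sup>+s. \<integral>\<^sup>+x. indicator {-\<bar>G\<bar>..R+\<bar>G\<bar>} s * f (x + s *\<^sub>R w) \<partial>lborel \<partial>lborel)"
      by (rule lborel_pair.Fubini'[symmetric]) measurable
    also have "\<dots> = (\<integral>\<^sup>+s. indicator {-\<bar>G\<bar>..R+\<bar>G\<bar>} s * ?I \<partial>(lborel::real measure))"
      by (subst nn_integral_cmult) (auto simp: nn_integral_lborel_translate)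
    also have "\<dots> = ennreal (R + 2 * \<bar>G\<bar>) * ?I"
      by (subst nn_integral_multc) (use R in \<open>auto simp: algebra_simps\<close>)
    finally show ?thesis .
  qed
  obtain I where I: "?I = ennreal I" "I \<ge> 0" using fin by (cases ?I) auto
  have "?L \<le> ennreal (1 + 2 * \<bar>G\<bar>) * ennreal I" using key[of 1] I by simp
  also have "\<dots> < \<infinity>" by (simp add: ennreal_mult_less_top)
  finally have "?L < \<infinity>" .
  then obtain L where L: "?L = ennreal L" "L \<ge> 0" by (cases ?L) auto
  have "L \<le> (1 + 2 * \<bar>G\<bar> / R) * I" if "R > 0" for R
  proof -
    have "R * L \<le> (R + 2 * \<bar>G\<bar>) * I"
      using key[OF that] I L that by (simp add: ennreal_mult[symmetric] del: ennreal_plus)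
    then show ?thesis using that by (simp add: field_simps)
  qed
  then have ev: "\<forall>\<^sub>F R in at_top. L \<le> (1 + 2 * \<bar>G\<bar> / R) * I"
    by (rule eventually_mono[OF eventually_gt_at_top[of 0]])
  have "((\<lambda>R. (1 + 2 * \<bar>G\<bar> / R) * I) \<longlongrightarrow> (1 + 0) * I) at_top"
    by (intro tendsto_mult tendsto_add tendsto_const real_tendsto_divide_at_top[OF tendsto_const filterlim_ident])
  then have "L \<le> I" using tendsto_lowerbound[OF _ ev] by simp
  then show ?thesis using I L by (simp add: ennreal_leI)
qed

text \<open>Two prisms of the same height over the same base differ by a shear parallel to the hyperplane.\<close>

lemma emeasure_sweep_shear_le:
  assumes A: "A \<in> sets borel" "A \<subseteq> {x. n \<bullet> x = c}" "bounded A"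
    and v: "n \<bullet> v \<noteq> 0" "n \<bullet> v' = n \<bullet> v"
  shows "emeasure lborel (sweep A v') \<le> emeasure lborel (sweep A v)"
proof -
  have v': "n \<bullet> v' \<noteq> 0" using v by simp
  note S = borel_sweep[OF A(1,2) v(1)] borel_sweep[OF A(1,2) v']
  define g where "g x = (n \<bullet> x - c) / (n \<bullet> v)" for x
  have fin: "emeasure lborel (sweep A v) < \<infinity>"
    by (intro emeasure_bounded_finite bounded_sweep A)
  have inv: "g (x + s *\<^sub>R (v' - v)) = g x" for x s
    using v by (simp add: g_def inner_add_right inner_diff_right)
  have eq: "indicator (sweep A v') x = (indicator (sweep A v) (x - g x *\<^sub>R (v' - v)) :: ennreal)" for x
  proof -
    have "g (x - g x *\<^sub>R (v' - v)) = g x"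
      using inv[of x "- g x"] by simp
    moreover have "x - g x *\<^sub>R (v' - v) - g x *\<^sub>R v = x - g x *\<^sub>R v'"
      by (simp add: algebra_simps)
    ultimately have "x \<in> sweep A v' \<longleftrightarrow> x - g x *\<^sub>R (v' - v) \<in> sweep A v"
      using mem_sweep_iff[OF A(2) v'] mem_sweep_iff[OF A(2) v(1)]
      unfolding v(2) g_def[symmetric] by metis
    then show ?thesis by (simp add: indicator_def)
  qed
  have "emeasure lborel (sweep A v') = (\<integral>\<^sup>+x. indicator (sweep A v') x \<partial>lborel)"
    using S by simp
  also have "\<dots> = (\<integral>\<^sup>+x. indicator (sweep A v) (x - g x *\<^sub>R (v' - v)) \<partial>lborel)"
    unfolding eq ..
  also have "\<dots> \<le> (\<integral>\<^sup>+x. indicator (sweep A v) x \<partial>lborel)"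
  proof (rule nn_integral_shear_le[where G=1])
    show "g \<in> borel_measurable borel" unfolding g_def by measurable
    show "\<bar>g x\<bar> \<le> 1" if "indicator (sweep A v) x \<noteq> (0::ennreal)" for x
      using that mem_sweep_iff[OF A(2) v(1), of x] by (auto simp: g_def indicator_def split: if_splits)
  qed (use S fin inv in auto)
  finally show ?thesis using S by simp
qed

lemma emeasure_sweep_shear:
  assumes "A \<in> sets borel" "A \<subseteq> {x. n \<bullet> x = c}" "bounded A" "n \<bullet> v \<noteq> 0" "n \<bullet> v' = n \<bullet> v"
  shows "emeasure lborel (sweep A v') = emeasure lborel (sweep A v)"
proof (rule antisym)
  show "emeasure lborel (sweep A v) \<le> emeasure lborel (sweep A v')"
    by (rule emeasure_sweep_shear_le[OF assms(1-3)]) (use assms(4,5) in simp_all)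
qed (rule emeasure_sweep_shear_le[OF assms])

text \<open>Smear each prism along its own direction over the length of the other one.  On every line both
  results are the convolution of the same two intervals, so they have the same mass, and convolution is
  commutative.\<close>

lemma emeasure_sweep_scaleR:
  assumes A [measurable]: "A \<in> sets borel" and AH: "A \<subseteq> {x. n \<bullet> x = c}"
    and v: "n \<bullet> v \<noteq> 0" and r: "r > 0"
  shows "emeasure lborel (sweep A (r *\<^sub>R v)) = ennreal r * emeasure lborel (sweep A v)"
proof -
  define \<tau> where "\<tau> x = (n \<bullet> x - c) / (n \<bullet> v)" for x
  have [measurable]: "\<tau> \<in> borel_measurable borel" unfolding \<tau>_def by measurable
  have \<tau>_diff: "\<tau> (x - t *\<^sub>R v) = \<tau> x - t" for x t
    using v by (simp add: \<tau>_def inner_diff_right field_simps)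
  have ind: "indicator (sweep A (q *\<^sub>R v)) (x - t *\<^sub>R v)
      = (indicator {0..q} (\<tau> x - t) * indicator A (x - \<tau> x *\<^sub>R v) :: ennreal)" if "q > 0" for q x t
  proof -
    have qv: "n \<bullet> (q *\<^sub>R v) \<noteq> 0" using that v by simp
    have h: "(n \<bullet> y - c) / (n \<bullet> (q *\<^sub>R v)) = \<tau> y / q" for y
      using that v by (simp add: \<tau>_def)
    have b: "x - t *\<^sub>R v - ((\<tau> x - t) / q) *\<^sub>R q *\<^sub>R v = x - \<tau> x *\<^sub>R v"
      using that by (simp add: scaleR_diff_left)
    have "x - t *\<^sub>R v \<in> sweep A (q *\<^sub>R v) \<longleftrightarrow> 0 \<le> (\<tau> x - t) / q \<and> (\<tau> x - t) / q \<le> 1 \<and> x - \<tau> x *\<^sub>R v \<in> A"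
      using mem_sweep_iff[OF AH qv, of "x - t *\<^sub>R v"]
      unfolding h \<tau>_diff b .
    also have "\<dots> \<longleftrightarrow> \<tau> x - t \<in> {0..q} \<and> x - \<tau> x *\<^sub>R v \<in> A"
      using that by (simp add: field_simps)
    finally show ?thesis by (simp add: indicator_def)
  qed
  have meas [measurable]: "sweep A (q *\<^sub>R v) \<in> sets borel" if "q > 0" for q
    using borel_sweep[OF A AH, of "q *\<^sub>R v"] that v by simp
  have *: "ennreal p * emeasure lborel (sweep A (q *\<^sub>R v)) =
      (\<integral>\<^sup>+x. \<integral>\<^sup>+t. indicator {0..p} t * (indicator {0..q} (\<tau> x - t) * indicator A (x - \<tau> x *\<^sub>R v)) \<partial>lborel \<partial>lborel)"
    if "p > 0" "q > 0" for p q
  proof -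
    note [measurable] = meas[OF that(2)]
    have "ennreal p * emeasure lborel (sweep A (q *\<^sub>R v)) =
       (\<integral>\<^sup>+t. indicator {0..p} t * emeasure lborel (sweep A (q *\<^sub>R v)) \<partial>(lborel::real measure))"
      by (subst nn_integral_multc) (use that in \<open>auto simp: mult.commute\<close>)
    also have "\<dots> = (\<integral>\<^sup>+t. indicator {0..p} t * (\<integral>\<^sup>+x. indicator (sweep A (q *\<^sub>R v)) (x - t *\<^sub>R v) \<partial>lborel) \<partial>lborel)"
    proof -
      have "(\<integral>\<^sup>+x. indicator (sweep A (q *\<^sub>R v)) (x - t *\<^sub>R v) \<partial>lborel) = emeasure lborel (sweep A (q *\<^sub>R v))" for t
        using nn_integral_lborel_translate[of "indicator (sweep A (q *\<^sub>R v))" "- t *\<^sub>R v"]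
        by simp
      then show ?thesis by simp
    qed
    also have "\<dots> = (\<integral>\<^sup>+t. \<integral>\<^sup>+x. indicator {0..p} t * indicator (sweep A (q *\<^sub>R v)) (x - t *\<^sub>R v) \<partial>lborel \<partial>lborel)"
      by (subst nn_integral_cmult) auto
    also have "\<dots> = (\<integral>\<^sup>+x. \<integral>\<^sup>+t. indicator {0..p} t * indicator (sweep A (q *\<^sub>R v)) (x - t *\<^sub>R v) \<partial>lborel \<partial>lborel)"
      by (rule lborel_pair.Fubini') measurable
    finally show ?thesis unfolding ind[OF that(2)] .
  qed
  have "emeasure lborel (sweep A (r *\<^sub>R v)) =
      (\<integral>\<^sup>+x. \<integral>\<^sup>+t. indicator {0..1} t * (indicator {0..r} (\<tau> x - t) * indicator A (x - \<tau> x *\<^sub>R v)) \<partial>lborel \<partial>lborel)"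
    using *[of 1 r] r by simp
  also have "\<dots> = (\<integral>\<^sup>+x. \<integral>\<^sup>+t. indicator {0..r} t * (indicator {0..1} (\<tau> x - t) * indicator A (x - \<tau> x *\<^sub>R v)) \<partial>lborel \<partial>lborel)"
  proof (rule nn_integral_cong)
    fix x :: 'a
    show "(\<integral>\<^sup>+t. indicator {0..1} t * (indicator {0..r} (\<tau> x - t) * indicator A (x - \<tau> x *\<^sub>R v)) \<partial>lborel)
      = (\<integral>\<^sup>+t. indicator {0..r} t * (indicator {0..1} (\<tau> x - t) * indicator A (x - \<tau> x *\<^sub>R v)) \<partial>lborel)"
      using nn_integral_real_affine[of "\<lambda>t. indicator {0..1} t * (indicator {0..r} (\<tau> x - t) * indicator A (x - \<tau> x *\<^sub>R v))" "-1" "\<tau> x"]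
      by (simp add: mult_ac)
  qed
  also have "\<dots> = ennreal r * emeasure lborel (sweep A v)"
    using *[of r 1] r by simp
  finally show ?thesis .
qed

lemma emeasure_sweep_uminus:
  assumes A: "A \<in> sets borel" and AH: "A \<subseteq> {x. n \<bullet> x = c}" and v: "n \<bullet> v \<noteq> 0"
  shows "emeasure lborel (sweep A (- v)) = emeasure lborel (sweep A v)"
proof -
  have S: "sweep A v \<in> sets borel" "sweep A (- v) \<in> sets borel"
    using borel_sweep[OF A AH] v by auto
  have "x \<in> sweep A (- v) \<longleftrightarrow> x + v \<in> sweep A v" for x
  proof -
    have "(\<exists>t\<in>{0..1}. x + t *\<^sub>R v \<in> A) \<longleftrightarrow> (\<exists>t\<in>{0..1}. x + v + t *\<^sub>R (- v) \<in> A)"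
    proof
      assume "\<exists>t\<in>{0..1}. x + t *\<^sub>R v \<in> A"
      then obtain t where "t \<in> {0..1}" "x + t *\<^sub>R v \<in> A" by blast
      then show "\<exists>t\<in>{0..1}. x + v + t *\<^sub>R (- v) \<in> A"
        by (intro bexI[of _ "1 - t"]) (auto simp: algebra_simps)
    next
      assume "\<exists>t\<in>{0..1}. x + v + t *\<^sub>R (- v) \<in> A"
      then obtain t where "t \<in> {0..1}" "x + v + t *\<^sub>R (- v) \<in> A" by blast
      then show "\<exists>t\<in>{0..1}. x + t *\<^sub>R v \<in> A"
        by (intro bexI[of _ "1 - t"]) (auto simp: algebra_simps)
    qed
    then show ?thesis
      using mem_sweep_minus[of "x" A v] mem_sweep_minus[of "x + v" A "- v"] by simp
  qed
  then have "indicator (sweep A (- v)) x = (indicator (sweep A v) (x + v) :: ennreal)" for x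
    by (simp add: indicator_def)
  then have "(\<integral>\<^sup>+x. indicator (sweep A (- v)) x \<partial>lborel) = (\<integral>\<^sup>+x. indicator (sweep A v) (x + v) \<partial>lborel)"
    by simp
  also have "\<dots> = (\<integral>\<^sup>+x. indicator (sweep A v) x \<partial>lborel)"
    by (rule nn_integral_lborel_translate) (use S in auto)
  finally show ?thesis using S by simp
qed

text \<open>Split v into its sign, a shear, and a scaling of the unit normal.\<close>

lemma measure_sweep_unit_normal:
  assumes A: "A \<in> sets borel" and AH: "A \<subseteq> {x. n \<bullet> x = c}" and bd: "bounded A" and n: "norm n = 1"
  shows "measure lebesgue (sweep A v) = \<bar>n \<bullet> v\<bar> * measure lebesgue (sweep A n)"
proof -
  have nn: "n \<bullet> n = 1" using n by (simp add: dot_square_norm)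
  consider "n \<bullet> v = 0" | "n \<bullet> v \<noteq> 0" by blast
  then show ?thesis
  proof cases
    case 1
    moreover have "n \<noteq> 0" using n by auto
    ultimately show ?thesis
      using negligible_sweep_parallel[OF AH] by (simp add: negligible_imp_measure0)
  next
    case 2
    define v' where "v' = (if n \<bullet> v > 0 then v else - v)"
    have v': "n \<bullet> v' = \<bar>n \<bullet> v\<bar>" by (simp add: v'_def)
    have "emeasure lborel (sweep A v) = emeasure lborel (sweep A v')"
      using emeasure_sweep_uminus[OF A AH 2] by (simp add: v'_def)
    also have "\<dots> = emeasure lborel (sweep A (\<bar>n \<bullet> v\<bar> *\<^sub>R n))"
      by (rule emeasure_sweep_shear[OF A AH bd]) (use 2 nn v' in auto)
    also have "\<dots> = ennreal \<bar>n \<bullet> v\<bar> * emeasure lborel (sweep A n)"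
      by (rule emeasure_sweep_scaleR[OF A AH]) (use 2 nn in auto)
    finally have e: "emeasure lborel (sweep A v) = ennreal \<bar>n \<bullet> v\<bar> * emeasure lborel (sweep A n)" .
    have S: "sweep A v \<in> sets lborel" "sweep A n \<in> sets lborel"
      using borel_sweep[OF A AH] 2 nn by auto
    have "measure lborel (sweep A v) = \<bar>n \<bullet> v\<bar> * measure lborel (sweep A n)"
      unfolding measure_def e by (simp add: enn2real_mult)
    then show ?thesis using S by (simp add: measure_completion)
  qed
qed

text \<open>The volume of a prism is base area times height.  The unit normal n' selected in the definition of the
  area may differ from n; comparing the two prisms in both directions gives area = |n.n'| m and
  m = |n.n'| area, where m is the volume of the prism along n, which forces area = m.\<close>

lemma measure_sweep:
  assumes A: "A \<in> sets borel" and AH: "A \<subseteq> {x. n \<bullet> x = c}" and bd: "bounded A" and n: "norm n = 1"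
  shows "measure lebesgue (sweep A v) = \<bar>n \<bullet> v\<bar> * area A"
proof -
  obtain n' c' where n': "norm n' = 1" "A \<subseteq> {x. n' \<bullet> x = c'}" "unit_prism A = sweep A n'"
    using unit_prism_eq_sweep[OF AH n] .
  have a1: "area A = \<bar>n \<bullet> n'\<bar> * measure lebesgue (sweep A n)"
    unfolding area_def n'(3) by (rule measure_sweep_unit_normal[OF A AH bd n])
  have a2: "measure lebesgue (sweep A n) = \<bar>n \<bullet> n'\<bar> * area A"
    unfolding area_def n'(3) inner_commute[of n] by (rule measure_sweep_unit_normal[OF A n'(2) bd n'(1)])
  have "measure lebesgue (sweep A n) = area A"
  proof (cases "measure lebesgue (sweep A n) = 0")
    case False
    then have "\<bar>n \<bullet> n'\<bar> * (\<bar>n \<bullet> n'\<bar> * measure lebesgue (sweep A n)) = measure lebesgue (sweep A n)"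
      using a1 a2 by metis
    then have "\<bar>n \<bullet> n'\<bar>\<^sup>2 = 1" using False by (simp add: power2_eq_square)
    then have "\<bar>n \<bullet> n'\<bar> = 1" by (simp add: abs_square_eq_1)
    then show ?thesis using a1 by simp
  qed (use a1 in simp)
  then show ?thesis unfolding measure_sweep_unit_normal[OF A AH bd n, of v] by simp
qed

lemma area_nonneg: "area A \<ge> 0"
  by (simp add: area_def)

text \<open>A set contained in two non-parallel hyperplanes has area zero: the height of the prism along n,
  measured by n', is less than 1.\<close>

lemma unit_normals_parallel:
  assumes A: "A \<in> sets borel" "bounded A" "area A > 0"
    and n: "norm n = 1" "A \<subseteq> {x. n \<bullet> x = c}" and n': "norm n' = 1" "A \<subseteq> {x. n' \<bullet> x = c'}"
  shows "n' = n \<or> n' = - n"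
proof -
  have "measure lebesgue (sweep A n) = area A"
    using measure_sweep[OF A(1) n(2) A(2) n(1), of n] n(1) by (simp add: dot_square_norm)
  moreover have "measure lebesgue (sweep A n) = \<bar>n' \<bullet> n\<bar> * area A"
    using measure_sweep[OF A(1) n'(2) A(2) n'(1), of n] .
  ultimately have "\<bar>n' \<bullet> n\<bar> = 1" using A by auto
  then have *: "n' \<bullet> n = 1 \<or> n' \<bullet> n = -1" by linarith
  have nn: "n \<bullet> n = 1" "n' \<bullet> n' = 1" using n(1) n'(1) by (simp_all add: dot_square_norm)
  from * show ?thesis
  proof
    assume "n' \<bullet> n = 1"
    then have "(n' - n) \<bullet> (n' - n) = 0"
      unfolding inner_diff_left inner_diff_right using nn by (simp add: inner_commute)
    then show ?thesis by simp
  next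
    assume "n' \<bullet> n = -1"
    then have "(n' + n) \<bullet> (n' + n) = 0"
      unfolding inner_add_left inner_add_right using nn by (simp add: inner_commute)
    then show ?thesis by (simp add: add_eq_0_iff)
  qed
qed

section \<open>Boundary crossings of a polyhedral cell along segments\<close>

text \<open>Eliminating t shows that the starting points lie in one hyperplane.  Hence almost no line in
  direction w meets the intersection of two faces lying in different hyperplanes.\<close>

lemma negligible_line_meets_two_hyperplanes:
  fixes w :: "'a::euclidean_space"
  assumes n: "n \<noteq> 0" and n': "n' \<noteq> 0" and neq: "{x. n \<bullet> x = c} \<noteq> {x. n' \<bullet> x = c'}"
  shows "negligible {x. \<exists>t::real. n \<bullet> (x + t *\<^sub>R w) = c \<and> n' \<bullet> (x + t *\<^sub>R w) = c'}" (is "negligible ?S")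
proof -
  consider "n \<bullet> w = 0" | "n' \<bullet> w = 0" | "n \<bullet> w \<noteq> 0" "n' \<bullet> w \<noteq> 0" by blast
  then show ?thesis
  proof cases
    case 1
    then have "?S \<subseteq> {x. n \<bullet> x = c}" by (auto simp: inner_add_right)
    moreover have "negligible {x. n \<bullet> x = c}" by (rule negligible_hyperplane) (use n in simp)
    ultimately show ?thesis by (rule negligible_subset[rotated])
  next
    case 2
    then have "?S \<subseteq> {x. n' \<bullet> x = c'}" by (auto simp: inner_add_right)
    moreover have "negligible {x. n' \<bullet> x = c'}" by (rule negligible_hyperplane) (use n' in simp)
    ultimately show ?thesis by (rule negligible_subset[rotated])
  next
    case 3
    define m where "m = (1 / (n \<bullet> w)) *\<^sub>R n - (1 / (n' \<bullet> w)) *\<^sub>R n'"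
    define d where "d = c / (n \<bullet> w) - c' / (n' \<bullet> w)"
    have sub: "?S \<subseteq> {x. m \<bullet> x = d}"
    proof
      fix x assume "x \<in> ?S"
      then obtain t :: real where t: "n \<bullet> x + t * (n \<bullet> w) = c" "n' \<bullet> x + t * (n' \<bullet> w) = c'"
        by (auto simp: inner_add_right)
      have "(n \<bullet> x) / (n \<bullet> w) = c / (n \<bullet> w) - t" "(n' \<bullet> x) / (n' \<bullet> w) = c' / (n' \<bullet> w) - t"
        using t 3 by (auto simp: field_simps)
      then show "x \<in> {x. m \<bullet> x = d}"
        by (simp add: m_def d_def inner_diff_left)
    qed
    have "m \<noteq> 0 \<or> d \<noteq> 0"
    proof (rule ccontr)
      assume "\<not> ?thesis"
      then have m: "(1 / (n \<bullet> w)) *\<^sub>R n = (1 / (n' \<bullet> w)) *\<^sub>R n'" and d: "c / (n \<bullet> w) = c' / (n' \<bullet> w)"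
        by (auto simp: m_def d_def)
      have "n \<bullet> x = c \<longleftrightarrow> n' \<bullet> x = c'" for x
      proof -
        have "n \<bullet> x = c \<longleftrightarrow> ((1 / (n \<bullet> w)) *\<^sub>R n) \<bullet> x = c / (n \<bullet> w)" using 3 by simp
        also have "\<dots> \<longleftrightarrow> ((1 / (n' \<bullet> w)) *\<^sub>R n') \<bullet> x = c' / (n' \<bullet> w)" unfolding m d ..
        also have "\<dots> \<longleftrightarrow> n' \<bullet> x = c'" using 3 by simp
        finally show ?thesis .
      qed
      then show False using neq by blast
    qed
    then have "negligible {x. m \<bullet> x = d}" by (rule negligible_hyperplane)
    then show ?thesis using sub by (rule negligible_subset)
  qed
qed

text \<open>The definition of an outward normal only looks along the normal line.  Near a point lying on a single
  hyperplane of the boundary, the two open half balls are connected and avoid the boundary of K, so each is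
  inside or outside K as a whole; thus the information transfers to every transversal direction.\<close>

lemma half_balls_at_regular_point:
  fixes K :: "'a::euclidean_space set"
  assumes fin: "finite H" and cl: "\<And>P. P \<in> H \<Longrightarrow> closed P"
    and fr: "frontier K \<subseteq> \<Union>H"
    and uniq: "\<And>P. P \<in> H \<Longrightarrow> y \<in> P \<Longrightarrow> P = {x. n \<bullet> x = c}"
    and y: "n \<bullet> y = c" and n: "norm n = 1"
    and out: "\<forall>\<^sub>F t in at_right (0::real). y - t *\<^sub>R n \<in> interior K \<and> y + t *\<^sub>R n \<notin> closure K"
  shows "\<exists>e>0. \<forall>z\<in>ball y e. (n \<bullet> z < c \<longrightarrow> z \<in> interior K) \<and> (n \<bullet> z > c \<longrightarrow> z \<notin> interior K)"
proof -
  let ?P = "{x. n \<bullet> x = c}"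
  have "closed (\<Union>(H - {?P}))" using fin cl by (intro closed_Union) auto
  moreover have "y \<notin> \<Union>(H - {?P})" using uniq by blast
  ultimately obtain e where e: "e > 0" "ball y e \<inter> \<Union>(H - {?P}) = {}"
    by (metis Compl_iff disjoint_eq_subset_Compl open_Compl open_contains_ball)
  have frP: "z \<in> ?P" if "z \<in> ball y e" "z \<in> frontier K" for z
    using that fr e by blast
  have nn: "n \<bullet> n = 1" using n by (simp add: dot_square_norm)
  have "\<forall>\<^sub>F t in at_right (0::real). 0 < t \<and> t < e"
    using eventually_at_right_less[of 0] order_tendstoD(2)[OF tendsto_ident_at e(1)]
    by eventually_elim simp
  then have "\<forall>\<^sub>F t in at_right (0::real). (y - t *\<^sub>R n \<in> interior K \<and> y + t *\<^sub>R n \<notin> closure K) \<and> 0 < t \<and> t < e"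
    using out by eventually_elim simp
  then obtain t where t: "y - t *\<^sub>R n \<in> interior K" "y + t *\<^sub>R n \<notin> closure K" "0 < t" "t < e"
    using eventually_happens'[OF trivial_limit_at_right_real] by blast
  let ?L = "ball y e \<inter> {z. n \<bullet> z < c}" and ?U = "ball y e \<inter> {z. n \<bullet> z > c}"
  have con: "connected ?L" "connected ?U"
    by (intro convex_connected convex_Int convex_ball convex_halfspace_lt convex_halfspace_gt)+
  have nofr: "?L \<inter> frontier K = {}" "?U \<inter> frontier K = {}"
    using frP by fastforce+
  have inL: "y - t *\<^sub>R n \<in> ?L" and inU: "y + t *\<^sub>R n \<in> ?U"
    using t n y nn by (auto simp: dist_norm inner_diff_right inner_add_right)
  have "?L \<inter> K \<noteq> {}" using inL t(1) interior_subset by blast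
  then have "?L \<subseteq> K" using connected_Int_frontier[OF con(1)] nofr(1) by blast
  moreover have "open ?L" by (intro open_Int open_ball open_halfspace_lt)
  ultimately have L: "?L \<subseteq> interior K" by (simp add: interior_maximal)
  have "?U - K \<noteq> {}" using inU t(2) closure_subset by blast
  then have U: "?U \<inter> K = {}" using connected_Int_frontier[OF con(2)] nofr(2) by blast
  show ?thesis
  proof (intro exI[of _ e] conjI ballI impI)
    fix z assume "z \<in> ball y e" "n \<bullet> z < c"
    then show "z \<in> interior K" using L by blast
  next
    fix z assume "z \<in> ball y e" "n \<bullet> z > c"
    then show "z \<notin> interior K" using U interior_subset by blast
  qed (rule e(1))
qed

text \<open>Subtracting the jumps that occurred before t, and using the left value at a jump, makes the function
  locally constant on a connected interval.\<close>

lemma increment_eq_sum_jumps: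
  fixes f :: "real \<Rightarrow> real"
  assumes T: "finite T" "T \<subseteq> {0<..<1}"
    and off: "\<And>t. t \<in> {0..1} - T \<Longrightarrow> \<forall>\<^sub>F s in at t. f s = f t"
    and left: "\<And>t. t \<in> T \<Longrightarrow> \<forall>\<^sub>F s in at_left t. f s = l t"
    and right: "\<And>t. t \<in> T \<Longrightarrow> \<forall>\<^sub>F s in at_right t. f s = l t + e t"
  shows "f 1 - f 0 = (\<Sum>t\<in>T. e t)"
proof -
  define G where "G t = (if t \<in> T then l t else f t) - (\<Sum>t'\<in>{t'\<in>T. t' < t}. e t')" for t
  have away: "\<forall>\<^sub>F s in at t. \<forall>t'\<in>T - {t}. (t' < s \<longleftrightarrow> t' < t) \<and> s \<noteq> t'" for t :: real
  proof -
    have "\<forall>\<^sub>F s in at t. (t' < s \<longleftrightarrow> t' < t) \<and> s \<noteq> t'" if "t' \<in> T - {t}" for t'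
    proof (cases "t' < t")
      case True
      then have "\<forall>\<^sub>F s in at t. t' < s" by (rule order_tendstoD(1)[OF tendsto_ident_at])
      then show ?thesis by eventually_elim (use True in auto)
    next
      case False
      then have "t < t'" using that by auto
      then have "\<forall>\<^sub>F s in at t. s < t'" by (rule order_tendstoD(2)[OF tendsto_ident_at])
      then show ?thesis by eventually_elim (use False in auto)
    qed
    then show ?thesis using T(1) by (simp add: eventually_ball_finite)
  qed
  have loc: "\<forall>\<^sub>F s in at t. G t = G s" if t: "t \<in> {0..1}" for t
  proof (cases "t \<in> T")
    case False
    have "\<forall>\<^sub>F s in at t. f s = f t" using off t False by simp
    with away[of t] show ?thesis
    proof eventually_elim
      case (elim s)
      then have "{t'\<in>T. t' < t} = {t'\<in>T. t' < s}" "s \<notin> T" using False by auto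
      then show ?case using elim False by (simp add: G_def)
    qed
  next
    case True
    have nb: "\<forall>\<^sub>F s in at_left t. s < t" "\<forall>\<^sub>F s in at_right t. t < s"
      by (auto simp: eventually_at_filter)
    have awl: "\<forall>\<^sub>F s in at_left t. \<forall>t'\<in>T - {t}. (t' < s \<longleftrightarrow> t' < t) \<and> s \<noteq> t'"
      and awr: "\<forall>\<^sub>F s in at_right t. \<forall>t'\<in>T - {t}. (t' < s \<longleftrightarrow> t' < t) \<and> s \<noteq> t'"
      using away[of t] unfolding eventually_at_split by auto
    have "\<forall>\<^sub>F s in at_left t. G t = G s"
      using awl nb(1) left[OF True]
    proof eventually_elim
      case (elim s)
      have "t' < t \<longleftrightarrow> t' < s" if "t' \<in> T" for t'
        using elim(1,2) that by (cases "t' = t") auto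
      then have "{t'\<in>T. t' < t} = {t'\<in>T. t' < s}" by blast
      moreover have "s \<notin> T" using elim(1,2) by auto
      ultimately show ?case using elim True by (simp add: G_def)
    qed
    moreover have "\<forall>\<^sub>F s in at_right t. G t = G s"
      using awr nb(2) right[OF True]
    proof eventually_elim
      case (elim s)
      have "t' < s \<longleftrightarrow> t' = t \<or> t' < t" if "t' \<in> T" for t'
        using elim(1,2) that by (cases "t' = t") auto
      then have "{t'\<in>T. t' < s} = insert t {t'\<in>T. t' < t}" using True by blast
      moreover have "s \<notin> T" using elim(1,2) by auto
      ultimately show ?case using elim True T(1) by (simp add: G_def)
    qed
    ultimately show ?thesis by (simp add: eventually_at_split)
  qed
  have "G 0 = G 1"
  proof (rule connected_local_const[of "{0..1::real}" 0 1 G])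
    show "\<forall>t\<in>{0..1}. \<forall>\<^sub>F s in at t within {0..1}. G t = G s"
      using loc filter_leD[OF at_le[OF subset_UNIV]] by blast
  qed auto
  moreover have "{t'\<in>T. t' < 0} = {}" "{t'\<in>T. t' < 1} = T" "0 \<notin> T" "1 \<notin> T" using T(2) by force+
  ultimately show ?thesis by (simp add: G_def)
qed

lemma AE_not_mem_negligible:
  "negligible N \<Longrightarrow> AE x in lebesgue. x \<notin> N"
  by (rule AE_not_in) (simp add: negligible_iff_null_sets)

lemma negligible_translation_preimage:
  fixes w :: "'a::euclidean_space"
  assumes "negligible N"
  shows "negligible {x. x + w \<in> N}"
proof -
  have "{x. x + w \<in> N} = (+) (- w) ` N"
    by (force simp: image_iff algebra_simps)
  then show ?thesis using negligible_translation[OF assms] by metis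
qed

text \<open>A finite-difference form of the divergence theorem, with no surface integral: walking from x to x + w,
  the indicator of K changes exactly when a face is crossed, downwards on leaving K (n.w > 0) and upwards on
  entering it (n.w < 0).  The null set excludes segments that end on a hyperplane of the boundary, meet two
  such hyperplanes or two faces at one point, or meet a face where its normal condition fails.\<close>

lemma AE_increment_indicator_cell:
  fixes K :: "'a::euclidean_space set" and w :: 'a
  assumes poly: "polyhedral K" and fin: "finite F" and fr: "frontier K = \<Union>F"
    and out: "\<And>\<sigma>. \<sigma> \<in> F \<Longrightarrow> outward_normal K \<sigma> (n \<sigma>)"
    and disj: "\<And>\<sigma> \<tau>. \<sigma> \<in> F \<Longrightarrow> \<tau> \<in> F \<Longrightarrow> \<sigma> \<noteq> \<tau> \<Longrightarrow> surface_null (\<sigma> \<inter> \<tau>)"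
  shows "AE x in lebesgue. indicat_real (interior K) (x + w) - indicat_real (interior K) x =
     - (\<Sum>\<sigma>\<in>F. sgn (n \<sigma> \<bullet> w) * indicat_real (sweep \<sigma> (- w)) x)"
proof -
  obtain c where c: "\<And>\<sigma>. \<sigma> \<in> F \<Longrightarrow> \<sigma> \<subseteq> {x. n \<sigma> \<bullet> x = c \<sigma>}"
    using out unfolding outward_normal_def by metis
  have onP: "n \<sigma> \<bullet> y = c \<sigma>" if "\<sigma> \<in> F" "y \<in> \<sigma>" for \<sigma> y
    using subsetD[OF c[OF that(1)] that(2)] by simp
  have n1: "\<And>\<sigma>. \<sigma> \<in> F \<Longrightarrow> norm (n \<sigma>) = 1" using out unfolding outward_normal_def by blast
  obtain H0 where H0: "finite H0" "\<forall>P\<in>H0. \<exists>n c. n \<noteq> 0 \<and> P = {x. n \<bullet> x = c}" "frontier K \<subseteq> \<Union>H0"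
    using poly[unfolded polyhedral_def] by (elim exE conjE) (rule that)
  define H where "H = H0 \<union> (\<lambda>\<sigma>. {x. n \<sigma> \<bullet> x = c \<sigma>}) ` F"
  have finH: "finite H" unfolding H_def using H0 fin by simp
  have hyp: "\<exists>n c. n \<noteq> 0 \<and> P = {x. n \<bullet> x = c}" if "P \<in> H" for P
  proof (cases "P \<in> H0")
    case False
    then obtain \<sigma> where "\<sigma> \<in> F" "P = {x. n \<sigma> \<bullet> x = c \<sigma>}" using \<open>P \<in> H\<close> by (auto simp: H_def)
    moreover from this have "n \<sigma> \<noteq> 0" using n1[of \<sigma>] by auto
    ultimately show ?thesis by blast
  qed (use H0(2) in simp)
  have clH: "closed P" and negH: "negligible P" if "P \<in> H" for P
  proof -
    obtain m d where "m \<noteq> 0" "P = {x. m \<bullet> x = d}" using hyp[OF \<open>P \<in> H\<close>] by blast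
    then show "closed P" "negligible P" using closed_hyperplane negligible_hyperplane by auto
  qed
  have frH: "frontier K \<subseteq> \<Union>H" using H0(3) by (auto simp: H_def)
  define bad where "bad \<sigma> = {x \<in> \<sigma>. \<not> (\<forall>\<^sub>F t in at_right (0::real).
      x - t *\<^sub>R n \<sigma> \<in> interior K \<and> x + t *\<^sub>R n \<sigma> \<notin> closure K)}" for \<sigma>
  have badnull: "negligible (sweep (bad \<sigma>) (- w))" if "\<sigma> \<in> F" for \<sigma>
  proof (rule surface_null_sweep)
    show "surface_null (bad \<sigma>)" using out[OF that] unfolding outward_normal_def bad_def by blast
    show "bad \<sigma> \<subseteq> {x. n \<sigma> \<bullet> x = c \<sigma>}" using c[OF that] by (auto simp: bad_def)
  qed (rule n1[OF that])
  have dnull: "negligible (sweep (\<sigma> \<inter> \<tau>) (- w))" if "\<sigma> \<in> F" "\<tau> \<in> F" "\<sigma> \<noteq> \<tau>" for \<sigma> \<tau>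
    by (rule surface_null_sweep[OF disj[OF that] _ n1[OF that(1)]]) (use c[OF that(1)] in blast)
  have mnull: "negligible {x. \<exists>t::real. x + t *\<^sub>R w \<in> P \<and> x + t *\<^sub>R w \<in> Q}"
    if "P \<in> H" "Q \<in> H" "P \<noteq> Q" for P Q
  proof -
    obtain m d where P: "m \<noteq> 0" "P = {x. m \<bullet> x = d}" using hyp[OF \<open>P \<in> H\<close>] by blast
    obtain m' d' where Q: "m' \<noteq> 0" "Q = {x. m' \<bullet> x = d'}" using hyp[OF \<open>Q \<in> H\<close>] by blast
    show ?thesis
      using negligible_line_meets_two_hyperplanes[OF P(1) Q(1), of d d' w] that(3)
      unfolding P(2) Q(2) mem_Collect_eq by blast
  qed
  have ae1: "AE x in lebesgue. \<forall>P\<in>H. x \<notin> P"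
    by (intro AE_finite_allI finH AE_not_mem_negligible negH)
  have ae2: "AE x in lebesgue. \<forall>P\<in>H. x + w \<notin> P"
    by (intro AE_finite_allI finH negH
        AE_not_mem_negligible[OF negligible_translation_preimage, unfolded mem_Collect_eq])
  have ae3: "AE x in lebesgue. \<forall>\<sigma>\<in>F. x \<notin> sweep (bad \<sigma>) (- w)"
    by (intro AE_finite_allI fin AE_not_mem_negligible badnull)
  have ae4: "AE x in lebesgue. \<forall>\<sigma>\<in>F. \<forall>\<tau>\<in>F. \<sigma> \<noteq> \<tau> \<longrightarrow> x \<notin> sweep (\<sigma> \<inter> \<tau>) (- w)"
    by (intro AE_finite_allI fin AE_impI AE_not_mem_negligible dnull)
  have ae5: "AE x in lebesgue. \<forall>P\<in>H. \<forall>Q\<in>H. P \<noteq> Q \<longrightarrow>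
      x \<notin> {x. \<exists>t::real. x + t *\<^sub>R w \<in> P \<and> x + t *\<^sub>R w \<in> Q}"
    by (intro AE_finite_allI finH AE_impI AE_not_mem_negligible mnull)
  from ae1 ae2 ae3 ae4 ae5 show ?thesis
  proof eventually_elim
    case (elim x)
    let ?p = "\<lambda>t::real. x + t *\<^sub>R w"
    define f where "f t = indicat_real (interior K) (?p t)" for t
    define T where "T = {t\<in>{0..1}. ?p t \<in> frontier K}"
    define F' where "F' = {\<sigma>\<in>F. x \<in> sweep \<sigma> (- w)}"
    \<comment> \<open>A face parallel to w lies in a hyperplane that contains every segment it meets, and x avoids it.\<close>
    have cross: "n \<sigma> \<bullet> w \<noteq> 0" if "\<sigma> \<in> F" "?p t \<in> \<sigma>" for \<sigma> t
    proof
      assume 0: "n \<sigma> \<bullet> w = 0"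
      have "n \<sigma> \<bullet> ?p t = c \<sigma>" by (rule onP[OF that])
      then have "x \<in> {x. n \<sigma> \<bullet> x = c \<sigma>}" using 0 by (simp add: inner_add_right)
      moreover have "x \<notin> {x. n \<sigma> \<bullet> x = c \<sigma>}"
        by (rule bspec[OF elim(1)]) (use that in \<open>simp add: H_def\<close>)
      ultimately show False by contradiction
    qed
    have once: "t = s" if "\<sigma> \<in> F" "?p t \<in> \<sigma>" "?p s \<in> \<sigma>" for \<sigma> t s
    proof -
      have "n \<sigma> \<bullet> ?p t = n \<sigma> \<bullet> ?p s" using onP[OF that(1,2)] onP[OF that(1,3)] by simp
      then show ?thesis using cross[OF that(1,2)] by (simp add: inner_add_right)
    qed
    have uniq: "\<exists>!\<sigma>. \<sigma> \<in> F \<and> ?p t \<in> \<sigma>" if t: "t \<in> T" for t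
    proof -
      obtain \<sigma> where \<sigma>: "\<sigma> \<in> F" "?p t \<in> \<sigma>" using t fr by (auto simp: T_def)
      moreover have "\<tau> = \<sigma>" if "\<tau> \<in> F" "?p t \<in> \<tau>" for \<tau>
      proof (rule ccontr)
        assume "\<tau> \<noteq> \<sigma>"
        then have "x \<notin> sweep (\<tau> \<inter> \<sigma>) (- w)" using elim(4) \<sigma> that by blast
        moreover have "x \<in> sweep (\<tau> \<inter> \<sigma>) (- w)"
          unfolding mem_sweep_minus using t \<sigma>(2) that(2) by (intro bexI[of _ t]) (simp_all add: T_def)
        ultimately show False by contradiction
      qed
      ultimately show ?thesis by blast
    qed
    \<comment> \<open>Crossing times correspond one to one to crossed faces, which turns the sum over times into one over faces.\<close>
    define \<Phi> where "\<Phi> t = (THE \<sigma>. \<sigma> \<in> F \<and> ?p t \<in> \<sigma>)" for t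
    have \<Phi>: "\<Phi> t \<in> F" "?p t \<in> \<Phi> t" if "t \<in> T" for t
      using theI'[OF uniq[OF that]] unfolding \<Phi>_def by auto
    have \<Phi>_eq: "\<Phi> t = \<sigma>" if "t \<in> T" "\<sigma> \<in> F" "?p t \<in> \<sigma>" for t \<sigma>
      using uniq[OF that(1)] \<Phi>[OF that(1)] that by blast
    have inj: "inj_on \<Phi> T"
      by (rule inj_onI) (metis \<Phi> once)
    have img: "\<Phi> ` T = F'"
    proof
      show "\<Phi> ` T \<subseteq> F'"
      proof
        fix \<sigma> assume "\<sigma> \<in> \<Phi> ` T"
        then obtain t where t: "t \<in> T" "\<sigma> = \<Phi> t" by blast
        have "x \<in> sweep \<sigma> (- w)"
          unfolding mem_sweep_minus using t \<Phi>(2)[OF t(1)]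
          by (intro bexI[of _ t]) (simp_all add: T_def)
        then show "\<sigma> \<in> F'" using \<Phi>(1)[OF t(1)] t(2) by (simp add: F'_def)
      qed
      show "F' \<subseteq> \<Phi> ` T"
      proof
        fix \<sigma> assume "\<sigma> \<in> F'"
        then obtain t where t: "\<sigma> \<in> F" "t \<in> {0..1}" "?p t \<in> \<sigma>"
          by (auto simp: F'_def mem_sweep_minus)
        then have "t \<in> T" using fr by (auto simp: T_def)
        then show "\<sigma> \<in> \<Phi> ` T" using \<Phi>_eq t by blast
      qed
    qed
    have "finite F'" unfolding F'_def using fin by simp
    then have finT: "finite T" using finite_imageD[OF _ inj] img by simp
    have nofr: "x \<notin> frontier K" "x + w \<notin> frontier K" using elim(1,2) frH by blast+
    have T01: "T \<subseteq> {0<..<1}"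
    proof
      fix t assume t: "t \<in> T"
      then have "t \<noteq> 0" "t \<noteq> 1" using nofr by (auto simp: T_def)
      then show "t \<in> {0<..<1}" using t by (simp add: T_def)
    qed
    have contp: "continuous_on UNIV ?p" by (intro continuous_intros)
    have tend: "(?p \<longlongrightarrow> ?p t) (at t)" for t
      using contp by (simp add: continuous_on_def)
    have "f 1 - f 0 = (\<Sum>t\<in>T. - sgn (n (\<Phi> t) \<bullet> w))"
    proof (rule increment_eq_sum_jumps[OF finT T01, where l="\<lambda>t. if n (\<Phi> t) \<bullet> w > 0 then 1 else 0"])
      fix t assume t: "t \<in> {0..1} - T"
      show "\<forall>\<^sub>F s in at t. f s = f t"
      proof (cases "?p t \<in> interior K")
        case True
        have "\<forall>\<^sub>F s in at t. ?p s \<in> interior K"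
          by (rule topological_tendstoD[OF tend open_interior True])
        then show ?thesis by eventually_elim (use True in \<open>simp add: f_def\<close>)
      next
        case False
        then have "?p t \<in> - closure K" using t by (auto simp: T_def frontier_def)
        then have "\<forall>\<^sub>F s in at t. ?p s \<in> - closure K"
          by (intro topological_tendstoD[OF tend]) auto
        then show ?thesis
        proof eventually_elim
          case (elim s)
          then have "?p s \<notin> interior K" using interior_subset closure_subset by blast
          then show ?case using False by (simp add: f_def)
        qed
      qed
    next
      fix t assume t: "t \<in> T"
      let ?s = "\<Phi> t"
      have cr: "n ?s \<bullet> w \<noteq> 0" by (rule cross[OF \<Phi>[OF t]])
      have y: "n ?s \<bullet> ?p t = c ?s" by (rule onP[OF \<Phi>[OF t]])
      have good: "\<forall>\<^sub>F r in at_right (0::real). ?p t - r *\<^sub>R n ?s \<in> interior K \<and> ?p t + r *\<^sub>R n ?s \<notin> closure K"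
      proof (rule ccontr)
        assume "\<not> ?thesis"
        then have "?p t \<in> bad ?s" using \<Phi>[OF t] by (simp add: bad_def)
        then have "x \<in> sweep (bad ?s) (- w)"
          unfolding mem_sweep_minus using t by (intro bexI[of _ t]) (simp_all add: T_def)
        then show False using bspec[OF elim(3) \<Phi>(1)[OF t]] by contradiction
      qed
      have Pin: "{x. n ?s \<bullet> x = c ?s} \<in> H" using \<Phi>[OF t] by (auto simp: H_def)
      have only: "P = {x. n ?s \<bullet> x = c ?s}" if P: "P \<in> H" "?p t \<in> P" for P
      proof (rule ccontr)
        assume ne: "P \<noteq> {x. n ?s \<bullet> x = c ?s}"
        have "\<exists>t::real. ?p t \<in> P \<and> ?p t \<in> {x. n ?s \<bullet> x = c ?s}"
          by (rule exI[of _ t]) (use P(2) y in simp)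
        then show False using elim(5)[rule_format, OF P(1) Pin ne] by simp
      qed
      obtain e where e: "e > 0" "\<forall>z\<in>ball (?p t) e.
          (n ?s \<bullet> z < c ?s \<longrightarrow> z \<in> interior K) \<and> (n ?s \<bullet> z > c ?s \<longrightarrow> z \<notin> interior K)"
        using half_balls_at_regular_point[OF finH clH frH only y n1[OF \<Phi>(1)[OF t]] good] by blast
      have near: "\<forall>\<^sub>F s in at t. ?p s \<in> ball (?p t) e"
        by (rule topological_tendstoD[OF tend]) (use e(1) in auto)
      have nearl: "\<forall>\<^sub>F s in at_left t. ?p s \<in> ball (?p t) e"
        and nearr: "\<forall>\<^sub>F s in at_right t. ?p s \<in> ball (?p t) e"
        using near unfolding eventually_at_split by auto
      have nb: "\<forall>\<^sub>F s in at_left t. s < t" "\<forall>\<^sub>F s in at_right t. t < s"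
        by (auto simp: eventually_at_filter)
      have height: "n ?s \<bullet> ?p s - c ?s = (s - t) * (n ?s \<bullet> w)" for s
        using y by (simp add: inner_add_right algebra_simps)
      have below: "f s = 1" if "?p s \<in> ball (?p t) e" "(s - t) * (n ?s \<bullet> w) < 0" for s
        using bspec[OF e(2) that(1)] that(2) height[of s] by (simp add: f_def)
      have above: "f s = 0" if "?p s \<in> ball (?p t) e" "(s - t) * (n ?s \<bullet> w) > 0" for s
        using bspec[OF e(2) that(1)] that(2) height[of s] by (simp add: f_def)
      show "\<forall>\<^sub>F s in at_left t. f s = (if n ?s \<bullet> w > 0 then 1 else 0)"
        using nearl nb(1)
      proof eventually_elim
        case (elim s)
        then show ?case using below[of s] above[of s] cr
          by (cases "n ?s \<bullet> w > 0") (simp_all add: mult_neg_pos mult_neg_neg)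
      qed
      show "\<forall>\<^sub>F s in at_right t. f s = (if n ?s \<bullet> w > 0 then 1 else 0) + - sgn (n ?s \<bullet> w)"
        using nearr nb(2)
      proof eventually_elim
        case (elim s)
        then show ?case using below[of s] above[of s] cr
          by (cases "n ?s \<bullet> w > 0") (simp_all add: mult_pos_pos mult_pos_neg)
      qed
    qed
    also have "\<dots> = - (\<Sum>t\<in>T. sgn (n (\<Phi> t) \<bullet> w))" by (simp add: sum_negf)
    also have "(\<Sum>t\<in>T. sgn (n (\<Phi> t) \<bullet> w)) = (\<Sum>\<sigma>\<in>F'. sgn (n \<sigma> \<bullet> w))"
      unfolding img[symmetric] by (simp add: sum.reindex[OF inj])
    also have "\<dots> = (\<Sum>\<sigma>\<in>F. sgn (n \<sigma> \<bullet> w) * indicat_real (sweep \<sigma> (- w)) x)"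
      unfolding F'_def using fin by (intro sum.mono_neutral_cong_left) auto
    finally show ?case by (simp add: f_def)
  qed
qed

section \<open>Cells, faces and normals of a mesh\<close>

lemma
  assumes "is_mesh \<Omega> M"
  shows is_mesh_null_partition_cells: "null_partition \<Omega> (cells M) (\<lambda>K. K)"
    and is_mesh_null_partition_dual: "null_partition \<Omega> (all_faces M) (dual_cell M)"
    and is_mesh_ext_faces: "\<forall>\<sigma>\<in>ext_faces M. \<sigma> \<subseteq> frontier \<Omega>"
    and is_mesh_dual: "\<forall>\<sigma> K L. separates M \<sigma> K L \<longrightarrow>
      dual_cell M \<sigma> \<subseteq> K \<union> L \<and> measure lebesgue (dual_cell M \<sigma>) > 0"
  using assms[unfolded is_mesh_def] by - (elim conjE, assumption)+

lemma
  assumes "is_mesh \<Omega> M" "separates M \<sigma> K L"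
  shows is_mesh_dual_subset: "dual_cell M \<sigma> \<subseteq> K \<union> L"
    and is_mesh_dual_pos: "measure lebesgue (dual_cell M \<sigma>) > 0"
  using is_mesh_dual[OF assms(1)] assms(2) by simp_all

lemma
  assumes "is_mesh \<Omega> M" "K \<in> cells M"
  shows cell_subset_closure: "K \<subseteq> closure \<Omega>"
    and cell_polyhedral: "polyhedral K"
    and cell_finite_faces: "finite (cell_faces M K)"
    and cell_frontier: "frontier K = \<Union>(cell_faces M K)"
    and cell_faces_regular: "\<forall>\<sigma>\<in>cell_faces M K. \<sigma> \<in> sets borel \<and> (\<exists>n. outward_normal K \<sigma> n)"
    and cell_faces_disjoint: "\<forall>\<sigma>\<in>cell_faces M K. \<forall>\<tau>\<in>cell_faces M K. \<sigma> \<noteq> \<tau> \<longrightarrow> surface_null (\<sigma> \<inter> \<tau>)"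
    and cell_point_mem: "cell_point M K \<in> K"
  using bspec[OF conjunct1[OF conjunct2[OF assms(1)[unfolded is_mesh_def]]] assms(2)]
  by - (elim conjE, assumption)+

lemma face_borel:
  assumes "is_mesh \<Omega> M" "K \<in> cells M" "\<sigma> \<in> cell_faces M K"
  shows "\<sigma> \<in> sets borel"
  using bspec[OF cell_faces_regular[OF assms(1,2)] assms(3)] by simp

lemma face_normal:
  assumes "is_mesh \<Omega> M" "K \<in> cells M" "\<sigma> \<in> cell_faces M K"
  shows "outward_normal K \<sigma> (normal_vec K \<sigma>)"
  using bspec[OF cell_faces_regular[OF assms(1,2)] assms(3)] unfolding normal_vec_def
  by (elim conjE) (rule someI_ex)

lemma faces_surface_disjoint:
  assumes "is_mesh \<Omega> M" "K \<in> cells M" "\<sigma> \<in> cell_faces M K" "\<tau> \<in> cell_faces M K" "\<sigma> \<noteq> \<tau>"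
  shows "surface_null (\<sigma> \<inter> \<tau>)"
  using cell_faces_disjoint[OF assms(1,2)] assms(3-5) by simp

lemma finite_cells: "is_mesh \<Omega> M \<Longrightarrow> finite (cells M)"
  using is_mesh_null_partition_cells unfolding null_partition_def by blast

lemma finite_all_faces: "is_mesh \<Omega> M \<Longrightarrow> finite (all_faces M)"
  using finite_cells cell_finite_faces unfolding all_faces_def by blast

lemma bounded_cell:
  assumes "is_mesh \<Omega> M" "bounded \<Omega>" "K \<in> cells M"
  shows "bounded K"
  using bounded_subset[OF bounded_closure[OF assms(2)] cell_subset_closure[OF assms(1,3)]] .

lemma face_subset_closure:
  assumes "is_mesh \<Omega> M" "K \<in> cells M" "\<sigma> \<in> cell_faces M K"
  shows "\<sigma> \<subseteq> closure K"
proof -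
  have "\<sigma> \<subseteq> frontier K" unfolding cell_frontier[OF assms(1,2)] using assms(3) by (rule Union_upper)
  then show ?thesis unfolding frontier_def by blast
qed

lemma bounded_face:
  assumes "is_mesh \<Omega> M" "bounded \<Omega>" "K \<in> cells M" "\<sigma> \<in> cell_faces M K"
  shows "bounded \<sigma>"
  using bounded_subset[OF bounded_closure[OF bounded_cell[OF assms(1-3)]] face_subset_closure[OF assms(1,3,4)]] .

lemma face_hyperplane:
  assumes "is_mesh \<Omega> M" "K \<in> cells M" "\<sigma> \<in> cell_faces M K"
  obtains c where "norm (normal_vec K \<sigma>) = 1" "\<sigma> \<subseteq> {x. normal_vec K \<sigma> \<bullet> x = c}"
  using face_normal[OF assms] unfolding outward_normal_def by blast

lemma negligible_frontier_polyhedral: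
  assumes "polyhedral S"
  shows "negligible (frontier S)"
proof -
  obtain H where H: "finite H" "\<forall>P\<in>H. \<exists>n c. n \<noteq> 0 \<and> P = {x. n \<bullet> x = c}" "frontier S \<subseteq> \<Union>H"
    using assms[unfolded polyhedral_def] by (elim exE conjE) (rule that)
  have "negligible P" if "P \<in> H" for P
  proof -
    obtain n c where "n \<noteq> 0" "P = {x. n \<bullet> x = c}" using H(2) \<open>P \<in> H\<close> by blast
    then show ?thesis using negligible_hyperplane by auto
  qed
  then have "negligible (\<Union>H)" using H(1) by (intro negligible_Union) auto
  then show ?thesis using H(3) by (rule negligible_subset)
qed

lemma interior_cells_disjoint:
  assumes "is_mesh \<Omega> M" "K \<in> cells M" "L \<in> cells M" "K \<noteq> L"
  shows "interior K \<inter> interior L = {}"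
proof (rule ccontr)
  assume "\<not> ?thesis"
  moreover have "negligible (K \<inter> L)"
    using is_mesh_null_partition_cells[OF assms(1)] assms(2-4) unfolding null_partition_def by blast
  then have "negligible (interior K \<inter> interior L)"
    by (rule negligible_subset) (use interior_subset in blast)
  ultimately show False
    using open_not_negligible[of "interior K \<inter> interior L"] by blast
qed

text \<open>If the normals agreed, then just below a regular point of the common face the interiors of the two
  cells would overlap.  Positive area guarantees that a point regular for both cells exists.\<close>

lemma opposite_normals:
  assumes M: "is_mesh \<Omega> M" and bd: "bounded \<Omega>"
    and K: "K \<in> cells M" "\<sigma> \<in> cell_faces M K" and L: "L \<in> cells M" "\<sigma> \<in> cell_faces M L"
    and ne: "K \<noteq> L" and pos: "area \<sigma> > 0"
  shows "normal_vec L \<sigma> = - normal_vec K \<sigma>"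
proof -
  let ?n = "normal_vec K \<sigma>"
  obtain c where c: "norm ?n = 1" "\<sigma> \<subseteq> {x. ?n \<bullet> x = c}" using face_hyperplane[OF M K] .
  obtain d where d: "norm (normal_vec L \<sigma>) = 1" "\<sigma> \<subseteq> {x. normal_vec L \<sigma> \<bullet> x = d}" using face_hyperplane[OF M L] .
  have "normal_vec L \<sigma> = ?n \<or> normal_vec L \<sigma> = - ?n"
    by (rule unit_normals_parallel[OF face_borel[OF M K] bounded_face[OF M bd K] pos c d])
  moreover have "normal_vec L \<sigma> \<noteq> ?n"
  proof
    assume eq: "normal_vec L \<sigma> = ?n"
    define B where "B C = {x \<in> \<sigma>. \<not> (\<forall>\<^sub>F t in at_right (0::real).
        x - t *\<^sub>R ?n \<in> interior C \<and> x + t *\<^sub>R ?n \<notin> closure C)}" for C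
    have "surface_null (B K)" "surface_null (B L)"
      using face_normal[OF M K] face_normal[OF M L] unfolding outward_normal_def eq B_def by blast+
    moreover have "B C \<subseteq> {x. ?n \<bullet> x = c}" for C using c(2) unfolding B_def by blast
    ultimately have neg: "negligible (sweep (B K) ?n \<union> sweep (B L) ?n)"
      by (intro negligible_Un surface_null_sweep[OF _ _ c(1)])
    have "\<not> \<sigma> \<subseteq> B K \<union> B L"
    proof
      assume "\<sigma> \<subseteq> B K \<union> B L"
      then have "sweep \<sigma> ?n \<subseteq> sweep (B K) ?n \<union> sweep (B L) ?n"
        unfolding sweep_def by blast
      then have "measure lebesgue (sweep \<sigma> ?n) = 0"
        using negligible_subset[OF neg] by (simp add: negligible_imp_measure0)
      moreover have "measure lebesgue (sweep \<sigma> ?n) = \<bar>?n \<bullet> ?n\<bar> * area \<sigma>"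
        by (rule measure_sweep[OF face_borel[OF M K] c(2) bounded_face[OF M bd K] c(1)])
      ultimately show False using pos c(1) by (simp add: dot_square_norm)
    qed
    then obtain y where y: "y \<in> \<sigma>" "y \<notin> B K" "y \<notin> B L" by blast
    then have "\<forall>\<^sub>F t in at_right (0::real). y - t *\<^sub>R ?n \<in> interior K \<and> y + t *\<^sub>R ?n \<notin> closure K"
      "\<forall>\<^sub>F t in at_right (0::real). y - t *\<^sub>R ?n \<in> interior L \<and> y + t *\<^sub>R ?n \<notin> closure L"
      unfolding B_def by blast+
    then have "\<forall>\<^sub>F t in at_right (0::real). y - t *\<^sub>R ?n \<in> interior K \<inter> interior L"
      by eventually_elim simp
    then show False
      using interior_cells_disjoint[OF M K(1) L(1) ne] by simp
  qed
  ultimately show ?thesis by blast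
qed

text \<open>Three cells sharing a face would have three pairwise opposite normals.\<close>

lemma cells_of_face:
  assumes M: "is_mesh \<Omega> M" and bd: "bounded \<Omega>" and sep: "separates M \<sigma> K L" and pos: "area \<sigma> > 0"
  shows "{C \<in> cells M. \<sigma> \<in> cell_faces M C} = {K, L}"
proof -
  have K: "K \<in> cells M" "\<sigma> \<in> cell_faces M K" and L: "L \<in> cells M" "\<sigma> \<in> cell_faces M L" and ne: "K \<noteq> L"
    using sep unfolding separates_def by auto
  have "C = K \<or> C = L" if C: "C \<in> cells M" "\<sigma> \<in> cell_faces M C" for C
  proof (rule ccontr)
    assume "\<not> ?thesis"
    then have "C \<noteq> K" "C \<noteq> L" by auto
    have "normal_vec K \<sigma> = - normal_vec C \<sigma>"
      by (rule opposite_normals[OF M bd C K \<open>C \<noteq> K\<close> pos])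
    moreover have "normal_vec L \<sigma> = - normal_vec C \<sigma>"
      by (rule opposite_normals[OF M bd C L \<open>C \<noteq> L\<close> pos])
    moreover have "normal_vec L \<sigma> = - normal_vec K \<sigma>"
      by (rule opposite_normals[OF M bd K L ne pos])
    ultimately have "normal_vec C \<sigma> + normal_vec C \<sigma> = 0" by (simp add: eq_neg_iff_add_eq_0)
    then have "2 *\<^sub>R normal_vec C \<sigma> = 0" by (simp add: scaleR_2)
    then have 0: "normal_vec C \<sigma> = 0" by simp
    obtain d where "norm (normal_vec C \<sigma>) = 1" using face_hyperplane[OF M C] by blast
    then show False unfolding 0 by simp
  qed
  then show ?thesis using K L by blast
qed

lemma theta_grad_ge:
  assumes M: "is_mesh \<Omega> M" and sep: "separates M \<sigma> K L"
  shows "area \<sigma> * norm (cell_point M L - cell_point M K) \<le> theta_grad M * measure lebesgue (dual_cell M \<sigma>)"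
proof -
  let ?q = "\<lambda>(\<sigma>, K, L). area \<sigma> * norm (cell_point M L - cell_point M K) / measure lebesgue (dual_cell M \<sigma>)"
  let ?S = "{area \<sigma> * norm (cell_point M L - cell_point M K) / measure lebesgue (dual_cell M \<sigma>)
                    | \<sigma> K L. separates M \<sigma> K L}"
  have "?S \<subseteq> ?q ` (all_faces M \<times> cells M \<times> cells M)"
  proof
    fix r assume "r \<in> ?S"
    then obtain \<sigma> K L where r: "separates M \<sigma> K L" "r = ?q (\<sigma>, K, L)" by auto
    then have "(\<sigma>, K, L) \<in> all_faces M \<times> cells M \<times> cells M"
      unfolding separates_def all_faces_def by blast
    then show "r \<in> ?q ` (all_faces M \<times> cells M \<times> cells M)" unfolding r(2) by (rule imageI)
  qed
  then have fin: "finite ?S"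
    by (rule finite_subset) (intro finite_imageI finite_cartesian_product finite_cells[OF M] finite_all_faces[OF M])
  have "area \<sigma> * norm (cell_point M L - cell_point M K) / measure lebesgue (dual_cell M \<sigma>) \<in> insert 0 ?S"
    using sep by blast
  then have "area \<sigma> * norm (cell_point M L - cell_point M K) / measure lebesgue (dual_cell M \<sigma>) \<le> theta_grad M"
    unfolding theta_grad_def using fin by (intro Max_ge) simp_all
  then show ?thesis
    using is_mesh_dual_pos[OF M sep] by (simp add: pos_divide_le_eq)
qed

lemma face_grad_interior:
  assumes "\<sigma> \<in> int_faces M"
  obtains K L where "separates M \<sigma> K L"
    "face_grad M \<phi> \<sigma> = (area \<sigma> / measure lebesgue (dual_cell M \<sigma>) *
       (\<phi> (cell_point M L) - \<phi> (cell_point M K))) *\<^sub>R normal_vec K \<sigma>"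
proof -
  define p where "p = (SOME (K, L). separates M \<sigma> K L)"
  obtain K L where p: "p = (K, L)" by (cases p)
  have "\<exists>p. (\<lambda>(K, L). separates M \<sigma> K L) p" using assms unfolding int_faces_def by auto
  then have "(\<lambda>(K, L). separates M \<sigma> K L) p" unfolding p_def by (rule someI_ex)
  then have "separates M \<sigma> K L" by (simp add: p)
  moreover have "face_grad M \<phi> \<sigma> = (area \<sigma> / measure lebesgue (dual_cell M \<sigma>) *
       (\<phi> (cell_point M L) - \<phi> (cell_point M K))) *\<^sub>R normal_vec K \<sigma>"
    unfolding face_grad_def p_def[symmetric] p using assms by simp
  ultimately show thesis by (rule that)
qed

text \<open>This is where the regularity of the meshes enters: it converts the flux of the jump of \<open>\<phi>\<close> through a
  face into the volume of the dual cell, and those volumes add up to that of the domain.\<close>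

lemma area_mult_jump_le:
  assumes M: "is_mesh \<Omega> M" and th: "theta_grad M \<le> \<theta>" and sep: "separates M \<sigma> K L"
    and lip: "\<And>x y. \<bar>\<phi> x - \<phi> y\<bar> \<le> B * dist x y" and B: "B \<ge> 0"
  shows "area \<sigma> * \<bar>\<phi> (cell_point M L) - \<phi> (cell_point M K)\<bar> \<le> B * \<theta> * measure lebesgue (dual_cell M \<sigma>)"
proof -
  have "area \<sigma> * \<bar>\<phi> (cell_point M L) - \<phi> (cell_point M K)\<bar>
      \<le> area \<sigma> * (B * norm (cell_point M L - cell_point M K))"
    using lip[of "cell_point M L" "cell_point M K"] area_nonneg[of \<sigma>]
    by (intro mult_left_mono) (simp_all add: dist_norm)
  also have "\<dots> = B * (area \<sigma> * norm (cell_point M L - cell_point M K))" by simp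
  also have "\<dots> \<le> B * (theta_grad M * measure lebesgue (dual_cell M \<sigma>))"
    by (rule mult_left_mono[OF theta_grad_ge[OF M sep] B])
  also have "\<dots> \<le> B * (\<theta> * measure lebesgue (dual_cell M \<sigma>))"
    using th B by (intro mult_left_mono mult_right_mono) simp_all
  finally show ?thesis by simp
qed

lemma norm_face_grad_le:
  assumes M: "is_mesh \<Omega> M" and th: "theta_grad M \<le> \<theta>" "\<theta> \<ge> 0"
    and lip: "\<And>x y. \<bar>\<phi> x - \<phi> y\<bar> \<le> B * dist x y" and B: "B \<ge> 0"
  shows "norm (face_grad M \<phi> \<sigma>) \<le> B * \<theta>"
proof (cases "\<sigma> \<in> int_faces M")
  case True
  obtain K L where KL: "separates M \<sigma> K L"
    "face_grad M \<phi> \<sigma> = (area \<sigma> / measure lebesgue (dual_cell M \<sigma>) *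
       (\<phi> (cell_point M L) - \<phi> (cell_point M K))) *\<^sub>R normal_vec K \<sigma>"
    using face_grad_interior[OF True] .
  have K: "K \<in> cells M" "\<sigma> \<in> cell_faces M K" using KL unfolding separates_def by auto
  have "norm (normal_vec K \<sigma>) = 1" using face_hyperplane[OF M K] by blast
  then have "norm (face_grad M \<phi> \<sigma>) = area \<sigma> * \<bar>\<phi> (cell_point M L) - \<phi> (cell_point M K)\<bar> / measure lebesgue (dual_cell M \<sigma>)"
    unfolding KL(2) by (simp add: abs_mult area_nonneg)
  also have "\<dots> \<le> B * \<theta>"
    using area_mult_jump_le[OF M th(1) KL(1) lip B] is_mesh_dual_pos[OF M KL(1)]
    by (simp add: pos_divide_le_eq)
  finally show ?thesis .
qed (use th B in \<open>simp add: face_grad_def\<close>)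

section \<open>Piecewise constant interpolation on the cells\<close>

lemma integrable_mult_bounded:
  fixes f g :: "'a \<Rightarrow> real"
  assumes f: "integrable N f" and g: "g \<in> borel_measurable N" and C: "\<And>x. \<bar>g x\<bar> \<le> C"
  shows "integrable N (\<lambda>x. f x * g x)"
proof (rule Bochner_Integration.integrable_bound[of _ "\<lambda>x. C * f x"])
  show "AE x in N. norm (f x * g x) \<le> norm (C * f x)"
  proof (rule AE_I2)
    fix x
    have "\<bar>f x\<bar> * \<bar>g x\<bar> \<le> \<bar>f x\<bar> * \<bar>C\<bar>"
      using C[of x] by (intro mult_left_mono) auto
    then show "norm (f x * g x) \<le> norm (C * f x)" by (simp add: abs_mult mult.commute)
  qed
qed (use f g in auto)

lemma integrable_indicator_mult:
  fixes g :: "'a::euclidean_space \<Rightarrow> real"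
  assumes "S \<in> lmeasurable" "g \<in> borel_measurable lebesgue" "\<And>x. \<bar>g x\<bar> \<le> C"
  shows "integrable lebesgue (\<lambda>x. indicat_real S x * g x)"
proof (rule integrable_mult_bounded[OF _ assms(2,3)])
  show "integrable lebesgue (indicat_real S)"
    using assms(1) by (intro integrable_real_indicator) (auto simp: fmeasurable_def)
qed

text \<open>Replaces g by a single value on a small set; used for dual cells and for prisms over faces.\<close>

lemma integral_indicator_near_const:
  fixes g :: "'a::euclidean_space \<Rightarrow> real"
  assumes S: "S \<in> lmeasurable" and g: "g \<in> borel_measurable lebesgue" "\<And>x. \<bar>g x\<bar> \<le> C"
    and near: "\<And>x. x \<in> S \<Longrightarrow> \<bar>g x - a\<bar> \<le> r"
  shows "\<bar>(LINT x|lebesgue. indicat_real S x * g x) - measure lebesgue S * a\<bar> \<le> r * measure lebesgue S"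
proof -
  have iS: "integrable lebesgue (indicat_real S)"
    using S by (intro integrable_real_indicator) (auto simp: fmeasurable_def)
  have "(LINT x|lebesgue. indicat_real S x * g x) - measure lebesgue S * a
      = (LINT x|lebesgue. indicat_real S x * g x - indicat_real S x * a)"
    using integrable_indicator_mult[OF S g] iS by (subst Bochner_Integration.integral_diff) auto
  also have "\<bar>\<dots>\<bar> \<le> (LINT x|lebesgue. r * indicat_real S x)"
  proof (rule integral_abs_bound_integral)
    show "integrable lebesgue (\<lambda>x. indicat_real S x * g x - indicat_real S x * a)"
      using integrable_indicator_mult[OF S g] iS by auto
    show "\<bar>indicat_real S x * g x - indicat_real S x * a\<bar> \<le> r * indicat_real S x" for x
      using near[of x] by (simp add: indicator_def)
  qed (use iS in auto)
  also have "\<dots> = r * measure lebesgue S" using S by simp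
  finally show ?thesis .
qed

lemma
  fixes f :: "'a::euclidean_space \<Rightarrow> real"
  assumes "f \<in> borel_measurable borel" "integrable lebesgue f"
  shows integrable_lebesgue_translate: "integrable lebesgue (\<lambda>x. f (x + w))"
    and integral_lebesgue_translate: "(LINT x|lebesgue. f (x + w)) = (LINT x|lebesgue. f x)"
proof -
  have f: "integrable lborel f" using assms by (simp add: integrable_completion)
  have fb: "f \<in> borel_measurable lborel" using assms by simp
  have d: "distr lborel lborel ((+) w) = lborel"
    using lborel_distr_plus[of w] by (simp cong: distr_cong)
  have "integrable (distr lborel lborel ((+) w)) f" using f d by simp
  then have i: "integrable lborel (\<lambda>x. f (w + x))"
    by (subst (asm) integrable_distr_eq) (use fb in auto)
  have m: "(\<lambda>x. f (x + w)) \<in> borel_measurable lborel" using assms by simp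
  show "integrable lebesgue (\<lambda>x. f (x + w))"
    using i m by (simp add: integrable_completion add.commute)
  have "(LINT x|lborel. f x) = (LINT x|distr lborel lborel ((+) w). f x)" using d by simp
  also have "\<dots> = (LINT x|lborel. f (w + x))"
    by (rule integral_distr) (use fb in auto)
  finally show "(LINT x|lebesgue. f (x + w)) = (LINT x|lebesgue. f x)"
    using fb m by (simp add: integral_completion add.commute)
qed

text \<open>Interiors of cells instead of cells make the function Borel; the boundaries of the cells are null.\<close>

definition cell_interpolant :: "'a::euclidean_space mesh \<Rightarrow> ('a \<Rightarrow> real) \<Rightarrow> 'a \<Rightarrow> real" where
  "cell_interpolant M \<phi> x = (\<Sum>K\<in>cells M. \<phi> (cell_point M K) * indicat_real (interior K) x)"

lemma borel_cell_interpolant [measurable]: "cell_interpolant M \<phi> \<in> borel_measurable borel"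
  unfolding cell_interpolant_def by (intro borel_measurable_sum borel_measurable_times borel_measurable_const
      borel_measurable_indicator) simp

lemma integrable_cell_interpolant:
  assumes "is_mesh \<Omega> M" "bounded \<Omega>"
  shows "integrable lebesgue (cell_interpolant M \<phi>)"
  unfolding cell_interpolant_def
proof (intro Bochner_Integration.integrable_sum integrable_mult_right)
  fix K assume "K \<in> cells M"
  then have "interior K \<in> lmeasurable"
    using bounded_cell[OF assms] bounded_interior lmeasurable_open open_interior by blast
  then show "integrable lebesgue (indicat_real (interior K))"
    by (intro integrable_real_indicator) (auto simp: fmeasurable_def)
qed

lemma AE_cell_interpolant_error:
  assumes M: "is_mesh \<Omega> M" and bd: "bounded \<Omega>"
    and h: "\<And>K. K \<in> cells M \<Longrightarrow> diameter K \<le> h"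
    and lip: "\<And>x y. \<bar>\<phi> x - \<phi> y\<bar> \<le> B * dist x y" and B: "B \<ge> 0"
    and zero: "\<And>x. x \<notin> \<Omega> \<Longrightarrow> \<phi> x = 0"
  shows "AE x in lebesgue. \<bar>cell_interpolant M \<phi> x - \<phi> x\<bar> \<le> B * h * indicat_real \<Omega> x"
proof -
  have "negligible (\<Omega> - \<Union>(cells M))" "negligible (\<Union>(cells M) - \<Omega>)"
    using is_mesh_null_partition_cells[OF M] unfolding null_partition_def by simp_all
  note ae = this[THEN AE_not_mem_negligible]
  have "AE x in lebesgue. \<forall>K\<in>cells M. x \<notin> frontier K"
    by (intro AE_finite_allI finite_cells[OF M] AE_not_mem_negligible negligible_frontier_polyhedral
        cell_polyhedral[OF M])
  from this ae show ?thesis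
  proof eventually_elim
    case (elim x)
    show ?case
    proof (cases "x \<in> \<Omega>")
      case True
      then obtain K where K: "K \<in> cells M" "x \<in> K" using elim(2) by blast
      have xK: "x \<in> interior K"
        using elim(1) K closure_subset[of K] unfolding frontier_def by blast
      have "cell_interpolant M \<phi> x = (\<Sum>L\<in>{K}. \<phi> (cell_point M L) * indicat_real (interior L) x)"
        unfolding cell_interpolant_def
      proof (rule sum.mono_neutral_right[OF finite_cells[OF M]])
        show "\<forall>L\<in>cells M - {K}. \<phi> (cell_point M L) * indicat_real (interior L) x = 0"
        proof
          fix L assume "L \<in> cells M - {K}"
          then have "x \<notin> interior L" using interior_cells_disjoint[OF M K(1), of L] xK by blast
          then show "\<phi> (cell_point M L) * indicat_real (interior L) x = 0" by simp
        qed
      qed (use K in simp)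
      then have "cell_interpolant M \<phi> x = \<phi> (cell_point M K)" using xK by simp
      moreover have "dist (cell_point M K) x \<le> h"
        using diameter_bounded_bound[OF bounded_cell[OF M bd K(1)] cell_point_mem[OF M K(1)] K(2)] h[OF K(1)]
        by simp
      then have "\<bar>\<phi> (cell_point M K) - \<phi> x\<bar> \<le> B * h"
        using lip[of "cell_point M K" x] mult_left_mono[OF _ B, of "dist (cell_point M K) x" h] by simp
      ultimately show ?thesis using True by simp
    next
      case False
      have "x \<notin> interior K" if "K \<in> cells M" for K
        using elim(3) False that interior_subset by blast
      then have "cell_interpolant M \<phi> x = 0" unfolding cell_interpolant_def by simp
      then show ?thesis using False zero by simp
    qed
  qed
qed

section \<open>Consistency of the discrete gradient with difference quotients\<close>

text \<open>Sum the crossing formula over the cells, weighted by the values of \<open>\<phi>\<close>, and exchange the order of the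
  two sums.  For an interior face the inner sum becomes the jump of \<open>\<phi>\<close>, by \<open>cells_of_face\<close> and
  \<open>opposite_normals\<close>.\<close>

lemma integral_increment_cell_interpolant:
  assumes M: "is_mesh \<Omega> M" and bd: "bounded \<Omega>"
    and g: "g \<in> borel_measurable lebesgue" "\<And>x. \<bar>g x\<bar> \<le> C"
  shows "(LINT x|lebesgue. (cell_interpolant M \<phi> (x + w) - cell_interpolant M \<phi> x) * g x) =
    (\<Sum>\<sigma>\<in>all_faces M. - (\<Sum>K\<in>{K\<in>cells M. \<sigma> \<in> cell_faces M K}. \<phi> (cell_point M K) * sgn (normal_vec K \<sigma> \<bullet> w)) *
       (LINT x|lebesgue. indicat_real (sweep \<sigma> (- w)) x * g x))"
proof -
  let ?u = "cell_interpolant M \<phi>"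
  let ?p = "\<lambda>K. \<phi> (cell_point M K)"
  define J where "J \<sigma> = - (\<Sum>K\<in>{K\<in>cells M. \<sigma> \<in> cell_faces M K}. ?p K * sgn (normal_vec K \<sigma> \<bullet> w))" for \<sigma>
  have "AE x in lebesgue. \<forall>K\<in>cells M. indicat_real (interior K) (x + w) - indicat_real (interior K) x =
     - (\<Sum>\<sigma>\<in>cell_faces M K. sgn (normal_vec K \<sigma> \<bullet> w) * indicat_real (sweep \<sigma> (- w)) x)"
    by (intro AE_finite_allI finite_cells[OF M] AE_increment_indicator_cell cell_polyhedral[OF M]
        cell_finite_faces[OF M] cell_frontier[OF M] face_normal[OF M] faces_surface_disjoint[OF M])
  then have ae: "AE x in lebesgue. (?u (x + w) - ?u x) * g x =
      (\<Sum>\<sigma>\<in>all_faces M. J \<sigma> * (indicat_real (sweep \<sigma> (- w)) x * g x))"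
  proof eventually_elim
    case (elim x)
    let ?s = "\<lambda>\<sigma>. indicat_real (sweep \<sigma> (- w)) x"
    have "?u (x + w) - ?u x = (\<Sum>K\<in>cells M. ?p K * (indicat_real (interior K) (x + w) - indicat_real (interior K) x))"
      unfolding cell_interpolant_def by (simp add: sum_subtractf right_diff_distrib)
    also have "\<dots> = (\<Sum>K\<in>cells M. ?p K * - (\<Sum>\<sigma>\<in>cell_faces M K. sgn (normal_vec K \<sigma> \<bullet> w) * ?s \<sigma>))"
      by (intro sum.cong refl arg_cong2[where f="(*)"]) (rule bspec[OF elim])
    also have "\<dots> = (\<Sum>K\<in>cells M. \<Sum>\<sigma>\<in>{\<sigma>\<in>all_faces M. \<sigma> \<in> cell_faces M K}. - (?p K * sgn (normal_vec K \<sigma> \<bullet> w)) * ?s \<sigma>)"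
    proof (intro sum.cong refl)
      fix K assume K: "K \<in> cells M"
      have "{\<sigma>\<in>all_faces M. \<sigma> \<in> cell_faces M K} = cell_faces M K"
        using K unfolding all_faces_def by blast
      then show "?p K * - (\<Sum>\<sigma>\<in>cell_faces M K. sgn (normal_vec K \<sigma> \<bullet> w) * ?s \<sigma>) =
        (\<Sum>\<sigma>\<in>{\<sigma>\<in>all_faces M. \<sigma> \<in> cell_faces M K}. - (?p K * sgn (normal_vec K \<sigma> \<bullet> w)) * ?s \<sigma>)"
        by (simp add: sum_distrib_left sum_negf mult.assoc)
    qed
    also have "\<dots> = (\<Sum>\<sigma>\<in>all_faces M. \<Sum>K\<in>{K\<in>cells M. \<sigma> \<in> cell_faces M K}. - (?p K * sgn (normal_vec K \<sigma> \<bullet> w)) * ?s \<sigma>)"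
      by (rule sum.swap_restrict[OF finite_cells[OF M] finite_all_faces[OF M]])
    also have "\<dots> = (\<Sum>\<sigma>\<in>all_faces M. J \<sigma> * ?s \<sigma>)"
      unfolding J_def by (simp add: sum_distrib_right sum_negf)
    finally show ?case by (simp add: sum_distrib_right mult.assoc)
  qed
  have lm: "sweep \<sigma> (- w) \<in> lmeasurable" if \<sigma>: "\<sigma> \<in> all_faces M" for \<sigma>
  proof -
    obtain K where K: "K \<in> cells M" "\<sigma> \<in> cell_faces M K" using \<sigma> unfolding all_faces_def by blast
    obtain c where c: "norm (normal_vec K \<sigma>) = 1" "\<sigma> \<subseteq> {x. normal_vec K \<sigma> \<bullet> x = c}"
      using face_hyperplane[OF M K] .
    then have "normal_vec K \<sigma> \<noteq> 0" by auto
    then show ?thesis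
      by (rule sweep_lmeasurable[OF face_borel[OF M K] c(2) _ bounded_face[OF M bd K]])
  qed
  have int: "integrable lebesgue (\<lambda>x. J \<sigma> * (indicat_real (sweep \<sigma> (- w)) x * g x))" if "\<sigma> \<in> all_faces M" for \<sigma>
    by (intro integrable_mult_right integrable_indicator_mult[OF lm[OF that] g])
  have iu: "integrable lebesgue ?u" by (rule integrable_cell_interpolant[OF M bd])
  have iu': "integrable lebesgue (\<lambda>x. ?u (x + w))"
    by (rule integrable_lebesgue_translate[OF _ iu]) measurable
  have "(LINT x|lebesgue. (?u (x + w) - ?u x) * g x)
      = (LINT x|lebesgue. (\<Sum>\<sigma>\<in>all_faces M. J \<sigma> * (indicat_real (sweep \<sigma> (- w)) x * g x)))"
  proof (rule integral_cong_AE[OF _ _ ae])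
    show "(\<lambda>x. (?u (x + w) - ?u x) * g x) \<in> borel_measurable lebesgue"
      using borel_measurable_integrable[OF iu] borel_measurable_integrable[OF iu'] g(1)
      by (intro borel_measurable_times borel_measurable_diff)
    show "(\<lambda>x. \<Sum>\<sigma>\<in>all_faces M. J \<sigma> * (indicat_real (sweep \<sigma> (- w)) x * g x)) \<in> borel_measurable lebesgue"
      using int by (intro borel_measurable_sum borel_measurable_integrable)
  qed
  also have "\<dots> = (\<Sum>\<sigma>\<in>all_faces M. (LINT x|lebesgue. J \<sigma> * (indicat_real (sweep \<sigma> (- w)) x * g x)))"
    by (rule Bochner_Integration.integral_sum[OF int])
  finally show ?thesis unfolding J_def by simp
qed

lemma dual_cell_diff_negligible:
  assumes "is_mesh \<Omega> M" "\<sigma> \<in> all_faces M"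
  shows "negligible (dual_cell M \<sigma> - \<Omega>)"
proof -
  have "negligible ((\<Union>\<sigma>\<in>all_faces M. dual_cell M \<sigma>) - \<Omega>)"
    using is_mesh_null_partition_dual[OF assms(1)] unfolding null_partition_def by simp
  then show ?thesis by (rule negligible_subset) (use assms(2) in blast)
qed

lemma dual_cell_lmeasurable:
  assumes M: "is_mesh \<Omega> M" and \<Omega>: "open \<Omega>" "bounded \<Omega>" and \<sigma>: "\<sigma> \<in> all_faces M"
  shows "dual_cell M \<sigma> \<in> lmeasurable"
proof -
  let ?D = "dual_cell M \<sigma>"
  have D: "?D \<in> sets lebesgue"
    using is_mesh_null_partition_dual[OF M] \<sigma> unfolding null_partition_def by simp
  have "\<Omega> \<in> lmeasurable" using \<Omega> by (simp add: lmeasurable_open)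
  then have "\<Omega> \<inter> ?D \<in> lmeasurable" using D by (simp add: fmeasurable_Int_fmeasurable)
  moreover have "?D - \<Omega> \<in> lmeasurable"
    by (rule negligible_imp_measurable[OF dual_cell_diff_negligible[OF M \<sigma>]])
  ultimately have "(\<Omega> \<inter> ?D) \<union> (?D - \<Omega>) \<in> lmeasurable" by (rule fmeasurable.Un)
  moreover have "(\<Omega> \<inter> ?D) \<union> (?D - \<Omega>) = ?D" by blast
  ultimately show ?thesis by simp
qed

lemma sum_measure_dual_cells_le:
  assumes M: "is_mesh \<Omega> M" and \<Omega>: "open \<Omega>" "bounded \<Omega>"
  shows "(\<Sum>\<sigma>\<in>all_faces M. measure lebesgue (dual_cell M \<sigma>)) \<le> measure lebesgue \<Omega>"
proof -
  let ?U = "\<Union>(dual_cell M ` all_faces M)"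
  have lm: "\<Omega> \<in> lmeasurable" using \<Omega> by (simp add: lmeasurable_open)
  have N: "negligible (?U - \<Omega>)"
    using is_mesh_null_partition_dual[OF M] unfolding null_partition_def by simp
  have "(\<Sum>\<sigma>\<in>all_faces M. measure lebesgue (dual_cell M \<sigma>)) = measure lebesgue ?U"
  proof (rule measure_negligible_finite_Union_image[symmetric, OF finite_all_faces[OF M]])
    show "dual_cell M \<sigma> \<in> lmeasurable" if "\<sigma> \<in> all_faces M" for \<sigma>
      by (rule dual_cell_lmeasurable[OF M \<Omega> that])
    show "pairwise (\<lambda>x y. negligible (dual_cell M x \<inter> dual_cell M y)) (all_faces M)"
      using is_mesh_null_partition_dual[OF M] unfolding null_partition_def pairwise_def by simp
  qed
  also have "\<dots> \<le> measure lebesgue (\<Omega> \<union> (?U - \<Omega>))"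
  proof (rule measure_mono_fmeasurable)
    show "?U \<in> sets lebesgue"
      using dual_cell_lmeasurable[OF M \<Omega>] finite_all_faces[OF M]
      by (intro sets.finite_UN) (auto simp: fmeasurable_def)
    show "\<Omega> \<union> (?U - \<Omega>) \<in> lmeasurable"
      by (rule fmeasurable.Un[OF lm negligible_imp_measurable[OF N]])
  qed blast
  also have "\<dots> \<le> measure lebesgue \<Omega> + measure lebesgue (?U - \<Omega>)"
    by (rule measure_Un_le) (use lm negligible_imp_measurable[OF N] in \<open>auto simp: fmeasurable_def\<close>)
  also have "\<dots> = measure lebesgue \<Omega>" using N by (simp add: negligible_imp_measure0)
  finally show ?thesis .
qed

text \<open>For an interior face both integrals are compared with the value g(y) at a point y of the face.  The
  prism has volume |n.w| area, so the two main terms agree; the error is the oscillation of g at distance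
  h + |w| and h from y, times \<open>area_mult_jump_le\<close>.  For a boundary face the values of \<open>\<phi>\<close> at the adjacent
  cell points vanish, since these points are within h of a point outside the domain.\<close>

lemma face_flux_error:
  assumes M: "is_mesh \<Omega> M" and \<Omega>: "open \<Omega>" "bounded \<Omega>"
    and h: "\<And>K. K \<in> cells M \<Longrightarrow> diameter K \<le> h"
    and th: "theta_grad M \<le> \<theta>" "\<theta> \<ge> 0"
    and lip: "\<And>x y. \<bar>\<phi> x - \<phi> y\<bar> \<le> B * dist x y" and B: "B \<ge> 0"
    and ext: "\<And>x y. \<phi> x \<noteq> 0 \<Longrightarrow> y \<notin> \<Omega> \<Longrightarrow> dist x y > h"
    and g: "g \<in> borel_measurable lebesgue" "\<And>x. \<bar>g x\<bar> \<le> C"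
    and gl: "\<And>x y. \<bar>g x - g y\<bar> \<le> L * dist x y" and L: "L \<ge> 0"
    and \<sigma>: "\<sigma> \<in> all_faces M"
  shows "\<bar>- (\<Sum>K\<in>{K\<in>cells M. \<sigma> \<in> cell_faces M K}. \<phi> (cell_point M K) * sgn (normal_vec K \<sigma> \<bullet> w)) *
       (LINT x|lebesgue. indicat_real (sweep \<sigma> (- w)) x * g x)
     - (face_grad M \<phi> \<sigma> \<bullet> w) * (LINT x|lebesgue. indicat_real (dual_cell M \<sigma>) x * g x)\<bar>
    \<le> B * \<theta> * L * (2 * h + norm w) * norm w * measure lebesgue (dual_cell M \<sigma>)"
proof -
  let ?J = "- (\<Sum>K\<in>{K\<in>cells M. \<sigma> \<in> cell_faces M K}. \<phi> (cell_point M K) * sgn (normal_vec K \<sigma> \<bullet> w))"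
  let ?c = "LINT x|lebesgue. indicat_real (sweep \<sigma> (- w)) x * g x"
  let ?D = "dual_cell M \<sigma>"
  let ?d = "LINT x|lebesgue. indicat_real ?D x * g x"
  obtain K0 where K0: "K0 \<in> cells M" "\<sigma> \<in> cell_faces M K0" using \<sigma> unfolding all_faces_def by blast
  have "0 \<le> diameter K0" by (rule diameter_ge_0[OF bounded_cell[OF M \<Omega>(2) K0(1)]])
  then have h0: "h \<ge> 0" using h[OF K0(1)] by simp
  have rhs: "0 \<le> B * \<theta> * L * (2 * h + norm w) * norm w * measure lebesgue ?D"
    using B th(2) L h0 by simp
  have near: "dist x y \<le> h" if "K \<in> cells M" "\<sigma> \<in> cell_faces M K" "y \<in> \<sigma>" "x \<in> closure K" for x y K
  proof -
    have "dist x y \<le> diameter (closure K)"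
      by (rule diameter_bounded_bound[OF bounded_closure[OF bounded_cell[OF M \<Omega>(2) that(1)]] that(4)])
         (use face_subset_closure[OF M that(1,2)] that(3) in blast)
    then show ?thesis
      using h[OF that(1)] diameter_closure[OF bounded_cell[OF M \<Omega>(2) that(1)]] by simp
  qed
  obtain c0 where c0: "norm (normal_vec K0 \<sigma>) = 1" "\<sigma> \<subseteq> {x. normal_vec K0 \<sigma> \<bullet> x = c0}"
    using face_hyperplane[OF M K0] .
  have swl: "sweep \<sigma> (- w) \<in> lmeasurable"
    by (rule sweep_lmeasurable[OF face_borel[OF M K0] c0(2) _ bounded_face[OF M \<Omega>(2) K0]]) (use c0(1) in auto)
  show ?thesis
  proof (cases "area \<sigma> = 0")
    case True
    have "measure lebesgue (sweep \<sigma> (- w)) = 0"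
      using measure_sweep[OF face_borel[OF M K0] c0(2) bounded_face[OF M \<Omega>(2) K0] c0(1), of "- w"] True by simp
    then have "?c = 0"
      using integral_indicator_near_const[OF swl g, of 0 C] g(2) by simp
    moreover have "face_grad M \<phi> \<sigma> = 0" unfolding face_grad_def by (simp add: True case_prod_beta)
    ultimately show ?thesis using rhs by simp
  next
    case False
    then have pos: "area \<sigma> > 0" using area_nonneg[of \<sigma>] by simp
    have "\<sigma> \<noteq> {}"
    proof
      assume "\<sigma> = {}"
      then have "unit_prism \<sigma> = {}" unfolding unit_prism_def by simp
      then show False using pos unfolding area_def by simp
    qed
    then obtain y where y: "y \<in> \<sigma>" by blast
    show ?thesis
    proof (cases "\<sigma> \<in> int_faces M")
      case False
      then have "\<sigma> \<in> ext_faces M" using \<sigma> unfolding ext_faces_def by blast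
      then have "y \<notin> \<Omega>" using is_mesh_ext_faces[OF M] y \<Omega>(1) unfolding frontier_def by (auto simp: interior_open)
      have "\<phi> (cell_point M K) = 0" if "K \<in> cells M" "\<sigma> \<in> cell_faces M K" for K
      proof (rule ccontr)
        assume "\<phi> (cell_point M K) \<noteq> 0"
        then have "h < dist (cell_point M K) y" using ext \<open>y \<notin> \<Omega>\<close> by blast
        moreover have "dist (cell_point M K) y \<le> h"
          using near[OF that y] cell_point_mem[OF M that(1)] closure_subset by blast
        ultimately show False by simp
      qed
      then have "?J = 0" by simp
      moreover have "face_grad M \<phi> \<sigma> = 0" unfolding face_grad_def using False by simp
      ultimately show ?thesis using rhs by simp
    next
      case True
      obtain K N where KN: "separates M \<sigma> K N"
        "face_grad M \<phi> \<sigma> = (area \<sigma> / measure lebesgue ?D *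
           (\<phi> (cell_point M N) - \<phi> (cell_point M K))) *\<^sub>R normal_vec K \<sigma>"
        using face_grad_interior[OF True] .
      have K: "K \<in> cells M" "\<sigma> \<in> cell_faces M K" and N: "N \<in> cells M" "\<sigma> \<in> cell_faces M N" and ne: "K \<noteq> N"
        using KN(1) unfolding separates_def by auto
      let ?n = "normal_vec K \<sigma>"
      define j where "j = \<phi> (cell_point M N) - \<phi> (cell_point M K)"
      obtain c where c: "norm ?n = 1" "\<sigma> \<subseteq> {x. ?n \<bullet> x = c}" using face_hyperplane[OF M K] .
      have opp: "normal_vec N \<sigma> = - ?n" by (rule opposite_normals[OF M \<Omega>(2) K N ne pos])
      have J: "?J = j * sgn (?n \<bullet> w)"
        unfolding cells_of_face[OF M \<Omega>(2) KN(1) pos] using ne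
        by (simp add: opp j_def sgn_minus algebra_simps)
      have Dpos: "measure lebesgue ?D > 0" by (rule is_mesh_dual_pos[OF M KN(1)])
      have msw: "measure lebesgue (sweep \<sigma> (- w)) = \<bar>?n \<bullet> w\<bar> * area \<sigma>"
        using measure_sweep[OF face_borel[OF M K] c(2) bounded_face[OF M \<Omega>(2) K] c(1), of "- w"] by simp
      have "\<bar>?c - \<bar>?n \<bullet> w\<bar> * area \<sigma> * g y\<bar> \<le> L * (h + norm w) * (\<bar>?n \<bullet> w\<bar> * area \<sigma>)"
        unfolding msw[symmetric]
      proof (rule integral_indicator_near_const[OF swl g])
        fix x assume "x \<in> sweep \<sigma> (- w)"
        then obtain t where t: "t \<in> {0..1}" "x + t *\<^sub>R w \<in> \<sigma>" unfolding mem_sweep_minus by blast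
        have "dist x y \<le> dist (x + t *\<^sub>R w) y + norm (t *\<^sub>R w)"
          using dist_triangle[of x y "x + t *\<^sub>R w"] by (simp add: dist_norm)
        also have "dist (x + t *\<^sub>R w) y \<le> h"
          by (rule near[OF K y]) (use t(2) face_subset_closure[OF M K] in blast)
        also have "norm (t *\<^sub>R w) \<le> norm w" using t(1) by (simp add: mult_left_le_one_le)
        finally have "dist x y \<le> h + norm w" by simp
        then show "\<bar>g x - g y\<bar> \<le> L * (h + norm w)"
          using gl[of x y] mult_left_mono[OF _ L, of "dist x y" "h + norm w"] by simp
      qed
      note ec = this
      have ed: "\<bar>?d - measure lebesgue ?D * g y\<bar> \<le> L * h * measure lebesgue ?D"
      proof (rule integral_indicator_near_const[OF dual_cell_lmeasurable[OF M \<Omega> \<sigma>] g])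
        fix x assume "x \<in> ?D"
        then have "x \<in> closure K \<or> x \<in> closure N"
          using is_mesh_dual_subset[OF M KN(1)] closure_subset by blast
        then have "dist x y \<le> h" using near[OF K y] near[OF N y] by blast
        then show "\<bar>g x - g y\<bar> \<le> L * h"
          using gl[of x y] mult_left_mono[OF _ L, of "dist x y" h] by simp
      qed
      have nw: "\<bar>?n \<bullet> w\<bar> \<le> norm w" using Cauchy_Schwarz_ineq2[of ?n w] c(1) by simp
      define m where "m = measure lebesgue ?D"
      have m: "m > 0" using Dpos by (simp add: m_def)
      have "?J * ?c - (face_grad M \<phi> \<sigma> \<bullet> w) * ?d
          = j * (sgn (?n \<bullet> w) * (?c - \<bar>?n \<bullet> w\<bar> * area \<sigma> * g y)
              - area \<sigma> / m * (?n \<bullet> w) * (?d - m * g y))"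
      proof -
        have "sgn (?n \<bullet> w) * \<bar>?n \<bullet> w\<bar> = ?n \<bullet> w" by (simp add: sgn_mult_abs)
        then have a: "sgn (?n \<bullet> w) * (\<bar>?n \<bullet> w\<bar> * area \<sigma> * g y) = (?n \<bullet> w) * area \<sigma> * g y"
          by (simp only: mult.assoc[symmetric])
        have b: "area \<sigma> / m * (?n \<bullet> w) * (m * g y) = (?n \<bullet> w) * area \<sigma> * g y"
          using m by simp
        show ?thesis
          unfolding J KN(2) j_def[symmetric] m_def[symmetric] right_diff_distrib a b by simp
      qed
      also have "\<bar>\<dots>\<bar> \<le> \<bar>j\<bar> * (norm w * (L * (h + norm w) * area \<sigma>) + norm w * (L * h * area \<sigma>))"
      proof -
        have 1: "\<bar>sgn (?n \<bullet> w) * (?c - \<bar>?n \<bullet> w\<bar> * area \<sigma> * g y)\<bar> \<le> norm w * (L * (h + norm w) * area \<sigma>)"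
        proof -
          have "\<bar>sgn (?n \<bullet> w) * (?c - \<bar>?n \<bullet> w\<bar> * area \<sigma> * g y)\<bar> \<le> 1 * \<bar>?c - \<bar>?n \<bullet> w\<bar> * area \<sigma> * g y\<bar>"
            unfolding abs_mult by (rule mult_right_mono) (simp_all add: abs_sgn_eq)
          also have "\<dots> \<le> \<bar>?n \<bullet> w\<bar> * (L * (h + norm w) * area \<sigma>)" using ec by (simp add: mult_ac)
          also have "\<dots> \<le> norm w * (L * (h + norm w) * area \<sigma>)"
            using nw L h0 pos by (intro mult_right_mono) simp_all
          finally show ?thesis .
        qed
        have 2: "\<bar>area \<sigma> / m * (?n \<bullet> w) * (?d - m * g y)\<bar> \<le> norm w * (L * h * area \<sigma>)"
        proof -
          have "\<bar>area \<sigma> / m * (?n \<bullet> w) * (?d - m * g y)\<bar> = area \<sigma> / m * (\<bar>?n \<bullet> w\<bar> * \<bar>?d - m * g y\<bar>)"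
            using pos m by (simp add: abs_mult)
          also have "\<dots> \<le> area \<sigma> / m * (norm w * (L * h * m))"
            using nw ed pos m unfolding m_def by (intro mult_left_mono mult_mono) simp_all
          also have "\<dots> = norm w * (L * h * area \<sigma>)" using m by simp
          finally show ?thesis .
        qed
        show ?thesis
          unfolding abs_mult[of j] by (intro mult_left_mono order_trans[OF abs_triangle_ineq4] add_mono 1 2) simp
      qed
      also have "\<dots> = (area \<sigma> * \<bar>j\<bar>) * (L * (2 * h + norm w) * norm w)" by (simp add: algebra_simps)
      also have "\<dots> \<le> (B * \<theta> * measure lebesgue ?D) * (L * (2 * h + norm w) * norm w)"
        unfolding j_def
        by (rule mult_right_mono[OF area_mult_jump_le[OF M th(1) KN(1) lip B]]) (use L h0 in simp)
      finally show ?thesis by (simp add: mult_ac)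
    qed
  qed
qed

lemma integral_discrete_grad_inner:
  assumes M: "is_mesh \<Omega> M" and \<Omega>: "open \<Omega>" "bounded \<Omega>"
    and g: "g \<in> borel_measurable lebesgue" "\<And>x. \<bar>g x\<bar> \<le> C"
  shows "(LINT x|lebesgue_on \<Omega>. (discrete_grad M \<phi> x \<bullet> w) * g x) =
    (\<Sum>\<sigma>\<in>all_faces M. (face_grad M \<phi> \<sigma> \<bullet> w) * (LINT x|lebesgue. indicat_real (dual_cell M \<sigma>) x * g x))"
proof -
  have \<Omega>s: "\<Omega> \<inter> space lebesgue \<in> sets lebesgue" using \<Omega>(1) by simp
  let ?I = "\<lambda>\<sigma> x. indicat_real (dual_cell M \<sigma>) x * g x"
  have int: "integrable lebesgue (?I \<sigma>)" if "\<sigma> \<in> all_faces M" for \<sigma>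
    by (rule integrable_indicator_mult[OF dual_cell_lmeasurable[OF M \<Omega> that] g])
  have ae: "AE x in lebesgue. \<forall>\<sigma>\<in>all_faces M. x \<notin> dual_cell M \<sigma> - \<Omega>"
    by (intro AE_finite_allI finite_all_faces[OF M] AE_not_mem_negligible dual_cell_diff_negligible[OF M])
  have "(LINT x|lebesgue_on \<Omega>. (discrete_grad M \<phi> x \<bullet> w) * g x)
      = (LINT x|lebesgue_on \<Omega>. (\<Sum>\<sigma>\<in>all_faces M. (face_grad M \<phi> \<sigma> \<bullet> w) * ?I \<sigma> x))"
    unfolding discrete_grad_def inner_sum_left sum_distrib_right by (simp add: mult_ac)
  also have "\<dots> = (LINT x|lebesgue. indicat_real \<Omega> x *\<^sub>R (\<Sum>\<sigma>\<in>all_faces M. (face_grad M \<phi> \<sigma> \<bullet> w) * ?I \<sigma> x))"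
    by (rule integral_restrict_space[OF \<Omega>s])
  also have "\<dots> = (LINT x|lebesgue. (\<Sum>\<sigma>\<in>all_faces M. (face_grad M \<phi> \<sigma> \<bullet> w) * ?I \<sigma> x))"
  proof (rule integral_cong_AE)
    have m: "(\<lambda>x. (\<Sum>\<sigma>\<in>all_faces M. (face_grad M \<phi> \<sigma> \<bullet> w) * ?I \<sigma> x)) \<in> borel_measurable lebesgue"
      using int by (intro borel_measurable_sum borel_measurable_times borel_measurable_const borel_measurable_integrable) auto
    then show "(\<lambda>x. (\<Sum>\<sigma>\<in>all_faces M. (face_grad M \<phi> \<sigma> \<bullet> w) * ?I \<sigma> x)) \<in> borel_measurable lebesgue" .
    show "(\<lambda>x. indicat_real \<Omega> x *\<^sub>R (\<Sum>\<sigma>\<in>all_faces M. (face_grad M \<phi> \<sigma> \<bullet> w) * ?I \<sigma> x)) \<in> borel_measurable lebesgue"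
      by (rule borel_measurable_scaleR[OF _ m]) (use \<Omega>s in \<open>auto intro: borel_measurable_indicator\<close>)
    show "AE x in lebesgue. indicat_real \<Omega> x *\<^sub>R (\<Sum>\<sigma>\<in>all_faces M. (face_grad M \<phi> \<sigma> \<bullet> w) * ?I \<sigma> x)
        = (\<Sum>\<sigma>\<in>all_faces M. (face_grad M \<phi> \<sigma> \<bullet> w) * ?I \<sigma> x)"
      using ae
    proof eventually_elim
      case (elim x)
      show ?case
      proof (cases "x \<in> \<Omega>")
        case False
        have "indicat_real (dual_cell M \<sigma>) x = 0" if "\<sigma> \<in> all_faces M" for \<sigma>
          using bspec[OF elim that] False by (simp add: indicator_def)
        then show ?thesis using False by simp
      qed simp
    qed
  qed
  also have "\<dots> = (\<Sum>\<sigma>\<in>all_faces M. (LINT x|lebesgue. (face_grad M \<phi> \<sigma> \<bullet> w) * ?I \<sigma> x))"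
    by (rule Bochner_Integration.integral_sum) (use int in simp)
  finally show ?thesis by simp
qed

text \<open>Dividing by |w|, the bound is of order h/|w| + h + |w|: it is small when the mesh size is small compared
  with the step w of the difference quotient and the step itself is small.  The first term replaces \<open>\<phi>\<close> by
  its cell interpolant, the second sums the errors of the faces.\<close>

lemma discrete_grad_consistency:
  assumes M: "is_mesh \<Omega> M" and \<Omega>: "open \<Omega>" "bounded \<Omega>"
    and h: "\<And>K. K \<in> cells M \<Longrightarrow> diameter K \<le> h"
    and th: "theta_grad M \<le> \<theta>" "\<theta> \<ge> 0"
    and lip: "\<And>x y. \<bar>\<phi> x - \<phi> y\<bar> \<le> B * dist x y" and B: "B \<ge> 0"
    and zero: "\<And>x. x \<notin> \<Omega> \<Longrightarrow> \<phi> x = 0"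
    and ext: "\<And>x y. \<phi> x \<noteq> 0 \<Longrightarrow> y \<notin> \<Omega> \<Longrightarrow> dist x y > h"
    and \<phi>b: "\<phi> \<in> borel_measurable borel" and \<phi>i: "integrable lebesgue \<phi>"
    and g: "g \<in> borel_measurable lebesgue" "\<And>x. \<bar>g x\<bar> \<le> C"
    and gl: "\<And>x y. \<bar>g x - g y\<bar> \<le> L * dist x y" and L: "L \<ge> 0"
  shows "\<bar>(LINT x|lebesgue. (\<phi> (x + w) - \<phi> x) * g x)
      - (LINT x|lebesgue_on \<Omega>. (discrete_grad M \<phi> x \<bullet> w) * g x)\<bar>
    \<le> (2 * B * h * C + B * \<theta> * L * (2 * h + norm w) * norm w) * measure lebesgue \<Omega>"
proof -
  let ?u = "cell_interpolant M \<phi>"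
  let ?du = "LINT x|lebesgue. (?u (x + w) - ?u x) * g x"
  let ?dp = "LINT x|lebesgue. (\<phi> (x + w) - \<phi> x) * g x"
  let ?G = "LINT x|lebesgue_on \<Omega>. (discrete_grad M \<phi> x \<bullet> w) * g x"
  have lm: "\<Omega> \<in> lmeasurable" using \<Omega> by (simp add: lmeasurable_open)
  have "\<bar>?du - ?G\<bar> \<le> (\<Sum>\<sigma>\<in>all_faces M. B * \<theta> * L * (2 * h + norm w) * norm w * measure lebesgue (dual_cell M \<sigma>))"
    unfolding integral_increment_cell_interpolant[OF M \<Omega>(2) g] integral_discrete_grad_inner[OF M \<Omega> g]
      sum_subtractf[symmetric]
    by (rule order_trans[OF sum_abs sum_mono]) (rule face_flux_error[OF M \<Omega> h th lip B ext g gl L])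
  also have "\<dots> = B * \<theta> * L * (2 * h + norm w) * norm w * (\<Sum>\<sigma>\<in>all_faces M. measure lebesgue (dual_cell M \<sigma>))"
    by (simp add: sum_distrib_left)
  also have "\<dots> \<le> B * \<theta> * L * (2 * h + norm w) * norm w * measure lebesgue \<Omega>"
  proof (cases "cells M = {}")
    case True
    then have "all_faces M = {}" unfolding all_faces_def by simp
    moreover have "negligible \<Omega>"
      using is_mesh_null_partition_cells[OF M] True unfolding null_partition_def by simp
    ultimately show ?thesis by (simp add: negligible_imp_measure0)
  next
    case False
    then obtain K where K: "K \<in> cells M" by blast
    have "0 \<le> diameter K" by (rule diameter_ge_0[OF bounded_cell[OF M \<Omega>(2) K]])
    then have "h \<ge> 0" using h[OF K] by simp
    then show ?thesis
      using sum_measure_dual_cells_le[OF M \<Omega>] B th(2) L by (intro mult_left_mono) simp_all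
  qed
  finally have 1: "\<bar>?du - ?G\<bar> \<le> B * \<theta> * L * (2 * h + norm w) * norm w * measure lebesgue \<Omega>" .
  have iu: "integrable lebesgue ?u" by (rule integrable_cell_interpolant[OF M \<Omega>(2)])
  have iu': "integrable lebesgue (\<lambda>x. ?u (x + w))"
    by (rule integrable_lebesgue_translate[OF _ iu]) measurable
  have ip: "integrable lebesgue (\<lambda>x. \<phi> (x + w))" by (rule integrable_lebesgue_translate[OF \<phi>b \<phi>i])
  have i1: "integrable lebesgue (\<lambda>x. (\<phi> (x + w) - \<phi> x) * g x)"
    by (rule integrable_mult_bounded[OF _ g]) (use ip \<phi>i in simp)
  have i2: "integrable lebesgue (\<lambda>x. (?u (x + w) - ?u x) * g x)"
    by (rule integrable_mult_bounded[OF _ g]) (use iu' iu in simp)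
  have i\<Omega>: "integrable lebesgue (indicat_real \<Omega>)"
    using lm by (intro integrable_real_indicator) (auto simp: fmeasurable_def)
  have b\<Omega>: "indicat_real \<Omega> \<in> borel_measurable borel" using \<Omega>(1) by simp
  have i\<Omega>': "integrable lebesgue (\<lambda>x. indicat_real \<Omega> (x + w))"
    by (rule integrable_lebesgue_translate[OF b\<Omega> i\<Omega>])
  have m\<Omega>: "(LINT x|lebesgue. indicat_real \<Omega> (x + w)) = measure lebesgue \<Omega>"
    using integral_lebesgue_translate[OF b\<Omega> i\<Omega>] lm by simp
  have err: "AE x in lebesgue. \<bar>?u x - \<phi> x\<bar> \<le> B * h * indicat_real \<Omega> x"
    by (rule AE_cell_interpolant_error[OF M \<Omega>(2) h lip B zero])
  have err': "AE x in lebesgue. \<bar>?u (x + w) - \<phi> (x + w)\<bar> \<le> B * h * indicat_real \<Omega> (x + w)"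
  proof -
    obtain N where N: "{x \<in> space lebesgue. \<not> \<bar>?u x - \<phi> x\<bar> \<le> B * h * indicat_real \<Omega> x} \<subseteq> N" "N \<in> null_sets lebesgue"
      using err unfolding eventually_ae_filter by blast
    have "AE x in lebesgue. x \<notin> {x. x + w \<in> N}"
      by (intro AE_not_mem_negligible negligible_translation_preimage) (use N(2) in \<open>simp add: negligible_iff_null_sets\<close>)
    then show ?thesis by eventually_elim (use N(1) in auto)
  qed
  have "\<bar>?dp - ?du\<bar> = \<bar>LINT x|lebesgue. (\<phi> (x + w) - \<phi> x) * g x - (?u (x + w) - ?u x) * g x\<bar>"
    using i1 i2 by simp
  also have "\<dots> \<le> (LINT x|lebesgue. \<bar>(\<phi> (x + w) - \<phi> x) * g x - (?u (x + w) - ?u x) * g x\<bar>)"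
    by (rule integral_abs_bound)
  also have "\<dots> \<le> (LINT x|lebesgue. (B * h * C) * (indicat_real \<Omega> (x + w) + indicat_real \<Omega> x))"
  proof (rule integral_mono_AE)
    show "integrable lebesgue (\<lambda>x. \<bar>(\<phi> (x + w) - \<phi> x) * g x - (?u (x + w) - ?u x) * g x\<bar>)"
      using i1 i2 by (intro integrable_abs Bochner_Integration.integrable_diff)
    show "integrable lebesgue (\<lambda>x. (B * h * C) * (indicat_real \<Omega> (x + w) + indicat_real \<Omega> x))"
      using i\<Omega> i\<Omega>' by simp
    show "AE x in lebesgue. \<bar>(\<phi> (x + w) - \<phi> x) * g x - (?u (x + w) - ?u x) * g x\<bar>
        \<le> (B * h * C) * (indicat_real \<Omega> (x + w) + indicat_real \<Omega> x)"
      using err err'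
    proof eventually_elim
      case (elim x)
      let ?a = "?u x - \<phi> x" and ?b = "?u (x + w) - \<phi> (x + w)"
      have "(\<phi> (x + w) - \<phi> x) * g x - (?u (x + w) - ?u x) * g x = (?a - ?b) * g x"
        by (simp add: algebra_simps)
      also have "\<bar>\<dots>\<bar> \<le> (B * h * indicat_real \<Omega> x + B * h * indicat_real \<Omega> (x + w)) * C"
        unfolding abs_mult using elim g(2)[of x] by (intro mult_mono) auto
      also have "\<dots> = (B * h * C) * (indicat_real \<Omega> (x + w) + indicat_real \<Omega> x)"
        by (simp add: algebra_simps)
      finally show ?case .
    qed
  qed
  also have "\<dots> = 2 * B * h * C * measure lebesgue \<Omega>"
    using i\<Omega> i\<Omega>' m\<Omega> lm by simp
  finally have 2: "\<bar>?dp - ?du\<bar> \<le> 2 * B * h * C * measure lebesgue \<Omega>" .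
  have "\<bar>?dp - ?G\<bar> \<le> \<bar>?dp - ?du\<bar> + \<bar>?du - ?G\<bar>" by simp
  also have "\<dots> \<le> 2 * B * h * C * measure lebesgue \<Omega> + B * \<theta> * L * (2 * h + norm w) * norm w * measure lebesgue \<Omega>"
    by (rule add_mono[OF 2 1])
  finally show ?thesis by (simp add: algebra_simps)
qed

section \<open>Test functions and the limit against Lipschitz weights\<close>

lemma test_function_zero_outside:
  "\<phi> \<in> test_functions \<Omega> \<Longrightarrow> x \<notin> \<Omega> \<Longrightarrow> \<phi> x = 0"
  using closure_subset[of "{x. \<phi> x \<noteq> 0}"] unfolding test_functions_def by blast

lemma
  assumes "\<phi> \<in> test_functions \<Omega>"
  shows test_function_differentiable: "\<phi> differentiable (at x)"
    and continuous_frechet_derivative_test_function: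
      "b \<in> Basis \<Longrightarrow> continuous_on UNIV (\<lambda>x. frechet_derivative \<phi> (at x) b)"
proof -
  have "C_k (Suc 0) \<phi>" using assms unfolding test_functions_def by blast
  then show "\<phi> differentiable (at x)"
    "b \<in> Basis \<Longrightarrow> continuous_on UNIV (\<lambda>x. frechet_derivative \<phi> (at x) b)" by simp_all
qed

lemma frechet_derivative_eq_grad_inner:
  fixes \<phi> :: "'a::euclidean_space \<Rightarrow> real"
  assumes "\<phi> differentiable (at x)"
  shows "frechet_derivative \<phi> (at x) v = grad \<phi> x \<bullet> v"
proof -
  interpret linear "frechet_derivative \<phi> (at x)" by (rule linear_frechet_derivative[OF assms])
  have "frechet_derivative \<phi> (at x) v = frechet_derivative \<phi> (at x) (\<Sum>b\<in>Basis. (v \<bullet> b) *\<^sub>R b)"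
    by (simp add: euclidean_representation)
  also have "\<dots> = (\<Sum>b\<in>Basis. (v \<bullet> b) * frechet_derivative \<phi> (at x) b)"
    by (simp add: sum scale)
  also have "\<dots> = grad \<phi> x \<bullet> v"
    unfolding grad_def inner_sum_left inner_scaleR_left by (simp add: inner_commute mult.commute)
  finally show ?thesis .
qed

lemma has_derivative_grad:
  assumes "\<phi> \<in> test_functions \<Omega>"
  shows "(\<phi> has_derivative (\<lambda>v. grad \<phi> x \<bullet> v)) (at x)"
proof -
  have "(\<phi> has_derivative frechet_derivative \<phi> (at x)) (at x)"
    using test_function_differentiable[OF assms] by (simp add: frechet_derivative_works)
  moreover have "frechet_derivative \<phi> (at x) = (\<lambda>v. grad \<phi> x \<bullet> v)"
    using frechet_derivative_eq_grad_inner[OF test_function_differentiable[OF assms]] by (rule ext)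
  ultimately show ?thesis by simp
qed

lemma continuous_grad:
  assumes "\<phi> \<in> test_functions \<Omega>"
  shows "continuous_on UNIV (grad \<phi>)"
  unfolding grad_def
  by (intro continuous_on_sum continuous_on_scaleR continuous_on_const
      continuous_frechet_derivative_test_function[OF assms])

lemma grad_zero_outside:
  assumes "\<phi> \<in> test_functions \<Omega>" "x \<notin> closure {x. \<phi> x \<noteq> 0}"
  shows "grad \<phi> x = 0"
proof -
  let ?U = "- closure {x. \<phi> x \<noteq> 0}"
  have "((\<lambda>_. 0) has_derivative (\<lambda>v. grad \<phi> x \<bullet> v)) (at x)"
  proof (rule has_derivative_transform_within_open[OF has_derivative_grad[OF assms(1)]])
    show "open ?U" by (simp add: open_Compl)
    show "x \<in> ?U" using assms(2) by simp
    show "\<phi> y = 0" if "y \<in> ?U" for y using that closure_subset[of "{x. \<phi> x \<noteq> 0}"] by blast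
  qed
  moreover have "((\<lambda>_. 0) has_derivative (\<lambda>v. 0 :: real)) (at x)" by (rule has_derivative_const)
  ultimately have "(\<lambda>v. grad \<phi> x \<bullet> v) = (\<lambda>v. 0)" by (rule has_derivative_unique)
  then have "grad \<phi> x \<bullet> grad \<phi> x = 0" by metis
  then show ?thesis by simp
qed

text \<open>The gradient is continuous and vanishes off a compact set, hence is bounded.\<close>

lemma test_function_lipschitz:
  assumes \<phi>: "\<phi> \<in> test_functions \<Omega>"
  obtains B where "B \<ge> 0" "\<And>x. norm (grad \<phi> x) \<le> B" "\<And>x y. \<bar>\<phi> x - \<phi> y\<bar> \<le> B * dist x y"
proof -
  let ?S = "closure {x. \<phi> x \<noteq> 0}"
  have "compact ?S" using \<phi> unfolding test_functions_def by blast
  then have "compact (grad \<phi> ` ?S)"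
    by (intro compact_continuous_image continuous_on_subset[OF continuous_grad[OF \<phi>]]) auto
  then have "bounded (grad \<phi> ` ?S)" by (rule compact_imp_bounded)
  then obtain B0 where "\<forall>x\<in>grad \<phi> ` ?S. norm x \<le> B0" unfolding bounded_iff by blast
  then have B0: "\<And>x. x \<in> ?S \<Longrightarrow> norm (grad \<phi> x) \<le> B0" by blast
  define B where "B = max 0 B0"
  have B: "norm (grad \<phi> x) \<le> B" for x
  proof (cases "x \<in> ?S")
    case True
    then show ?thesis using B0[OF True] by (simp add: B_def)
  qed (simp add: grad_zero_outside[OF \<phi>] B_def)
  have "\<bar>\<phi> x - \<phi> y\<bar> \<le> B * dist x y" for x y
  proof -
    have "norm (\<phi> x - \<phi> y) \<le> B * norm (x - y)"
    proof (rule differentiable_bound[of UNIV])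
      fix z
      show "onorm (\<lambda>v. grad \<phi> z \<bullet> v) \<le> B"
      proof (rule onorm_bound)
        show "norm (grad \<phi> z \<bullet> v) \<le> B * norm v" for v
          using Cauchy_Schwarz_ineq2[of "grad \<phi> z" v] mult_right_mono[OF B[of z], of "norm v"] by simp
      qed (simp add: B_def)
    qed (use has_derivative_grad[OF \<phi>] in auto)
    then show ?thesis by (simp add: dist_norm)
  qed
  then show thesis using that[of B] B by (simp add: B_def)
qed

lemma
  assumes \<phi>: "\<phi> \<in> test_functions \<Omega>" and \<Omega>: "open \<Omega>" "bounded \<Omega>"
  shows borel_test_function: "\<phi> \<in> borel_measurable borel"
    and integrable_test_function: "integrable lebesgue \<phi>"
proof -
  let ?S = "closure {x. \<phi> x \<noteq> 0}"
  have cont: "continuous_on UNIV \<phi>"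
    using test_function_differentiable[OF \<phi>]
    by (intro differentiable_imp_continuous_on) (simp add: differentiable_on_def)
  then show bm: "\<phi> \<in> borel_measurable borel" by (rule borel_measurable_continuous_onI)
  have cS: "compact ?S" using \<phi> unfolding test_functions_def by blast
  have "integrable lborel (\<lambda>x. indicator ?S x *\<^sub>R \<phi> x)"
    by (rule borel_integrable_compact[OF cS continuous_on_subset[OF cont subset_UNIV]])
  moreover have "(\<lambda>x. indicator ?S x *\<^sub>R \<phi> x) = \<phi>"
  proof
    show "indicator ?S x *\<^sub>R \<phi> x = \<phi> x" for x
      using closure_subset[of "{x. \<phi> x \<noteq> 0}"] by (cases "\<phi> x = 0") (auto simp: indicator_def)
  qed
  ultimately have "integrable lborel \<phi>" by (simp only:)
  then show "integrable lebesgue \<phi>"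
    using bm by (simp add: integrable_completion)
qed

lemma difference_quotient_tendsto_grad:
  assumes "\<phi> \<in> test_functions \<Omega>"
  shows "(\<lambda>k. (\<phi> (x + inverse (real (Suc k)) *\<^sub>R c) - \<phi> x) / inverse (real (Suc k))) \<longlonglongrightarrow> grad \<phi> x \<bullet> c"
proof -
  have "((\<lambda>s. \<phi> (x + s *\<^sub>R c)) has_derivative (\<lambda>s. grad \<phi> x \<bullet> (s *\<^sub>R c))) (at 0)"
  proof (rule has_derivative_compose[where g=\<phi> and f="\<lambda>s. x + s *\<^sub>R c" and s=UNIV and x=0 and f'="\<lambda>s. s *\<^sub>R c"])
    show "((\<lambda>s. x + s *\<^sub>R c) has_derivative (\<lambda>s. s *\<^sub>R c)) (at 0)"
      by (auto intro!: derivative_eq_intros)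
    show "(\<phi> has_derivative (\<lambda>v. grad \<phi> x \<bullet> v)) (at (x + 0 *\<^sub>R c))"
      using has_derivative_grad[OF assms, of x] by simp
  qed
  moreover have "(\<lambda>s. grad \<phi> x \<bullet> (s *\<^sub>R c)) = (*) (grad \<phi> x \<bullet> c)"
    by (simp add: fun_eq_iff)
  ultimately have "((\<lambda>s. \<phi> (x + s *\<^sub>R c)) has_real_derivative (grad \<phi> x \<bullet> c)) (at 0)"
    unfolding has_field_derivative_def by (simp only:)
  then have "((\<lambda>s. (\<phi> (x + s *\<^sub>R c) - \<phi> x) / s) \<longlongrightarrow> grad \<phi> x \<bullet> c) (at 0)"
    by (simp add: DERIV_def)
  moreover have "filterlim (\<lambda>k. inverse (real (Suc k))) (at 0) sequentially"
    unfolding filterlim_at using LIMSEQ_inverse_real_of_nat by simp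
  ultimately show ?thesis by (rule filterlim_compose)
qed

text \<open>The difference quotients are bounded by the Lipschitz constant and, for steps at most 1, supported in one
  ball.\<close>

lemma integral_difference_quotient_tendsto:
  assumes \<phi>: "\<phi> \<in> test_functions \<Omega>" and \<Omega>: "open \<Omega>" "bounded \<Omega>"
    and g: "g \<in> borel_measurable lebesgue" "\<And>x. \<bar>g x\<bar> \<le> C"
  shows "(\<lambda>k. LINT x|lebesgue. (\<phi> (x + inverse (real (Suc k)) *\<^sub>R c) - \<phi> x) / inverse (real (Suc k)) * g x)
    \<longlonglongrightarrow> (LINT x|lebesgue. (grad \<phi> x \<bullet> c) * g x)"
proof -
  obtain B where B: "B \<ge> 0" "\<And>x. norm (grad \<phi> x) \<le> B" "\<And>x y. \<bar>\<phi> x - \<phi> y\<bar> \<le> B * dist x y"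
    using test_function_lipschitz[OF \<phi>] by blast
  obtain R where R: "\<And>x. x \<in> \<Omega> \<Longrightarrow> norm x \<le> R" using \<Omega>(2) unfolding bounded_iff by blast
  let ?b = "cball (0::'a) (R + norm c)"
  let ?s = "\<lambda>k. inverse (real (Suc k))"
  have \<phi>b: "\<phi> \<in> borel_measurable borel" by (rule borel_test_function[OF \<phi> \<Omega>])
  have gradb: "grad \<phi> \<in> borel_measurable borel"
    by (rule borel_measurable_continuous_onI[OF continuous_grad[OF \<phi>]])
  have m: "(\<lambda>x. \<phi> (x + w)) \<in> borel_measurable lebesgue" for w
  proof -
    have "(\<lambda>x. \<phi> (x + w)) \<in> borel_measurable lborel" using \<phi>b by measurable
    then show ?thesis by (rule measurable_completion)
  qed
  have mg: "(\<lambda>x. grad \<phi> x \<bullet> c) \<in> borel_measurable lebesgue"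
  proof -
    have "(\<lambda>x. grad \<phi> x \<bullet> c) \<in> borel_measurable lborel" using gradb by measurable
    then show ?thesis by (rule measurable_completion)
  qed
  show ?thesis
  proof (rule integral_dominated_convergence[where w="\<lambda>x. B * norm c * \<bar>C\<bar> * indicat_real ?b x"])
    show "(\<lambda>x. (grad \<phi> x \<bullet> c) * g x) \<in> borel_measurable lebesgue"
      by (rule borel_measurable_times[OF mg g(1)])
    show "(\<lambda>x. (\<phi> (x + ?s k *\<^sub>R c) - \<phi> x) / ?s k * g x) \<in> borel_measurable lebesgue" for k
      using m[of "?s k *\<^sub>R c"] m[of 0] g(1) by (intro borel_measurable_times borel_measurable_divide borel_measurable_diff) simp_all
    show "integrable lebesgue (\<lambda>x. B * norm c * \<bar>C\<bar> * indicat_real ?b x)"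
      using lmeasurable_cball[of "0::'a" "R + norm c"]
      by (intro integrable_mult_right integrable_real_indicator) (auto simp: fmeasurable_def)
    show "AE x in lebesgue. (\<lambda>k. (\<phi> (x + ?s k *\<^sub>R c) - \<phi> x) / ?s k * g x) \<longlonglongrightarrow> (grad \<phi> x \<bullet> c) * g x"
      by (intro AE_I2 tendsto_mult tendsto_const difference_quotient_tendsto_grad[OF \<phi>])
    show "AE x in lebesgue. norm ((\<phi> (x + ?s k *\<^sub>R c) - \<phi> x) / ?s k * g x)
        \<le> B * norm c * \<bar>C\<bar> * indicat_real ?b x" for k
    proof (rule AE_I2)
      fix x :: 'a
      have s: "0 < ?s k" "?s k \<le> 1" by (simp_all add: inverse_le_1_iff)
      show "norm ((\<phi> (x + ?s k *\<^sub>R c) - \<phi> x) / ?s k * g x) \<le> B * norm c * \<bar>C\<bar> * indicat_real ?b x"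
      proof (cases "x \<in> ?b")
        case True
        have "\<bar>\<phi> (x + ?s k *\<^sub>R c) - \<phi> x\<bar> \<le> B * (?s k * norm c)"
          using B(3)[of "x + ?s k *\<^sub>R c" x] s by (simp add: dist_norm)
        then have "\<bar>\<phi> (x + ?s k *\<^sub>R c) - \<phi> x\<bar> / ?s k \<le> B * norm c"
          using s(1) by (simp only: pos_divide_le_eq mult_ac)
        then have "\<bar>\<phi> (x + ?s k *\<^sub>R c) - \<phi> x\<bar> / ?s k * \<bar>g x\<bar> \<le> B * norm c * \<bar>C\<bar>"
          using g(2)[of x] B(1) by (intro mult_mono) simp_all
        then show ?thesis using True s(1) by (simp only: real_norm_def abs_mult abs_divide abs_of_pos indicator_simps mult_1_right)
      next
        case False
        then have big: "norm x > R + norm c" by (simp add: dist_norm)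
        then have "x \<notin> \<Omega>" using R[of x] norm_ge_zero[of c] by linarith
        moreover have "x + ?s k *\<^sub>R c \<notin> \<Omega>"
        proof
          assume "x + ?s k *\<^sub>R c \<in> \<Omega>"
          then have "norm (x + ?s k *\<^sub>R c) \<le> R" by (rule R)
          moreover have "norm x \<le> norm (x + ?s k *\<^sub>R c) + norm (?s k *\<^sub>R c)"
            using norm_triangle_ineq4[of "x + ?s k *\<^sub>R c" "?s k *\<^sub>R c"] by simp
          moreover have "norm (?s k *\<^sub>R c) \<le> norm c"
            using s mult_left_le_one_le[of "norm c" "?s k"] by simp
          ultimately show False using big by linarith
        qed
        ultimately show ?thesis using test_function_zero_outside[OF \<phi>] False by simp
      qed
    qed
  qed
qed

text \<open>Two limits in the right order: with the step s fixed, the mesh size tends to 0 and leaves an error of order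
  s; then s tends to 0.\<close>

lemma discrete_grad_tendsto_lipschitz:
  assumes \<Omega>: "open \<Omega>" "bounded \<Omega>"
    and M: "\<And>m. is_mesh \<Omega> (M m)" and size: "(\<lambda>m. mesh_size (M m)) \<longlonglongrightarrow> 0"
    and th: "\<theta> \<ge> 0" "\<And>m. theta_grad (M m) \<le> \<theta>" and \<phi>: "\<phi> \<in> test_functions \<Omega>"
    and g: "\<And>x. \<bar>g x\<bar> \<le> C" "\<And>x y. \<bar>g x - g y\<bar> \<le> L * dist x y" and L: "L \<ge> 0"
  shows "(\<lambda>m. LINT x|lebesgue_on \<Omega>. (discrete_grad (M m) \<phi> x \<bullet> c) * g x)
    \<longlonglongrightarrow> (LINT x|lebesgue_on \<Omega>. (grad \<phi> x \<bullet> c) * g x)"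
proof -
  obtain B where B: "B \<ge> 0" "\<And>x. norm (grad \<phi> x) \<le> B" "\<And>x y. \<bar>\<phi> x - \<phi> y\<bar> \<le> B * dist x y"
    using test_function_lipschitz[OF \<phi>] by blast
  have "continuous_on UNIV g"
  proof (rule lipschitz_on_continuous_on[of L])
    show "L-lipschitz_on UNIV g"
      by (rule lipschitz_onI) (use g(2) L in \<open>auto simp: dist_real_def\<close>)
  qed
  then have "g \<in> borel_measurable lborel" by (simp add: borel_measurable_continuous_onI)
  then have gm: "g \<in> borel_measurable lebesgue" by (rule measurable_completion)
  define h where "h m = max 0 (mesh_size (M m))" for m
  have h0: "h \<longlonglongrightarrow> 0"
    unfolding h_def using tendsto_max[OF tendsto_const[of 0] size] by simp
  have hK: "diameter K \<le> h m" if "K \<in> cells (M m)" for K m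
  proof -
    have "diameter K \<le> mesh_size (M m)"
      unfolding mesh_size_def by (rule Max_ge) (use finite_cells[OF M] that in auto)
    then show ?thesis by (simp add: h_def)
  qed
  let ?S = "closure {x. \<phi> x \<noteq> 0}"
  have S: "compact ?S" "?S \<subseteq> \<Omega>" using \<phi> unfolding test_functions_def by blast+
  \<comment> \<open>Once h < d, no cell touching a boundary face has its point in the support of \<open>\<phi>\<close>.\<close>
  have "?S \<inter> - \<Omega> = {}" using S(2) by blast
  then obtain d where d: "d > 0" "\<forall>x\<in>?S. \<forall>y\<in>- \<Omega>. d \<le> dist x y"
    using separate_compact_closed[OF S(1), of "- \<Omega>"] \<Omega>(1) by (auto simp: closed_Compl)
  have ext: "dist x y > h m" if "h m < d" "\<phi> x \<noteq> 0" "y \<notin> \<Omega>" for x y m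
  proof -
    have "x \<in> ?S" using closure_subset[of "{x. \<phi> x \<noteq> 0}"] that(2) by blast
    then have "d \<le> dist x y" using d(2) that(3) by simp
    then show ?thesis using that(1) by simp
  qed
  define V where "V = measure lebesgue \<Omega>"
  define s where "s k = inverse (real (Suc k))" for k
  have s: "s k > 0" for k by (simp add: s_def)
  have s0: "s \<longlonglongrightarrow> 0" unfolding s_def by (rule LIMSEQ_inverse_real_of_nat)
  define Q where "Q k = (LINT x|lebesgue. (\<phi> (x + s k *\<^sub>R c) - \<phi> x) / s k * g x)" for k
  define I where "I m = (LINT x|lebesgue_on \<Omega>. (discrete_grad (M m) \<phi> x \<bullet> c) * g x)" for m
  define Z where "Z = (LINT x|lebesgue_on \<Omega>. (grad \<phi> x \<bullet> c) * g x)"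
  \<comment> \<open>The consistency error divided by the step s k; its limit in m is of order s k.\<close>
  define E where "E k m = (2 * B * h m * C / s k + B * \<theta> * L * (2 * h m + s k * norm c) * norm c) * V" for k m
  have \<Omega>s: "\<Omega> \<inter> space lebesgue \<in> sets lebesgue" using \<Omega>(1) by simp
  have "Z = (LINT x|lebesgue. indicat_real \<Omega> x *\<^sub>R ((grad \<phi> x \<bullet> c) * g x))"
    unfolding Z_def by (rule integral_restrict_space[OF \<Omega>s])
  also have "\<dots> = (LINT x|lebesgue. (grad \<phi> x \<bullet> c) * g x)"
  proof (rule Bochner_Integration.integral_cong[OF refl])
    fix x
    show "indicat_real \<Omega> x *\<^sub>R ((grad \<phi> x \<bullet> c) * g x) = (grad \<phi> x \<bullet> c) * g x"
    proof (cases "x \<in> \<Omega>")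
      case False
      then have "x \<notin> ?S" using S(2) by blast
      then show ?thesis using grad_zero_outside[OF \<phi>] by simp
    qed simp
  qed
  finally have Z: "Z = (LINT x|lebesgue. (grad \<phi> x \<bullet> c) * g x)" .
  have QZ: "Q \<longlonglongrightarrow> Z"
    unfolding Q_def s_def Z by (rule integral_difference_quotient_tendsto[OF \<phi> \<Omega> gm g(1)])
  have key: "\<bar>Q k - I m\<bar> \<le> E k m" if "h m < d" for k m
  proof -
    have "\<bar>(LINT x|lebesgue. (\<phi> (x + s k *\<^sub>R c) - \<phi> x) * g x)
        - (LINT x|lebesgue_on \<Omega>. (discrete_grad (M m) \<phi> x \<bullet> (s k *\<^sub>R c)) * g x)\<bar>
      \<le> (2 * B * h m * C + B * \<theta> * L * (2 * h m + norm (s k *\<^sub>R c)) * norm (s k *\<^sub>R c)) * measure lebesgue \<Omega>"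
      by (rule discrete_grad_consistency[OF M \<Omega> hK th(2,1) B(3,1) test_function_zero_outside[OF \<phi>]
            ext[OF that] borel_test_function[OF \<phi> \<Omega>] integrable_test_function[OF \<phi> \<Omega>] gm g L])
    moreover have "(LINT x|lebesgue. (\<phi> (x + s k *\<^sub>R c) - \<phi> x) * g x) = s k * Q k"
      unfolding Q_def using s[of k] by simp
    moreover have "(LINT x|lebesgue_on \<Omega>. (discrete_grad (M m) \<phi> x \<bullet> (s k *\<^sub>R c)) * g x) = s k * I m"
      unfolding I_def by (simp add: mult.assoc)
    moreover have "(2 * B * h m * C + B * \<theta> * L * (2 * h m + norm (s k *\<^sub>R c)) * norm (s k *\<^sub>R c)) * measure lebesgue \<Omega>
        = s k * E k m"
      unfolding E_def V_def using s[of k] by (simp add: field_simps)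
    ultimately have "\<bar>s k * Q k - s k * I m\<bar> \<le> s k * E k m" by simp
    moreover have "\<bar>s k * Q k - s k * I m\<bar> = s k * \<bar>Q k - I m\<bar>"
      using s[of k] by (simp add: abs_mult flip: right_diff_distrib)
    ultimately show ?thesis using s[of k] by simp
  qed
  have El: "(\<lambda>m. E k m) \<longlonglongrightarrow> (2 * B * 0 * C / s k + B * \<theta> * L * (2 * 0 + s k * norm c) * norm c) * V" for k
    unfolding E_def using s[of k] by (intro tendsto_intros h0) simp
  have F0: "(\<lambda>k. B * \<theta> * L * (s k * norm c) * norm c * V) \<longlonglongrightarrow> B * \<theta> * L * (0 * norm c) * norm c * V"
    by (intro tendsto_intros s0)
  have "I \<longlonglongrightarrow> Z"
  proof (rule LIMSEQ_I)
    fix e :: real assume e: "e > 0"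
    have "\<forall>\<^sub>F k in sequentially. \<bar>Q k - Z\<bar> < e / 2"
      using tendstoD[OF QZ, of "e / 2"] e by (simp add: dist_real_def)
    moreover have "\<forall>\<^sub>F k in sequentially. B * \<theta> * L * (s k * norm c) * norm c * V < e / 2"
      using order_tendstoD(2)[OF F0, of "e / 2"] e by simp
    ultimately have "\<forall>\<^sub>F k in sequentially. \<bar>Q k - Z\<bar> < e / 2 \<and> B * \<theta> * L * (s k * norm c) * norm c * V < e / 2"
      by (rule eventually_conj)
    then obtain k where k: "\<bar>Q k - Z\<bar> < e / 2" "B * \<theta> * L * (s k * norm c) * norm c * V < e / 2"
      using eventually_happens'[OF sequentially_bot] by blast
    have "\<forall>\<^sub>F m in sequentially. E k m < e / 2"
      using order_tendstoD(2)[OF El[of k], of "e / 2"] k(2) by simp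
    moreover have "\<forall>\<^sub>F m in sequentially. h m < d"
      using order_tendstoD(2)[OF h0 d(1)] .
    ultimately have "\<forall>\<^sub>F m in sequentially. norm (I m - Z) < e"
    proof eventually_elim
      case (elim m)
      then show ?case using key[of m k] k(1) by (simp add: abs_if split: if_splits)
    qed
    then show "\<exists>no. \<forall>m\<ge>no. norm (I m - Z) < e" by (simp add: eventually_sequentially)
  qed
  then show ?thesis unfolding I_def Z_def .
qed

section \<open>Weak star convergence from Lipschitz weights\<close>

lemma integrable_inner_bounded:
  fixes G \<psi> :: "'a \<Rightarrow> 'b::euclidean_space"
  assumes G: "G \<in> borel_measurable N" "AE x in N. norm (G x) \<le> C" and \<psi>: "integrable N \<psi>"
  shows "integrable N (\<lambda>x. G x \<bullet> \<psi> x)"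
proof (rule Bochner_Integration.integrable_bound[of _ "\<lambda>x. C * norm (\<psi> x)"])
  show "integrable N (\<lambda>x. C * norm (\<psi> x))" using \<psi> by simp
  show "(\<lambda>x. G x \<bullet> \<psi> x) \<in> borel_measurable N"
    by (rule borel_measurable_inner[OF G(1) borel_measurable_integrable[OF \<psi>]])
  show "AE x in N. norm (G x \<bullet> \<psi> x) \<le> norm (C * norm (\<psi> x))"
    using G(2)
  proof eventually_elim
    case (elim x)
    have "\<bar>G x \<bullet> \<psi> x\<bar> \<le> norm (G x) * norm (\<psi> x)" by (rule Cauchy_Schwarz_ineq2)
    also have "\<dots> \<le> C * norm (\<psi> x)" by (rule mult_right_mono[OF elim]) simp
    finally show ?case by simp
  qed
qed

lemma integral_inner_bounded_le:
  fixes G \<psi> :: "'a \<Rightarrow> 'b::euclidean_space"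
  assumes G: "G \<in> borel_measurable N" "AE x in N. norm (G x) \<le> C" and \<psi>: "integrable N \<psi>"
  shows "\<bar>LINT x|N. G x \<bullet> \<psi> x\<bar> \<le> C * (LINT x|N. norm (\<psi> x))"
proof -
  have "\<bar>LINT x|N. G x \<bullet> \<psi> x\<bar> \<le> (LINT x|N. \<bar>G x \<bullet> \<psi> x\<bar>)" by (rule integral_abs_bound)
  also have "\<dots> \<le> (LINT x|N. C * norm (\<psi> x))"
  proof (rule integral_mono_AE)
    show "AE x in N. \<bar>G x \<bullet> \<psi> x\<bar> \<le> C * norm (\<psi> x)"
      using G(2)
    proof eventually_elim
      case (elim x)
      show ?case
        using Cauchy_Schwarz_ineq2[of "G x" "\<psi> x"] mult_right_mono[OF elim, of "norm (\<psi> x)"] by simp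
    qed
  qed (use integrable_inner_bounded[OF G \<psi>] \<psi> in auto)
  finally show ?thesis by simp
qed

text \<open>Uniform boundedness makes the set of test functions on which convergence holds closed in the
  integral norm.\<close>

lemma bounded_weak_limit_closure:
  fixes G :: "nat \<Rightarrow> 'a \<Rightarrow> 'b::euclidean_space"
  assumes G: "\<And>m. G m \<in> borel_measurable N" "\<And>m. AE x in N. norm (G m x) \<le> C"
    and F: "F \<in> borel_measurable N" "AE x in N. norm (F x) \<le> C"
    and \<psi>: "integrable N \<psi>"
    and appr: "\<And>e. e > 0 \<Longrightarrow> \<exists>\<eta>. integrable N \<eta> \<and> (LINT x|N. norm (\<psi> x - \<eta> x)) < e \<and>
        (\<lambda>m. LINT x|N. G m x \<bullet> \<eta> x) \<longlonglongrightarrow> (LINT x|N. F x \<bullet> \<eta> x)"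
  shows "(\<lambda>m. LINT x|N. G m x \<bullet> \<psi> x) \<longlonglongrightarrow> (LINT x|N. F x \<bullet> \<psi> x)"
proof (rule LIMSEQ_I)
  fix e :: real assume e: "e > 0"
  define D where "D = \<bar>C\<bar> + 1"
  have D: "D > 0" "C \<le> D" by (simp_all add: D_def)
  obtain \<eta> where \<eta>: "integrable N \<eta>" "(LINT x|N. norm (\<psi> x - \<eta> x)) < e / (3 * D)"
    "(\<lambda>m. LINT x|N. G m x \<bullet> \<eta> x) \<longlonglongrightarrow> (LINT x|N. F x \<bullet> \<eta> x)"
    using appr[of "e / (3 * D)"] e D by auto
  have near: "\<bar>(LINT x|N. H x \<bullet> \<psi> x) - (LINT x|N. H x \<bullet> \<eta> x)\<bar> < e / 3"
    if H: "H \<in> borel_measurable N" "AE x in N. norm (H x) \<le> C" for H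
  proof -
    have i: "integrable N (\<lambda>x. \<psi> x - \<eta> x)" using \<psi> \<eta>(1) by simp
    have "(LINT x|N. H x \<bullet> \<psi> x) - (LINT x|N. H x \<bullet> \<eta> x) = (LINT x|N. H x \<bullet> (\<psi> x - \<eta> x))"
      using integrable_inner_bounded[OF H \<psi>] integrable_inner_bounded[OF H \<eta>(1)]
      by (simp add: inner_diff_right)
    also have "\<bar>\<dots>\<bar> \<le> C * (LINT x|N. norm (\<psi> x - \<eta> x))"
      by (rule integral_inner_bounded_le[OF H i])
    also have "\<dots> \<le> D * (LINT x|N. norm (\<psi> x - \<eta> x))"
      by (rule mult_right_mono[OF D(2)]) simp
    also have "\<dots> < D * (e / (3 * D))" using \<eta>(2) D(1) by (rule mult_strict_left_mono)
    also have "\<dots> = e / 3" using D(1) by simp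
    finally show ?thesis .
  qed
  have "\<exists>no. \<forall>m\<ge>no. norm ((LINT x|N. G m x \<bullet> \<eta> x) - (LINT x|N. F x \<bullet> \<eta> x)) < e / 3"
    using LIMSEQ_D[OF \<eta>(3), of "e / 3"] e by simp
  then obtain no where no: "\<forall>m\<ge>no. \<bar>(LINT x|N. G m x \<bullet> \<eta> x) - (LINT x|N. F x \<bullet> \<eta> x)\<bar> < e / 3"
    by auto
  have "norm ((LINT x|N. G m x \<bullet> \<psi> x) - (LINT x|N. F x \<bullet> \<psi> x)) < e" if "m \<ge> no" for m
  proof -
    have "\<bar>(LINT x|N. G m x \<bullet> \<eta> x) - (LINT x|N. F x \<bullet> \<eta> x)\<bar> < e / 3" using no that by blast
    with near[OF G(1,2)[of m]] near[OF F] show ?thesis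
      unfolding real_norm_def by linarith
  qed
  then show "\<exists>no. \<forall>m\<ge>no. norm ((LINT x|N. G m x \<bullet> \<psi> x) - (LINT x|N. F x \<bullet> \<psi> x)) < e" by blast
qed

text \<open>Shrink A to a closed set T and use max 0 (1 - k dist(x, T)) for large k.\<close>

lemma approximate_indicator_by_lipschitz:
  fixes A \<Omega> :: "'a::euclidean_space set"
  assumes \<Omega>: "\<Omega> \<in> lmeasurable" and A: "A \<in> sets (lebesgue_on \<Omega>)" and e: "e > 0"
  shows "\<exists>(g :: 'a \<Rightarrow> real) L. L \<ge> 0 \<and> (\<forall>x. \<bar>g x\<bar> \<le> 1) \<and> (\<forall>x y. \<bar>g x - g y\<bar> \<le> L * dist x y) \<and>
    (LINT x|lebesgue_on \<Omega>. \<bar>indicat_real A x - g x\<bar>) < e"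
proof -
  let ?N = "lebesgue_on \<Omega>"
  interpret finite_measure ?N by (rule finite_measure_lebesgue_on[OF \<Omega>])
  have \<Omega>s: "\<Omega> \<inter> space lebesgue \<in> sets lebesgue" using \<Omega> by (auto simp: fmeasurable_def)
  have A': "A \<subseteq> \<Omega>" "A \<in> sets lebesgue" using A sets_restrict_space_iff[OF \<Omega>s] by auto
  obtain T where T: "closed T" "T \<subseteq> A" "A - T \<in> lmeasurable" "emeasure lebesgue (A - T) < ennreal (e / 2)"
    using sets_lebesgue_inner_closed[OF A'(2), of "e / 2"] e by auto
  have Ts: "T \<in> sets ?N" "A - T \<in> sets ?N"
    using T A' sets_restrict_space_iff[OF \<Omega>s] by (auto simp: fmeasurable_def)
  have "measure ?N (A - T) = measure lebesgue (A - T)"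
    by (rule measure_restrict_space[OF \<Omega>s]) (use A' in blast)
  also have "\<dots> < e / 2"
  proof -
    have "emeasure lebesgue (A - T) = ennreal (measure lebesgue (A - T))"
      using fmeasurableD2[OF T(3)] by (rule emeasure_eq_ennreal_measure)
    then show ?thesis using T(4) by (simp add: ennreal_less_iff)
  qed
  finally have mAT: "measure ?N (A - T) < e / 2" .
  \<comment> \<open>The distance to the empty set is 0 by convention, which would give the constant 1.\<close>
  define g where "g k x = (if T = {} then 0 else max 0 (1 - real k * infdist x T))" for k x
  have g1: "\<bar>g k x\<bar> \<le> 1" for k x
    by (simp add: g_def infdist_nonneg)
  have gl: "\<bar>g k x - g k y\<bar> \<le> real k * dist x y" for k x y
  proof -
    have "\<bar>real k * infdist x T - real k * infdist y T\<bar> \<le> real k * dist x y"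
      using mult_left_mono[OF infdist_triangle_abs[of x T y], of "real k"]
      by (simp add: abs_mult flip: right_diff_distrib)
    moreover have "\<bar>max 0 (1 - a) - max 0 (1 - b)\<bar> \<le> \<bar>a - b\<bar>" for a b :: real
      by (simp add: max_def abs_if)
    ultimately show ?thesis unfolding g_def
      by (cases "T = {}") (auto intro: order_trans)
  qed
  have glim: "(\<lambda>k. g k x) \<longlonglongrightarrow> indicat_real T x" for x
  proof (cases "x \<in> T")
    case True
    then have "g k x = 1" for k by (auto simp: g_def)
    then show ?thesis using True by simp
  next
    case False
    have "\<forall>\<^sub>F k in sequentially. g k x = 0"
    proof (cases "T = {}")
      case False
      with \<open>x \<notin> T\<close> T(1) have "infdist x T > 0"
        using in_closed_iff_infdist_zero[of T x] infdist_nonneg[of x T] by fastforce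
      then obtain k0 where "1 < real k0 * infdist x T" using reals_Archimedean3 by blast
      then have "1 \<le> real k * infdist x T" if "k \<ge> k0" for k
        using mult_right_mono[of "real k0" "real k" "infdist x T"] that infdist_nonneg[of x T] by simp
      then have "g k x = 0" if "k \<ge> k0" for k using that by (simp add: g_def)
      then show ?thesis unfolding eventually_sequentially by blast
    qed (simp add: g_def)
    then show ?thesis using \<open>x \<notin> T\<close> by (simp add: tendsto_eventually)
  qed
  have gm: "g k \<in> borel_measurable ?N" for k
  proof -
    have "continuous_on UNIV (g k)"
      by (rule lipschitz_on_continuous_on[of "real k"], rule lipschitz_onI)
         (use gl[of k] in \<open>auto simp: dist_real_def\<close>)
    then have "g k \<in> borel_measurable lborel" by (simp add: borel_measurable_continuous_onI)
    then show ?thesis by (intro measurable_restrict_space1 measurable_completion)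
  qed
  have iT: "integrable ?N (indicat_real T)" "integrable ?N (indicat_real (A - T))"
    using Ts by (intro integrable_real_indicator; simp add: emeasure_eq_measure)+
  have ig: "integrable ?N (g k)" for k
    by (rule integrable_const_bound[of _ 1]) (use g1[of k] gm[of k] in auto)
  have "(\<lambda>k. LINT x|?N. \<bar>indicat_real T x - g k x\<bar>) \<longlonglongrightarrow> (LINT x|?N. 0)"
  proof (rule integral_dominated_convergence[where w="\<lambda>_. 2"])
    show "(\<lambda>x. \<bar>indicat_real T x - g k x\<bar>) \<in> borel_measurable ?N" for k
      using gm[of k] borel_measurable_integrable[OF iT(1)] by measurable
    show "AE x in ?N. (\<lambda>k. \<bar>indicat_real T x - g k x\<bar>) \<longlonglongrightarrow> 0"
    proof (rule AE_I2)
      fix x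
      have "(\<lambda>k. \<bar>indicat_real T x - g k x\<bar>) \<longlonglongrightarrow> \<bar>indicat_real T x - indicat_real T x\<bar>"
        by (intro tendsto_intros glim)
      then show "(\<lambda>k. \<bar>indicat_real T x - g k x\<bar>) \<longlonglongrightarrow> 0" by simp
    qed
    show "AE x in ?N. norm \<bar>indicat_real T x - g k x\<bar> \<le> 2" for k
    proof (rule AE_I2)
      fix x
      have "\<bar>indicat_real T x\<bar> \<le> 1" by (simp add: indicator_def)
      then show "norm \<bar>indicat_real T x - g k x\<bar> \<le> 2"
        using g1[of k x] abs_triangle_ineq4[of "indicat_real T x" "g k x"] unfolding real_norm_def by linarith
    qed
  qed simp_all
  then have "\<forall>\<^sub>F k in sequentially. (LINT x|?N. \<bar>indicat_real T x - g k x\<bar>) < e / 2"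
    using order_tendstoD(2)[of _ "0::real" sequentially "e / 2"] e by simp
  then obtain k where k: "(LINT x|?N. \<bar>indicat_real T x - g k x\<bar>) < e / 2"
    using eventually_happens'[OF sequentially_bot] by blast
  have "(LINT x|?N. \<bar>indicat_real A x - g k x\<bar>) = (LINT x|?N. \<bar>indicat_real (A - T) x + (indicat_real T x - g k x)\<bar>)"
    using T(2) by (intro Bochner_Integration.integral_cong) (auto simp: indicator_def)
  also have "\<dots> \<le> (LINT x|?N. indicat_real (A - T) x + \<bar>indicat_real T x - g k x\<bar>)"
  proof (rule integral_mono)
    show "integrable ?N (\<lambda>x. \<bar>indicat_real (A - T) x + (indicat_real T x - g k x)\<bar>)"
      "integrable ?N (\<lambda>x. indicat_real (A - T) x + \<bar>indicat_real T x - g k x\<bar>)"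
      using iT ig[of k] by auto
    show "\<bar>indicat_real (A - T) x + (indicat_real T x - g k x)\<bar> \<le> indicat_real (A - T) x + \<bar>indicat_real T x - g k x\<bar>" for x
      using abs_triangle_ineq[of "indicat_real (A - T) x" "indicat_real T x - g k x"] by simp
  qed
  also have "\<dots> = measure ?N (A - T) + (LINT x|?N. \<bar>indicat_real T x - g k x\<bar>)"
    using iT ig[of k] Ts A'(1) by (simp add: Int_absorb2 subset_trans[OF Diff_subset])
  also have "\<dots> < e" using mAT k by simp
  finally have "(LINT x|?N. \<bar>indicat_real A x - g k x\<bar>) < e" .
  then show ?thesis using g1[of k] gl[of k] by (intro exI[of _ "g k"] exI[of _ "real k"]) simp
qed

text \<open>Lipschitz functions times constant vectors span a dense subspace of the integrable functions.\<close>

lemma weak_star_from_lipschitz: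
  fixes G :: "nat \<Rightarrow> 'a::euclidean_space \<Rightarrow> 'a"
  assumes \<Omega>: "\<Omega> \<in> lmeasurable"
    and G: "\<And>m. G m \<in> borel_measurable (lebesgue_on \<Omega>)" "\<And>m. AE x in lebesgue_on \<Omega>. norm (G m x) \<le> C"
    and F: "F \<in> borel_measurable (lebesgue_on \<Omega>)" "AE x in lebesgue_on \<Omega>. norm (F x) \<le> C"
    and lip: "\<And>c g L. L \<ge> 0 \<Longrightarrow> (\<And>x. \<bar>g x\<bar> \<le> 1) \<Longrightarrow> (\<And>x y. \<bar>g x - g y\<bar> \<le> L * dist x y) \<Longrightarrow>
      (\<lambda>m. LINT x|lebesgue_on \<Omega>. (G m x \<bullet> c) * g x) \<longlonglongrightarrow> (LINT x|lebesgue_on \<Omega>. (F x \<bullet> c) * g x)"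
    and \<psi>: "integrable (lebesgue_on \<Omega>) \<psi>"
  shows "(\<lambda>m. LINT x|lebesgue_on \<Omega>. G m x \<bullet> \<psi> x) \<longlonglongrightarrow> (LINT x|lebesgue_on \<Omega>. F x \<bullet> \<psi> x)"
  using \<psi>
proof (induction rule: integrable_induct)
  case (base A c)
  let ?N = "lebesgue_on \<Omega>"
  interpret finite_measure ?N by (rule finite_measure_lebesgue_on[OF \<Omega>])
  have iA: "integrable ?N (indicat_real A)"
    using base by (intro integrable_real_indicator) auto
  show ?case
  proof (rule bounded_weak_limit_closure[OF G F])
    show "integrable ?N (\<lambda>x. indicat_real A x *\<^sub>R c)" using iA by (rule integrable_scaleR_left)
    fix e :: real assume e: "e > 0"
    define D where "D = norm c + 1"
    have D: "D > 0" "norm c \<le> D" by (simp_all add: D_def add_nonneg_pos)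
    have "e / D > 0" using e D(1) by simp
    from approximate_indicator_by_lipschitz[OF \<Omega> base(1) this]
    obtain g :: "'a \<Rightarrow> real" and L where g': "L \<ge> 0" "\<forall>x. \<bar>g x\<bar> \<le> 1" "\<forall>x y. \<bar>g x - g y\<bar> \<le> L * dist x y"
      "(LINT x|?N. \<bar>indicat_real A x - g x\<bar>) < e / D"
      by (elim exE conjE)
    note g = g'(1) g'(2)[rule_format] g'(3)[rule_format] g'(4)
    have gm: "g \<in> borel_measurable ?N"
    proof -
      have "continuous_on UNIV g"
        by (rule lipschitz_on_continuous_on[of L], rule lipschitz_onI)
           (use g(1,3) in \<open>auto simp: dist_real_def\<close>)
      then have "g \<in> borel_measurable lborel" by (simp add: borel_measurable_continuous_onI)
      then show ?thesis by (intro measurable_restrict_space1 measurable_completion)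
    qed
    have ig: "integrable ?N g" by (rule integrable_const_bound[of _ 1]) (use g(2) gm in auto)
    show "\<exists>\<eta>. integrable ?N \<eta> \<and> (LINT x|?N. norm (indicat_real A x *\<^sub>R c - \<eta> x)) < e \<and>
        (\<lambda>m. LINT x|?N. G m x \<bullet> \<eta> x) \<longlonglongrightarrow> (LINT x|?N. F x \<bullet> \<eta> x)"
    proof (intro exI[of _ "\<lambda>x. g x *\<^sub>R c"] conjI)
      show "integrable ?N (\<lambda>x. g x *\<^sub>R c)" using ig by (rule integrable_scaleR_left)
      have "(LINT x|?N. norm (indicat_real A x *\<^sub>R c - g x *\<^sub>R c)) = (LINT x|?N. \<bar>indicat_real A x - g x\<bar> * norm c)"
        by (simp flip: scaleR_diff_left)
      also have "\<dots> = (LINT x|?N. \<bar>indicat_real A x - g x\<bar>) * norm c" by simp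
      also have "\<dots> \<le> (LINT x|?N. \<bar>indicat_real A x - g x\<bar>) * D"
        by (rule mult_left_mono[OF D(2)]) simp
      also have "\<dots> < e" using g(4) D(1) by (simp add: pos_less_divide_eq)
      finally show "(LINT x|?N. norm (indicat_real A x *\<^sub>R c - g x *\<^sub>R c)) < e" .
      show "(\<lambda>m. LINT x|?N. G m x \<bullet> g x *\<^sub>R c) \<longlonglongrightarrow> (LINT x|?N. F x \<bullet> g x *\<^sub>R c)"
        using lip[OF g(1-3), of c] by (simp add: mult.commute)
    qed
  qed
next
  case (add f h)
  have "(LINT x|lebesgue_on \<Omega>. H x \<bullet> (f x + h x)) = (LINT x|lebesgue_on \<Omega>. H x \<bullet> f x) + (LINT x|lebesgue_on \<Omega>. H x \<bullet> h x)"
    if H: "H \<in> borel_measurable (lebesgue_on \<Omega>)" "AE x in lebesgue_on \<Omega>. norm (H x) \<le> C" for H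
    using integrable_inner_bounded[OF H add.hyps(1)] integrable_inner_bounded[OF H add.hyps(2)]
    by (simp add: inner_add_right)
  then show ?case
    using tendsto_add[OF add.IH] G F by simp
next
  case (lim f s)
  let ?N = "lebesgue_on \<Omega>"
  show ?case
  proof (rule bounded_weak_limit_closure[OF G F])
    show f: "integrable ?N f" by (rule lim.hyps(4))
    fix e :: real assume e: "e > 0"
    have "(\<lambda>i. LINT x|?N. norm (f x - s i x)) \<longlonglongrightarrow> (LINT x|?N. 0)"
    proof (rule integral_dominated_convergence[where w="\<lambda>x. 3 * norm (f x)"])
      show "(\<lambda>x. norm (f x - s i x)) \<in> borel_measurable ?N" for i
        using f lim.hyps(1)[of i] by (intro borel_measurable_integrable integrable_norm Bochner_Integration.integrable_diff)
      show "integrable ?N (\<lambda>x. 3 * norm (f x))" using f by simp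
      show "AE x in ?N. (\<lambda>i. norm (f x - s i x)) \<longlonglongrightarrow> 0"
      proof (rule AE_I2)
        fix x assume "x \<in> space ?N"
        then have "(\<lambda>i. norm (f x - s i x)) \<longlonglongrightarrow> norm (f x - f x)"
          by (intro tendsto_intros lim.hyps(2))
        then show "(\<lambda>i. norm (f x - s i x)) \<longlonglongrightarrow> 0" by simp
      qed
      show "AE x in ?N. norm (norm (f x - s i x)) \<le> 3 * norm (f x)" for i
      proof (rule AE_I2)
        fix x assume "x \<in> space ?N"
        then show "norm (norm (f x - s i x)) \<le> 3 * norm (f x)"
          using lim.hyps(3)[of x i] norm_triangle_ineq4[of "f x" "s i x"] by simp
      qed
    qed simp
    then have "\<forall>\<^sub>F i in sequentially. (LINT x|?N. norm (f x - s i x)) < e"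
      using order_tendstoD(2)[of _ "0::real" sequentially e] e by simp
    then obtain i where "(LINT x|?N. norm (f x - s i x)) < e"
      using eventually_happens'[OF sequentially_bot] by blast
    then show "\<exists>\<eta>. integrable ?N \<eta> \<and> (LINT x|?N. norm (f x - \<eta> x)) < e \<and>
        (\<lambda>m. LINT x|?N. G m x \<bullet> \<eta> x) \<longlonglongrightarrow> (LINT x|?N. F x \<bullet> \<eta> x)"
      using lim.hyps(1)[of i] lim.IH[of i] by blast
  qed
qed

section \<open>Boundedness and convergence of the discrete gradients\<close>

text \<open>Almost every point lies in at most one dual cell, so a bound on each face value suffices.\<close>

lemma AE_norm_discrete_grad_le:
  assumes M: "is_mesh \<Omega> M" and th: "theta_grad M \<le> \<theta>" "\<theta> \<ge> 0"
    and lip: "\<And>x y. \<bar>\<phi> x - \<phi> y\<bar> \<le> B * dist x y" and B: "B \<ge> 0"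
  shows "AE x in lebesgue. norm (discrete_grad M \<phi> x) \<le> B * \<theta>"
proof -
  have neg: "negligible (dual_cell M \<sigma> \<inter> dual_cell M \<tau>)" if "\<sigma> \<in> all_faces M" "\<tau> \<in> all_faces M" "\<sigma> \<noteq> \<tau>" for \<sigma> \<tau>
    using is_mesh_null_partition_dual[OF M] that unfolding null_partition_def by simp
  have "AE x in lebesgue. \<forall>\<sigma>\<in>all_faces M. \<forall>\<tau>\<in>all_faces M. \<sigma> \<noteq> \<tau> \<longrightarrow> x \<notin> dual_cell M \<sigma> \<inter> dual_cell M \<tau>"
    by (intro AE_finite_allI finite_all_faces[OF M] AE_impI AE_not_mem_negligible neg)
  then show ?thesis
  proof eventually_elim
    case (elim x)
    show ?case
    proof (cases "\<exists>\<sigma>\<in>all_faces M. x \<in> dual_cell M \<sigma>")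
      case True
      then obtain \<sigma> where \<sigma>: "\<sigma> \<in> all_faces M" "x \<in> dual_cell M \<sigma>" by blast
      have "discrete_grad M \<phi> x = (\<Sum>\<tau>\<in>{\<sigma>}. indicat_real (dual_cell M \<tau>) x *\<^sub>R face_grad M \<phi> \<tau>)"
        unfolding discrete_grad_def
      proof (rule sum.mono_neutral_right[OF finite_all_faces[OF M]])
        show "\<forall>\<tau>\<in>all_faces M - {\<sigma>}. indicat_real (dual_cell M \<tau>) x *\<^sub>R face_grad M \<phi> \<tau> = 0"
        proof
          fix \<tau> assume "\<tau> \<in> all_faces M - {\<sigma>}"
          then have "x \<notin> dual_cell M \<tau>" using elim \<sigma> by blast
          then show "indicat_real (dual_cell M \<tau>) x *\<^sub>R face_grad M \<phi> \<tau> = 0" by simp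
        qed
      qed (use \<sigma> in simp)
      then have "discrete_grad M \<phi> x = face_grad M \<phi> \<sigma>" using \<sigma> by simp
      then show ?thesis using norm_face_grad_le[OF M th lip B] by simp
    next
      case False
      then have "discrete_grad M \<phi> x = 0" unfolding discrete_grad_def by (intro sum.neutral) simp
      then show ?thesis using th B by simp
    qed
  qed
qed

lemma measurable_discrete_grad:
  assumes "is_mesh \<Omega> M"
  shows "discrete_grad M \<phi> \<in> borel_measurable lebesgue"
proof -
  have "dual_cell M \<sigma> \<in> sets lebesgue" if "\<sigma> \<in> all_faces M" for \<sigma>
    using is_mesh_null_partition_dual[OF assms] that unfolding null_partition_def by simp
  then show ?thesis
    unfolding discrete_grad_def[abs_def]
    by (intro borel_measurable_sum borel_measurable_scaleR borel_measurable_const borel_measurable_indicator)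
qed

lemma
  assumes m: "f \<in> borel_measurable (lebesgue_on \<Omega>)"
    and b: "AE x in lebesgue_on \<Omega>. norm (f x) \<le> C"
  shows Linf_norm_le: "Linf_norm \<Omega> f \<le> ereal C"
    and Linf_memI: "f \<in> Linf \<Omega>"
proof -
  have "(\<lambda>x. ereal (norm (f x))) \<in> borel_measurable (lebesgue_on \<Omega>)" using m by measurable
  then show le: "Linf_norm \<Omega> f \<le> ereal C"
    unfolding Linf_norm_def by (rule esssup_I) (use b in simp)
  then have "Linf_norm \<Omega> f < \<infinity>" by (rule le_less_trans) simp
  then show "f \<in> Linf \<Omega>" using m unfolding Linf_def by simp
qed

theorem lemma3p1:
  fixes \<Omega> :: "'a::euclidean_space set"
    and M :: "nat \<Rightarrow> 'a mesh"
    and \<theta> :: real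
    and \<phi> :: "'a \<Rightarrow> real"
  assumes "open \<Omega>" and "bounded \<Omega>" and "polyhedral \<Omega>"
    and "\<And>m. is_mesh \<Omega> (M m)"
    and "(\<lambda>m. mesh_size (M m)) \<longlonglongrightarrow> 0"
    and "\<theta> \<ge> 0"
    and "\<And>m. theta_grad (M m) \<le> \<theta>"
    and "\<phi> \<in> test_functions \<Omega>"
  shows "Linf_bounded \<Omega> (\<lambda>m. discrete_grad (M m) \<phi>) \<and>
         Linf_weak_star \<Omega> (\<lambda>m. discrete_grad (M m) \<phi>) (grad \<phi>)"
proof -
  note \<Omega> = assms(1,2) and M = assms(4) and th = assms(7,6) and \<phi> = assms(8)
  let ?N = "lebesgue_on \<Omega>" and ?G = "\<lambda>m. discrete_grad (M m) \<phi>"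
  obtain B where B: "B \<ge> 0" "\<And>x. norm (grad \<phi> x) \<le> B" "\<And>x y. \<bar>\<phi> x - \<phi> y\<bar> \<le> B * dist x y"
    using test_function_lipschitz[OF \<phi>] by blast
  define C where "C = max B (B * \<theta>)"
  have \<Omega>s: "\<Omega> \<inter> space lebesgue \<in> sets lebesgue" using \<Omega>(1) by simp
  have Gm: "?G m \<in> borel_measurable ?N" for m
    by (rule measurable_restrict_space1[OF measurable_discrete_grad[OF M]])
  have ae: "AE x in lebesgue. norm (?G m x) \<le> C" for m
    using AE_norm_discrete_grad_le[OF M th B(3,1), of m] by eventually_elim (simp add: C_def)
  have Gb: "AE x in ?N. norm (?G m x) \<le> C" for m
    unfolding AE_restrict_space_iff[OF \<Omega>s] using ae[of m] by eventually_elim simp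
  have "grad \<phi> \<in> borel_measurable lborel"
    using borel_measurable_continuous_onI[OF continuous_grad[OF \<phi>]] by simp
  then have Fm: "grad \<phi> \<in> borel_measurable ?N"
    by (intro measurable_restrict_space1 measurable_completion)
  have Fb: "AE x in ?N. norm (grad \<phi> x) \<le> C"
    by (rule AE_I2) (use B(2) in \<open>simp add: C_def max.coboundedI1\<close>)
  have conv: "(\<lambda>m. LINT x|?N. ?G m x \<bullet> \<psi> x) \<longlonglongrightarrow> (LINT x|?N. grad \<phi> x \<bullet> \<psi> x)"
    if "integrable ?N \<psi>" for \<psi>
  proof (rule weak_star_from_lipschitz[OF lmeasurable_open[OF \<Omega>(2,1)] Gm Gb Fm Fb _ that])
    fix c :: 'a and g :: "'a \<Rightarrow> real" and L
    assume g: "L \<ge> 0" "\<And>x. \<bar>g x\<bar> \<le> 1" "\<And>x y. \<bar>g x - g y\<bar> \<le> L * dist x y"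
    show "(\<lambda>m. LINT x|?N. (?G m x \<bullet> c) * g x) \<longlonglongrightarrow> (LINT x|?N. (grad \<phi> x \<bullet> c) * g x)"
      by (rule discrete_grad_tendsto_lipschitz[OF \<Omega> M assms(5,6,7) \<phi> g(2,3,1)])
  qed
  have "?G m \<in> Linf \<Omega>" "Linf_norm \<Omega> (?G m) \<le> ereal C" for m
    using Linf_memI[OF Gm Gb] Linf_norm_le[OF Gm Gb] by auto
  moreover have "grad \<phi> \<in> Linf \<Omega>" by (rule Linf_memI[OF Fm Fb])
  ultimately show ?thesis
    unfolding Linf_bounded_def Linf_weak_star_def using conv by blast
qed

end
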